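(* Let $d\ge 2$, $\nu>0$, $\frac d2+1<p<\infty$, and let $u$ be a strong solution to the incompressible Navier–Stokes equations with initial value $u_0\in L^\infty(\mathbb R^d)$ and maximal lifespan $T_{max}$, satisfying $$|u(x,t)|+\sqrt{\nu t}\,|\nabla u(x,t)|\le h(t)\,\langle x\rangle^{-p},\qquad (x,t)\in\mathbb R^d\times[0,T_{max}),$$ for some non-decreasing function $h:[0,T_{max})\to[0,\infty)$. Then for any integer $N$ with $1\le N<2p-d-1$ and all $(x,t)\in\{x:|x|\ge1\}\times[0,T_{max})$, $$u(x,t)=G_{\nu t}*u_0(x)-\sum_{|\alpha|=0}^{N}\frac{(-1)^{|\alpha|}}{\alpha!}\sum_{i,j=1}^d\nabla\partial^\alpha\mathrm K_{i,j}(x)\int_0^t\mathrm M_\alpha^{i,j}(s)\,ds+\mathrm R_1(x,t)+\mathrm R_2(x,t),$$ where the remainders satisfy, for any $[0,T']\subset[0,T_{max})$, $$\sup_{t\in[0,T']}|\mathrm R_1(x,t)|=O\big(|x|^{-d-N-1}\big),\qquad \sup_{t\in[0,T']}|\mathrm R_2(x,t)|=O\big(|x|^{-2p}\big)\qquad\text{as }|x|\to\infty.$$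
   Context: $\langle x\rangle:=1+|x|$ and $G_t(x)=(4\pi t)^{-d/2}e^{-|x|^2/(4t)}$. $\Gamma$ is the fundamental solution of the Laplacian, $-\Delta\Gamma=\delta_0$ on $\mathbb R^d$, and $\mathrm K_{i,j}:=\partial_i\partial_j\Gamma$. The moments are $\mathrm M_\alpha^{i,j}(t):=\int_{\mathbb R^d}y^\alpha u^i(y,t)u^j(y,t)\,dy$, $\alpha\in\mathbb N_0^d$. The incompressible Navier–Stokes system on $\mathbb R^d$ with viscosity $\nu>0$ is $\partial_tu+\mathrm{div}(u\otimes u)+\nabla p=\nu\Delta u$, $\mathrm{div}\,u=0$ (here $p$ is the pressure, not the exponent). For $d\le r\le\infty$, $u\in C([0,T);L^r)$ is the strong (mild) solution arising from $u_0\in L^r$ if $$u(x,t)=G_{\nu t}*u_0(x)-\int_0^tG_{\nu(t-s)}*\mathcal P\,\mathrm{div}\big(u(s)\otimes u(s)\big)(x)\,ds$$ holds in $C([0,T);L^r)$ and for a.e. $(x,t)\in\mathbb R^d\times[0,T)$, where $\mathcal P=\mathrm{Id}+\nabla(-\Delta)^{-1}\mathrm{div}$ is the Leray projector. For $u_0\in L^\infty$ the maximal lifespan is $T_{max}:=\sup\{T>0:\ \text{there exists a unique solution }u\in C([0,T];L^\infty)\text{ with }u(0)=u_0\}$. At $t=0$ the term $G_{\nu t}*u_0$ is read as $u_0$, and the term $\sqrt{\nu t}\,|\nabla u(x,t)|$ as $0$. *)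

theory Defs
  imports "HOL-Analysis.Analysis" "HOL-Probability.Essential_Supremum"
begin

definition partial :: "'d \<Rightarrow> (real ^ 'd \<Rightarrow> real) \<Rightarrow> real ^ 'd \<Rightarrow> real" where
  "partial i f x = deriv (\<lambda>s. f (x + s *\<^sub>R axis i 1)) 0"

definition grad :: "(real ^ 'd \<Rightarrow> real) \<Rightarrow> real ^ 'd \<Rightarrow> real ^ 'd" where
  "grad f x = (\<chi> k. partial k f x)"

definition divergence :: "(real ^ 'd \<Rightarrow> real ^ 'd) \<Rightarrow> real ^ 'd \<Rightarrow> real" where
  "divergence v x = (\<Sum>i\<in>UNIV. partial i (\<lambda>y. v y $ i) x)"

definition matrix_div :: "(real ^ 'd \<Rightarrow> real ^ 'd ^ 'd) \<Rightarrow> real ^ 'd \<Rightarrow> real ^ 'd" where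
  "matrix_div W x = (\<chi> k. \<Sum>j\<in>UNIV. partial j (\<lambda>y. W y $ k $ j) x)"

definition outer :: "real ^ 'd \<Rightarrow> real ^ 'd \<Rightarrow> real ^ 'd ^ 'd" where
  "outer v w = (\<chi> i j. v $ i * w $ j)"

type_synonym 'd multi_index = "'d \<Rightarrow> nat"

definition mi_abs :: "'d::finite multi_index \<Rightarrow> nat" where
  "mi_abs \<alpha> = (\<Sum>i\<in>UNIV. \<alpha> i)"

definition mi_fact :: "'d::finite multi_index \<Rightarrow> real" where
  "mi_fact \<alpha> = (\<Prod>i\<in>UNIV. fact (\<alpha> i))"

definition mi_power :: "real ^ 'd \<Rightarrow> 'd multi_index \<Rightarrow> real" where
  "mi_power y \<alpha> = (\<Prod>i\<in>UNIV. (y $ i) ^ \<alpha> i)"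

text \<open>The index type carries no order, so the partial derivatives are taken along some enumeration
  of it. The choice is immaterial where the function is smooth.\<close>

definition mi_partial :: "'d multi_index \<Rightarrow> (real ^ 'd \<Rightarrow> real) \<Rightarrow> real ^ 'd \<Rightarrow> real" where
  "mi_partial \<alpha> f =
     foldr (\<lambda>i. partial i ^^ \<alpha> i) (SOME is. distinct is \<and> set is = (UNIV :: 'd set)) f"

text \<open>\<open>- \<Delta> \<Gamma> = \<delta>\<^sub>0\<close> in dimension at least 2; \<open>d * unit_ball_vol d\<close> is the area of the unit sphere.
  The value at the origin is irrelevant.\<close>

definition newton :: "real ^ 'd \<Rightarrow> real" where
  "newton x = (let d = real CARD('d) in
     if CARD('d) = 2 then - ln (norm x) / (2 * pi)
     else norm x powr (2 - d) / (d * (d - 2) * unit_ball_vol d))"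

definition K :: "'d \<Rightarrow> 'd \<Rightarrow> real ^ 'd \<Rightarrow> real" where
  "K i j = partial i (partial j newton)"

definition heat_kernel :: "real \<Rightarrow> real ^ 'd \<Rightarrow> real" where
  "heat_kernel t x = (4 * pi * t) powr (- real CARD('d) / 2) * exp (- (norm x)\<^sup>2 / (4 * t))"

definition heat_flow :: "real \<Rightarrow> (real ^ 'd \<Rightarrow> real ^ 'd) \<Rightarrow> real ^ 'd \<Rightarrow> real ^ 'd" where
  "heat_flow t f x =
     (if t = 0 then f x else (LINT y|lebesgue. heat_kernel t (x - y) *\<^sub>R f y))"

definition inv_neg_laplacian :: "(real ^ 'd \<Rightarrow> real) \<Rightarrow> real ^ 'd \<Rightarrow> real" where
  "inv_neg_laplacian f x = (LINT y|lebesgue. newton (x - y) * f y)"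

definition leray :: "(real ^ 'd \<Rightarrow> real ^ 'd) \<Rightarrow> real ^ 'd \<Rightarrow> real ^ 'd" where
  "leray v x = v x + grad (inv_neg_laplacian (divergence v)) x"

text \<open>For a bounded matrix field \<open>W\<close>, \<open>\<P> div W\<close> is only a distribution. As \<open>\<P> div\<close> commutes with
  translations, \<open>G\<^sub>t * \<P> div W\<close> is the convolution of \<open>W\<close> with the kernel obtained by applying
  \<open>\<P> div\<close> to the matrix fields whose only nonzero entry is \<open>G\<^sub>t\<close>. This kernel is integrable
  for \<open>t > 0\<close>.\<close>

definition oseen :: "real \<Rightarrow> 'd \<Rightarrow> 'd \<Rightarrow> real ^ 'd \<Rightarrow> real ^ 'd" where
  "oseen t i j =
     leray (matrix_div (\<lambda>x. heat_kernel t x *\<^sub>R outer (axis i 1) (axis j 1)))"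

definition heat_leray_div ::
  "real \<Rightarrow> (real ^ 'd \<Rightarrow> real ^ 'd ^ 'd) \<Rightarrow> real ^ 'd \<Rightarrow> real ^ 'd" where
  "heat_leray_div t W x =
     (\<Sum>i\<in>UNIV. \<Sum>j\<in>UNIV. LINT y|lebesgue. (W y $ i $ j) *\<^sub>R oseen t i j (x - y))"

text \<open>A time-dependent field is a function of time with values in functions of space; elements of
  \<open>L\<^sup>\<infinity>\<close> are represented by functions, with almost everywhere equality written out.\<close>

definition Linf_norm :: "(real ^ 'd \<Rightarrow> real ^ 'd) \<Rightarrow> ereal" where
  "Linf_norm f = esssup lebesgue (\<lambda>x. ereal (norm (f x)))"

definition Linf :: "(real ^ 'd \<Rightarrow> real ^ 'd) set" where
  "Linf = {f \<in> borel_measurable lebesgue. Linf_norm f < \<infinity>}"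

definition continuous_Linf :: "real set \<Rightarrow> (real \<Rightarrow> real ^ 'd \<Rightarrow> real ^ 'd) \<Rightarrow> bool" where
  "continuous_Linf I u \<longleftrightarrow>
     (\<forall>t\<in>I. u t \<in> Linf) \<and>
     (\<forall>t\<in>I. ((\<lambda>s. Linf_norm (\<lambda>x. u s x - u t x)) \<longlongrightarrow> 0) (at t within I))"

definition mild_rhs ::
  "real \<Rightarrow> (real ^ 'd \<Rightarrow> real ^ 'd) \<Rightarrow> (real \<Rightarrow> real ^ 'd \<Rightarrow> real ^ 'd) \<Rightarrow> real \<Rightarrow> real ^ 'd \<Rightarrow> real ^ 'd"
  where
  "mild_rhs \<nu> u0 u t x =
     heat_flow (\<nu> * t) u0 x
     - (LINT s:{0..t}|lebesgue. heat_leray_div (\<nu> * (t - s)) (\<lambda>y. outer (u s y) (u s y)) x)"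

text \<open>Equality in \<open>C(I; L\<^sup>\<infinity>)\<close> is equality for every \<open>t\<close> and almost every \<open>x\<close>. At \<open>t = 0\<close> it
  says that \<open>u 0 = u0\<close> almost everywhere.\<close>

definition mild_solution ::
  "real \<Rightarrow> (real ^ 'd \<Rightarrow> real ^ 'd) \<Rightarrow> real set \<Rightarrow> (real \<Rightarrow> real ^ 'd \<Rightarrow> real ^ 'd) \<Rightarrow> bool" where
  "mild_solution \<nu> u0 I u \<longleftrightarrow>
     continuous_Linf I u \<and>
     (\<forall>t\<in>I. AE x in lebesgue. u t x = mild_rhs \<nu> u0 u t x) \<and>
     (AE (x, t) in lebesgue. t \<in> I \<longrightarrow> u t x = mild_rhs \<nu> u0 u t x)"

definition lifespan :: "real \<Rightarrow> (real ^ 'd \<Rightarrow> real ^ 'd) \<Rightarrow> ereal" where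
  "lifespan \<nu> u0 = Sup {ereal T | T. T > 0 \<and>
     (\<exists>u. mild_solution \<nu> u0 {0..T} u \<and>
        (\<forall>v. mild_solution \<nu> u0 {0..T} v \<longrightarrow>
           (\<forall>t\<in>{0..T}. AE x in lebesgue. v t x = u t x)))}"

definition moment ::
  "(real \<Rightarrow> real ^ 'd \<Rightarrow> real ^ 'd) \<Rightarrow> 'd multi_index \<Rightarrow> 'd \<Rightarrow> 'd \<Rightarrow> real \<Rightarrow> real" where
  "moment u \<alpha> i j t = (LINT y|lebesgue. mi_power y \<alpha> * u t y $ i * u t y $ j)"

end

theory Submission
  imports Defs "HOL-Probability.Distributions"
begin

text \<open>
  Since \<open>N < 2p - d - 1\<close>, a term \<open>O(\<bar>x\<bar>\<^sup>-\<^sup>2\<^sup>p)\<close> is also \<open>O(\<bar>x\<bar>\<^sup>-\<^sup>d\<^sup>-\<^sup>N\<^sup>-\<^sup>1)\<close>, so one may take \<open>R\<^sub>2 = 0\<close> and has to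
  bound the difference between the nonlinear term and the moment sum. By continuity in \<open>x\<close> the
  bound is only needed almost everywhere, where the integral equation holds.

  Writing \<open>\<Gamma> = \<integral>\<^sub>0\<^sup>\<infinity> G\<^sub>s ds\<close> (up to a divergent constant if \<open>d = 2\<close>), the semigroup property gives
  \<open>\<Gamma> * \<partial>\<^sub>i\<partial>\<^sub>jG\<^sub>t = \<integral>\<^sub>t\<^sup>\<infinity> \<partial>\<^sub>i\<partial>\<^sub>jG\<^sub>s ds\<close>, whereas \<open>K\<^sub>i\<^sub>j\<close> is the same integral from \<open>0\<close>. Hence the kernel of
  \<open>G\<^sub>t * \<P> div\<close> differs from \<open>\<nabla>K\<^sub>i\<^sub>j(z)\<close> by a term that decays faster than every power of \<open>\<bar>z\<bar>\<close>, and
  its \<open>L\<^sup>1\<close> norm is \<open>O(t\<^sup>-\<^sup>1\<^sup>/\<^sup>2)\<close>. The quadratic term is \<open>O(\<bar>y\<bar>\<^sup>-\<^sup>2\<^sup>p)\<close>. In the convolution at \<open>x\<close>, the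
  region \<open>\<bar>y\<bar> \<le> \<bar>x\<bar>/2\<close> is treated by Taylor expansion of \<open>\<nabla>K\<^sub>i\<^sub>j(x - y)\<close> in \<open>y\<close>, the region
  \<open>\<bar>x - y\<bar> \<le> \<bar>x\<bar>/2\<close> by the \<open>L\<^sup>1\<close> norm of the kernel, and the rest by its decay; the moments of order
  at most \<open>N\<close> converge because \<open>2p - N > d\<close>.
\<close>

section \<open>Gaussian integrals\<close>

text \<open>Apart from Gaussians, the kernels are polynomials in x times members of one family in q
  = |x|^2, namely \<open>heat_tail b \<tau> q\<close>, the integral of s^{-b} e^{-q/(4s)} over s >
  \<tau>. Differentiation in q sends b to b + 1 with factor -1/4, so spatial derivatives stay in the
  family; \<tau> = 0 gives K and \<tau> = t the nonlocal part of the Oseen kernel. Their difference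
  is an integral over (0, t], where e^{-q/(4s)} is below any power of s/q. Two obstacles shape the
  rest. Joint measurability of u in time and space is not among the data, so measurability of the
  time integrands is derived from continuity in time, by L^infinity continuity and dominated
  convergence. And \<open>partial\<close> is a one-dimensional \<open>deriv\<close> while
  \<open>mi_partial\<close> follows an arbitrary enumeration of the coordinates, so
  differentiability and commutation of the derivatives of K have to be established; the inductive
  class \<open>homog\<close> yields both, together with the decay rates.\<close>

lemma gaussian_real_integral:
  assumes a: "0 < (a::real)"
  shows "(\<integral>\<^sup>+x. ennreal (exp (- a * x\<^sup>2)) \<partial>lborel) = ennreal (sqrt (pi / a))"
proof -
  define \<sigma> where "\<sigma> = sqrt (1 / (2 * a))"
  have s: "\<sigma> > 0" "\<sigma>\<^sup>2 = 1 / (2 * a)" using a by (auto simp: \<sigma>_def)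
  have eq: "exp (- a * x\<^sup>2) = sqrt (pi / a) * normal_density 0 \<sigma> x" for x
    using a by (simp add: normal_density_def s)
  have "(\<integral>\<^sup>+x. ennreal (exp (- a * x\<^sup>2)) \<partial>lborel) = (\<integral>\<^sup>+x. ennreal (sqrt (pi / a)) * ennreal (normal_density 0 \<sigma> x) \<partial>lborel)"
    unfolding eq using a s by (intro nn_integral_cong ennreal_mult) auto
  also have "\<dots> = ennreal (sqrt (pi / a)) * (\<integral>\<^sup>+x. ennreal (normal_density 0 \<sigma> x) \<partial>lborel)"
    by (rule nn_integral_cmult) auto
  also have "(\<integral>\<^sup>+x. ennreal (normal_density 0 \<sigma> x) \<partial>lborel) = 1"
    by (subst nn_integral_eq_integral) (use s in \<open>auto simp: integral_normal_density integrable_normal_density\<close>)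
  finally show ?thesis by simp
qed

lemma gaussian_nn_integral:
  assumes a: "0 < (a::real)"
  shows "(\<integral>\<^sup>+(x::'a::euclidean_space). ennreal (exp (- a * (norm x)\<^sup>2)) \<partial>lborel)
    = ennreal ((pi / a) powr (real DIM('a) / 2))"
proof -
  have "ennreal (exp (- a * (norm x)\<^sup>2)) = (\<Prod>b\<in>Basis. ennreal (exp (- a * (x \<bullet> b)\<^sup>2)))" for x :: 'a
  proof -
    have "(norm x)\<^sup>2 = (\<Sum>b\<in>Basis. (x \<bullet> b)\<^sup>2)"
      by (subst power2_norm_eq_inner, subst euclidean_inner) (simp add: power2_eq_square)
    then show ?thesis
      by (simp add: prod_ennreal exp_sum[symmetric] sum_distrib_left[symmetric] sum_negf)
  qed
  then have "(\<integral>\<^sup>+(x::'a). ennreal (exp (- a * (norm x)\<^sup>2)) \<partial>lborel)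
     = (\<integral>\<^sup>+(x::'a). (\<Prod>b\<in>Basis. ennreal (exp (- a * (x \<bullet> b)\<^sup>2))) \<partial>lborel)"
    by simp
  also have "\<dots> = (\<Prod>b\<in>(Basis::'a set). (\<integral>\<^sup>+x. ennreal (exp (- a * x\<^sup>2)) \<partial>lborel))"
    by (rule nn_integral_lborel_prod) auto
  also have "\<dots> = ennreal (sqrt (pi / a) ^ DIM('a))"
    using gaussian_real_integral[OF a] a by (simp add: ennreal_power)
  also have "sqrt (pi / a) ^ DIM('a) = (pi / a) powr (real DIM('a) / 2)"
    using a by (simp add: powr_half_sqrt[symmetric] powr_realpow[symmetric] powr_powr)
  finally show ?thesis .
qed

lemma gaussian_integrable:
  assumes a: "0 < (a::real)"
  shows "integrable lborel (\<lambda>x::'a::euclidean_space. exp (- a * (norm x)\<^sup>2))"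
  by (rule integrableI_nonneg) (use gaussian_nn_integral[OF a, where 'a='a] in auto)

lemma gaussian_integral:
  assumes a: "0 < (a::real)"
  shows "(LINT x::'a::euclidean_space|lborel. exp (- a * (norm x)\<^sup>2)) = (pi / a) powr (real DIM('a) / 2)"
  by (rule integral_eq_nn_integral[THEN trans]) (use gaussian_nn_integral[OF a, where 'a='a] in auto)

lemma power_le_exp_bound:
  fixes a :: real assumes "a > 0"
  shows "\<exists>C\<ge>0. \<forall>r\<ge>0. r ^ k \<le> C * exp (a * r)"
proof (intro exI conjI allI impI)
  show "0 \<le> fact k / a ^ k" using assms by simp
  fix r :: real assume r: "r \<ge> 0"
  \<comment> \<open>A single term of the exponential series; this is the source of the witness
    \<open>fact k / a ^ k\<close>.\<close>
  have "(a * r) ^ k /\<^sub>R fact k \<le> (\<Sum>n. (a * r) ^ n /\<^sub>R fact n)"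
    using sum_le_suminf[OF summable_exp_generic[of "a * r"], of "{k}"] assms r by (simp add: inverse_eq_divide)
  then have "(a * r) ^ k / fact k \<le> exp (a * r)" by (simp add: exp_def inverse_eq_divide)
  then show "r ^ k \<le> fact k / a ^ k * exp (a * r)"
    using assms by (simp add: power_mult_distrib field_simps)
qed

lemma powr_le_exp_bound:
  fixes a :: real assumes "a > 0" "k \<ge> 0"
  shows "\<exists>C\<ge>0. \<forall>r\<ge>0. r powr k \<le> C * exp (a * r)"
proof -
  define n where "n = nat \<lceil>k\<rceil>"
  obtain C where C: "C \<ge> 0" "\<And>r. r \<ge> 0 \<Longrightarrow> r ^ n \<le> C * exp (a * r)"
    using power_le_exp_bound[OF assms(1), of n] by blast
  have kn: "k \<le> real n" unfolding n_def by linarith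
  \<comment> \<open>Rounding k up is legitimate only for r > 1; the extra 1 in the constant covers r
    \<le> 1, where the power is at most 1.\<close>
  have "r powr k \<le> (C + 1) * exp (a * r)" if r: "r \<ge> 0" for r
  proof (cases "r \<le> 1")
    case True
    then have "r powr k \<le> 1" using r assms by (simp add: powr_le1)
    also have "1 \<le> exp (a * r)" using assms r by simp
    also have "\<dots> \<le> (C + 1) * exp (a * r)" using C(1) by (simp add: algebra_simps)
    finally show ?thesis .
  next
    case False
    then have "r powr k \<le> r powr n" using kn by (intro powr_mono) auto
    also have "\<dots> = r ^ n" using False by (simp add: powr_realpow)
    also have "\<dots> \<le> C * exp (a * r)" using C(2) r by simp
    also have "\<dots> \<le> (C + 1) * exp (a * r)" by (simp add: algebra_simps)
    finally show ?thesis .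
  qed
  then show ?thesis using C(1) by (intro exI[of _ "C + 1"]) auto
qed

text \<open>Half of the Gaussian absorbs the polynomial: (1 + r)^k is at most C e^{a(1 + r)/4}, and
  a(1 + r)/4 \<le> a/2 + a r^2/2, which leaves e^{-a r^2/2}.\<close>

lemma gaussian_moment_integrable:
  assumes a: "0 < (a::real)"
  shows "integrable lborel (\<lambda>x::'a::euclidean_space. (1 + norm x) ^ k * exp (- a * (norm x)\<^sup>2))"
proof -
  obtain C where C: "C \<ge> 0" "\<And>r. r \<ge> 0 \<Longrightarrow> r ^ k \<le> C * exp (a / 4 * r)"
    using power_le_exp_bound[of "a / 4" k] a by auto
  show ?thesis
  proof (rule Bochner_Integration.integrable_bound)
    show "integrable lborel (\<lambda>x::'a. C * exp (a / 2) * exp (- (a / 2) * (norm x)\<^sup>2))"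
      using a by (intro integrable_mult_right gaussian_integrable) auto
    have "(1 + r) ^ k * exp (- a * r\<^sup>2) \<le> C * exp (a / 2) * exp (- (a / 2) * r\<^sup>2)" if r: "r \<ge> 0" for r
    proof -
      have "1 + r \<le> (1 + r)\<^sup>2" using r by (simp add: power2_eq_square algebra_simps)
      moreover have "(1 + r)\<^sup>2 \<le> 2 + 2 * r\<^sup>2"
        using zero_le_power2[of "1 - r"] by (simp add: power2_eq_square algebra_simps)
      ultimately have "a / 4 * (1 + r) \<le> a / 4 * (2 + 2 * r\<^sup>2)" using a by (intro mult_left_mono) auto
      then have exparg: "a / 4 * (1 + r) \<le> a / 2 + a / 2 * r\<^sup>2" by (simp add: field_simps)
      have "(1 + r) ^ k * exp (- a * r\<^sup>2) \<le> C * exp (a / 4 * (1 + r)) * exp (- a * r\<^sup>2)"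
        using C(2)[of "1 + r"] r by (intro mult_right_mono) auto
      also have "\<dots> \<le> C * exp (a / 2 + a / 2 * r\<^sup>2) * exp (- a * r\<^sup>2)"
        using exparg C(1) by (intro mult_right_mono mult_left_mono) auto
      also have "\<dots> = C * exp (a / 2) * exp (- (a / 2) * r\<^sup>2)"
        by (simp add: mult_exp_exp algebra_simps)
      finally show ?thesis .
    qed
    then show "AE x in lborel. norm ((1 + norm (x::'a)) ^ k * exp (- a * (norm x)\<^sup>2))
        \<le> norm (C * exp (a / 2) * exp (- (a / 2) * (norm x)\<^sup>2))"
      using C(1) by (auto simp: abs_mult)
  qed auto
qed

section \<open>Translations, reflections and moments of Gaussians\<close>

lemma lborel_integral_shift:
  fixes f :: "'a::euclidean_space \<Rightarrow> 'b::{banach, second_countable_topology}"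
  shows "(LINT x|lborel. f (t + x)) = (LINT x|lborel. f x)"
    and "integrable lborel (\<lambda>x. f (t + x)) \<longleftrightarrow> integrable lborel f"
proof -
  have meas: "(\<lambda>x. f (t + x)) \<in> borel_measurable lborel \<longleftrightarrow> f \<in> borel_measurable lborel"
  proof
    assume m: "(\<lambda>x. f (t + x)) \<in> borel_measurable lborel"
    have "(\<lambda>x. f (t + (- t + x))) \<in> borel_measurable lborel"
      by (rule measurable_compose[where f = "(+) (- t)" and g = "\<lambda>x. f (t + x)", OF _ m]) simp
    then show "f \<in> borel_measurable lborel" by simp
  next
    assume f[measurable]: "f \<in> borel_measurable lborel"
    show "(\<lambda>x. f (t + x)) \<in> borel_measurable lborel"
      by (rule measurable_compose[where f = "(+) t" and g = f, OF _ f]) simp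
  qed
  show i: "integrable lborel (\<lambda>x. f (t + x)) \<longleftrightarrow> integrable lborel f"
  proof (cases "f \<in> borel_measurable lborel")
    case True
    then have "integrable lborel f \<longleftrightarrow> integrable (distr lborel borel ((+) t)) f"
      by (simp add: lborel_distr_plus)
    also have "\<dots> \<longleftrightarrow> integrable lborel (\<lambda>x. f (t + x))"
      using True by (intro integrable_distr_eq) auto
    finally show ?thesis by simp
  next
    case False then show ?thesis using meas by (auto dest: borel_measurable_integrable)
  qed
  show "(LINT x|lborel. f (t + x)) = (LINT x|lborel. f x)"
  proof (cases "f \<in> borel_measurable lborel")
    case True
    then have "integral\<^sup>L lborel f = integral\<^sup>L (distr lborel borel ((+) t)) f"
      by (simp add: lborel_distr_plus)
    also have "\<dots> = (LINT x|lborel. f (t + x))"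
      using True by (intro integral_distr) auto
    finally show ?thesis by simp
  next
    case False
    then show ?thesis using i by (auto dest: borel_measurable_integrable simp: not_integrable_integral_eq)
  qed
qed

lemma lborel_distr_minus: "distr lborel borel (\<lambda>x::'a::euclidean_space. t - x) = lborel"
  using lborel_affine[of "-1" t] by (simp add: density_1)

lemma lborel_integral_reflect:
  fixes f :: "'a::euclidean_space \<Rightarrow> 'b::{banach, second_countable_topology}"
  assumes "f \<in> borel_measurable borel"
  shows "(LINT x|lborel. f (t - x)) = (LINT x|lborel. f x)"
    and "integrable lborel (\<lambda>x. f (t - x)) \<longleftrightarrow> integrable lborel f"
proof -
  show "(LINT x|lborel. f (t - x)) = (LINT x|lborel. f x)"
    using assms integral_distr[of "\<lambda>x. t - x" lborel borel f] by (simp add: lborel_distr_minus)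
  show "integrable lborel (\<lambda>x. f (t - x)) \<longleftrightarrow> integrable lborel f"
    using assms integrable_distr_eq[of "\<lambda>x. t - x" lborel borel f] by (simp add: lborel_distr_minus)
qed

text \<open>Fubini for \<open>(\<sigma>, y) \<mapsto> F' (y + \<sigma> e)\<close> on \<open>[0, 1] \<times> \<real>\<^sup>d\<close>: the integral over \<open>\<sigma>\<close> gives
  \<open>F (y + e) - F y\<close>, whose integral vanishes by translation invariance.\<close>

lemma integral_directional_derivative_eq_0:
  fixes F F' :: "'a::euclidean_space \<Rightarrow> real"
  assumes F: "integrable lborel F" and F': "integrable lborel F'"
    and cont: "continuous_on UNIV F'"
    and deriv: "\<And>y. (F has_derivative (\<lambda>h. F'' y h)) (at y)" and dir: "\<And>y. F'' y e = F' y"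
  shows "(LINT y|lborel. F' y) = 0"
proof -
  have c[measurable]: "F' \<in> borel_measurable borel"
    using cont by (rule borel_measurable_continuous_onI)
  have ftc: "(LINT \<sigma>|lborel. indicator {0..1} \<sigma> * F' (y + \<sigma> *\<^sub>R e)) = F (y + e) - F y" for y
  proof -
    have "(LINT \<sigma>:{0..1}|lborel. F' (y + \<sigma> *\<^sub>R e)) = F (y + 1 *\<^sub>R e) - F (y + 0 *\<^sub>R e)"
      unfolding set_lebesgue_integral_def
    proof (rule integral_FTC_Icc)
      show "((\<lambda>\<sigma>. F (y + \<sigma> *\<^sub>R e)) has_vector_derivative F' (y + \<sigma> *\<^sub>R e)) (at \<sigma> within {0..1})" for \<sigma>
      proof -
        have "((\<lambda>\<sigma>. F (y + \<sigma> *\<^sub>R e)) has_derivative (\<lambda>h. F'' (y + \<sigma> *\<^sub>R e) (h *\<^sub>R e))) (at \<sigma> within {0..1})"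
          by (rule has_derivative_compose[OF _ deriv]) (auto intro!: derivative_eq_intros)
        moreover have "F'' (y + \<sigma> *\<^sub>R e) (h *\<^sub>R e) = h *\<^sub>R F' (y + \<sigma> *\<^sub>R e)" for h
          using deriv[of "y + \<sigma> *\<^sub>R e"] dir by (metis has_derivative_linear linear_cmul)
        ultimately show ?thesis by (simp add: has_vector_derivative_def)
      qed
      show "continuous_on {0..1} (\<lambda>\<sigma>. F' (y + \<sigma> *\<^sub>R e))"
        by (rule continuous_on_compose2[OF cont]) (auto intro!: continuous_intros)
    qed auto
    then show ?thesis by (simp add: set_lebesgue_integral_def)
  qed
  let ?f = "\<lambda>\<sigma> y. indicator {0..1} \<sigma> * F' (y + \<sigma> *\<^sub>R e)"
  have int: "integrable (lborel \<Otimes>\<^sub>M lborel) (\<lambda>(\<sigma>::real, y). ?f \<sigma> y)"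
  proof (rule lborel_pair.Fubini_integrable)
    show "(\<lambda>(\<sigma>::real, y). ?f \<sigma> y) \<in> borel_measurable (lborel \<Otimes>\<^sub>M lborel)" by measurable
    have "(LINT y|lborel. norm (case (\<sigma>, y) of (\<sigma>, y) \<Rightarrow> ?f \<sigma> y))
       = indicator {0..1} \<sigma> *\<^sub>R (LINT y|lborel. norm (F' y))" for \<sigma> :: real
      using lborel_integral_shift(1)[of "\<lambda>y. norm (F' y)" "\<sigma> *\<^sub>R e"]
      by (auto simp: abs_mult add.commute split: split_indicator)
    moreover have "integrable lborel (\<lambda>\<sigma>::real. indicator {0..1} \<sigma> *\<^sub>R (LINT y|lborel. norm (F' y)))"
      by (intro integrable_real_indicator integrable_scaleR_left) auto
    ultimately show "integrable lborel (\<lambda>\<sigma>::real. LINT y|lborel. norm (case (\<sigma>, y) of (\<sigma>, y) \<Rightarrow> ?f \<sigma> y))"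
      by simp
    show "AE \<sigma>::real in lborel. integrable lborel (\<lambda>y. case (\<sigma>, y) of (\<sigma>, y) \<Rightarrow> ?f \<sigma> y)"
      using F' lborel_integral_shift(2)[of F' "_ *\<^sub>R e"] by (auto simp: add.commute intro!: AE_I2)
  qed
  have "(LINT \<sigma>::real|lborel. LINT y|lborel. ?f \<sigma> y) = (LINT y|lborel. LINT \<sigma>::real|lborel. ?f \<sigma> y)"
    using lborel_pair.Fubini_integral[OF int] by simp
  also have "\<dots> = (LINT y|lborel. F (e + y) - F y)" by (simp add: ftc add.commute)
  also have "\<dots> = 0"
    using F lborel_integral_shift[of F e] by (simp add: Bochner_Integration.integral_diff)
  also have "(LINT \<sigma>::real|lborel. LINT y|lborel. ?f \<sigma> y) = (LINT \<sigma>::real|lborel. indicator {0..1} \<sigma> *\<^sub>R (LINT y|lborel. F' y))"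
    using lborel_integral_shift(1)[of F' "_ *\<^sub>R e"] by (simp add: add.commute)
  also have "\<dots> = (LINT y|lborel. F' y)" by simp
  finally show ?thesis .
qed

text \<open>Up to the factor -2a the integrand is the i-th derivative of the Gaussian, so its
  integral vanishes.\<close>

lemma gaussian_first_moment:
  fixes a :: real and i :: "'d::finite"
  assumes a: "0 < a"
  shows "integrable lborel (\<lambda>y::real^'d. y $ i * exp (- a * (norm y)\<^sup>2))"
    and "(LINT y::real^'d|lborel. y $ i * exp (- a * (norm y)\<^sup>2)) = 0"
proof -
  show int: "integrable lborel (\<lambda>y::real^'d. y $ i * exp (- a * (norm y)\<^sup>2))"
  proof (rule Bochner_Integration.integrable_bound[OF gaussian_moment_integrable[OF a, of 1]])
    show "AE y in lborel. norm (y $ i * exp (- a * (norm y)\<^sup>2))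
       \<le> norm ((1 + norm (y::real^'d)) ^ 1 * exp (- a * (norm y)\<^sup>2))"
      using order_trans[OF component_le_norm_cart] by (auto simp: abs_mult intro!: AE_I2 mult_right_mono add_increasing)
  qed auto
  have "(LINT y::real^'d|lborel. - 2 * a * (y $ i * exp (- a * (norm y)\<^sup>2))) = 0"
  proof (rule integral_directional_derivative_eq_0[where F = "\<lambda>y. exp (- a * (norm y)\<^sup>2)" and e = "axis i 1"
        and F'' = "\<lambda>y h. - 2 * a * (y \<bullet> h) * exp (- a * (norm y)\<^sup>2)"])
    show "((\<lambda>y::real^'d. exp (- a * (norm y)\<^sup>2)) has_derivative
        (\<lambda>h. - 2 * a * (y \<bullet> h) * exp (- a * (norm y)\<^sup>2))) (at y)" for y
      unfolding power2_norm_eq_inner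
      by (auto intro!: derivative_eq_intros simp: inner_commute)
  qed (use gaussian_integrable[OF a, where 'a="real^'d"] int in \<open>auto intro!: continuous_intros simp: inner_axis\<close>)
  then show "(LINT y::real^'d|lborel. y $ i * exp (- a * (norm y)\<^sup>2)) = 0"
    using a by simp
qed

text \<open>The i-th derivative of y_j e^{-a|y|^2} is (delta_ij - 2a y_i y_j) e^{-a|y|^2}. Its
  integral is 0, which expresses the second moment by the plain Gaussian integral.\<close>

lemma gaussian_second_moment:
  fixes a :: real and i j :: "'d::finite"
  assumes a: "0 < a"
  shows "integrable lborel (\<lambda>y::real^'d. y $ i * y $ j * exp (- a * (norm y)\<^sup>2))"
    and "(LINT y::real^'d|lborel. y $ i * y $ j * exp (- a * (norm y)\<^sup>2))
      = (if i = j then (pi / a) powr (real CARD('d) / 2) / (2 * a) else 0)"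
proof -
  show int: "integrable lborel (\<lambda>y::real^'d. y $ i * y $ j * exp (- a * (norm y)\<^sup>2))"
  proof (rule Bochner_Integration.integrable_bound[OF gaussian_moment_integrable[OF a, of 2]])
    have "\<bar>y $ i * y $ j\<bar> \<le> (1 + norm y)\<^sup>2" for y :: "real^'d"
      unfolding power2_eq_square abs_mult
      by (intro mult_mono) (use order_trans[OF component_le_norm_cart[of y]] in \<open>auto intro: add_increasing\<close>)
    then show "AE y in lborel. norm (y $ i * y $ j * exp (- a * (norm y)\<^sup>2))
       \<le> norm ((1 + norm (y::real^'d)) ^ 2 * exp (- a * (norm y)\<^sup>2))"
      by (auto simp: abs_mult intro!: AE_I2 mult_right_mono)
  qed auto
  let ?\<delta> = "if i = j then 1 else 0 :: real"
  let ?F = "\<lambda>y::real^'d. (?\<delta> - 2 * a * (y $ i * y $ j)) * exp (- a * (norm y)\<^sup>2)"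
  have F: "?F y = ?\<delta> * exp (- a * (norm y)\<^sup>2) - 2 * a * (y $ i * y $ j * exp (- a * (norm y)\<^sup>2))" for y
    by (simp add: algebra_simps)
  have intF: "integrable lborel ?F"
    unfolding F by (intro Bochner_Integration.integrable_diff integrable_mult_right int gaussian_integrable a)
  have "(LINT y|lborel. ?F y) = 0"
  proof (rule integral_directional_derivative_eq_0[where F = "\<lambda>y. y $ j * exp (- a * (norm y)\<^sup>2)" and e = "axis i 1"
        and F'' = "\<lambda>y h. (h $ j - 2 * a * (y \<bullet> h) * y $ j) * exp (- a * (norm y)\<^sup>2)"])
    show "((\<lambda>y::real^'d. y $ j * exp (- a * (norm y)\<^sup>2)) has_derivative
        (\<lambda>h. (h $ j - 2 * a * (y \<bullet> h) * y $ j) * exp (- a * (norm y)\<^sup>2))) (at y)" for y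
      unfolding power2_norm_eq_inner
      by (auto intro!: derivative_eq_intros ext bounded_linear_imp_has_derivative
          bounded_linear_vec_nth simp: inner_commute algebra_simps)
  qed (use gaussian_first_moment(1)[OF a, of j] intF in \<open>auto intro!: continuous_intros simp: inner_axis, auto simp: axis_def\<close>)
  moreover have "(LINT y|lborel. ?F y) = ?\<delta> * (pi / a) powr (real CARD('d) / 2)
      - 2 * a * (LINT y::real^'d|lborel. y $ i * y $ j * exp (- a * (norm y)\<^sup>2))"
    unfolding F using gaussian_integral[OF a, where 'a="real^'d"] gaussian_integrable[OF a, where 'a="real^'d"] int
    by (subst Bochner_Integration.integral_diff) auto
  ultimately show "(LINT y::real^'d|lborel. y $ i * y $ j * exp (- a * (norm y)\<^sup>2))
      = (if i = j then (pi / a) powr (real CARD('d) / 2) / (2 * a) else 0)"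
    using a by (auto simp: field_simps)
qed

text \<open>The product of Gaussians centred at x and at 0 is a Gaussian centred at t x/(s + t);
  this is the algebra behind the semigroup property.\<close>

lemma complete_square:
  fixes x y :: "'a::real_inner" and s t :: real
  assumes "s > 0" "t > 0"
  shows "(norm (x - y))\<^sup>2 / (4 * s) + (norm y)\<^sup>2 / (4 * t)
    = (norm x)\<^sup>2 / (4 * (s + t)) + (s + t) / (4 * s * t) * (norm (y - (t / (s + t)) *\<^sub>R x))\<^sup>2"
proof -
  have st: "s + t \<noteq> 0" "s \<noteq> 0" "t \<noteq> 0" using assms by auto
  show ?thesis
    unfolding power2_norm_eq_inner inner_diff_left inner_diff_right inner_scaleR_left inner_scaleR_right
      inner_commute[of y x]
    using st by (simp add: divide_simps) algebra
qed

text \<open>This is G_s * d_i d_j G_t = d_i d_j G_{s+t} without the normalising constants, which are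
  collected in the factor (4 pi s t/(s + t))^{d/2}. After completing the square and moving the
  centre to 0, the polynomial is expanded about the new centre; odd moments drop out.\<close>

lemma heat_second_derivative_semigroup:
  fixes x :: "real^'d" and s t :: real and i j :: 'd
  assumes s: "s > 0" and t: "t > 0"
  shows "integrable lborel (\<lambda>y. exp (- (norm (x - y))\<^sup>2 / (4 * s)) *
      ((y $ i * y $ j / (4 * t\<^sup>2) - (if i = j then 1 / (2 * t) else 0)) * exp (- (norm y)\<^sup>2 / (4 * t))))"
    and "(LINT y|lborel. exp (- (norm (x - y))\<^sup>2 / (4 * s)) *
      ((y $ i * y $ j / (4 * t\<^sup>2) - (if i = j then 1 / (2 * t) else 0)) * exp (- (norm y)\<^sup>2 / (4 * t))))
    = (4 * pi * s * t / (s + t)) powr (real CARD('d) / 2) *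
      ((x $ i * x $ j / (4 * (s + t)\<^sup>2) - (if i = j then 1 / (2 * (s + t)) else 0))
        * exp (- (norm x)\<^sup>2 / (4 * (s + t))))"
proof -
  define a where "a = (s + t) / (4 * s * t)"
  define m where "m = t / (s + t)"
  define c where "c = exp (- (norm x)\<^sup>2 / (4 * (s + t)))"
  define D where "D = (if i = j then 1 else 0 :: real)"
  have a: "a > 0" using s t by (auto simp: a_def)
  have pia: "pi / a = 4 * pi * s * t / (s + t)" by (simp add: a_def field_simps)
  let ?f = "\<lambda>y. exp (- (norm (x - y))\<^sup>2 / (4 * s)) *
      ((y $ i * y $ j / (4 * t\<^sup>2) - D / (2 * t)) * exp (- (norm y)\<^sup>2 / (4 * t)))"
  let ?e = "\<lambda>w::real^'d. exp (- a * (norm w)\<^sup>2)"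
  let ?g = "\<lambda>w. c / (4 * t\<^sup>2) * (w $ i * w $ j * ?e w) + m * x $ j * c / (4 * t\<^sup>2) * (w $ i * ?e w)
      + m * x $ i * c / (4 * t\<^sup>2) * (w $ j * ?e w) + c * (m\<^sup>2 * x $ i * x $ j / (4 * t\<^sup>2) - D / (2 * t)) * ?e w"
  have "?f (m *\<^sub>R x + w) = ?g w" for w
  proof -
    have "- (norm (x - (m *\<^sub>R x + w)))\<^sup>2 / (4 * s) + - (norm (m *\<^sub>R x + w))\<^sup>2 / (4 * t)
        = - (norm x)\<^sup>2 / (4 * (s + t)) + - a * (norm w)\<^sup>2"
      using complete_square[OF s t, of x "m *\<^sub>R x + w"] by (simp add: a_def m_def)
    then have e: "exp (- (norm (x - (m *\<^sub>R x + w)))\<^sup>2 / (4 * s)) * exp (- (norm (m *\<^sub>R x + w))\<^sup>2 / (4 * t)) = c * ?e w"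
      unfolding c_def mult_exp_exp by simp
    have "?f (m *\<^sub>R x + w) = ((m * x $ i + w $ i) * (m * x $ j + w $ j) / (4 * t\<^sup>2) - D / (2 * t)) *
       (exp (- (norm (x - (m *\<^sub>R x + w)))\<^sup>2 / (4 * s)) * exp (- (norm (m *\<^sub>R x + w))\<^sup>2 / (4 * t)))"
      by simp
    also have "\<dots> = ?g w" unfolding e using t by (simp add: field_simps power2_eq_square)
    finally show ?thesis .
  qed
  then have fg: "(\<lambda>w. ?f (m *\<^sub>R x + w)) = ?g" by auto
  have ig: "integrable lborel ?g"
    by (intro Bochner_Integration.integrable_add integrable_mult_right gaussian_first_moment
        gaussian_second_moment gaussian_integrable a)
  have Df: "(if i = j then 1 / (2 * r) else 0) = D / (2 * r)" for r by (auto simp: D_def)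
  show "integrable lborel (\<lambda>y. exp (- (norm (x - y))\<^sup>2 / (4 * s)) *
      ((y $ i * y $ j / (4 * t\<^sup>2) - (if i = j then 1 / (2 * t) else 0)) * exp (- (norm y)\<^sup>2 / (4 * t))))"
    unfolding Df using ig unfolding fg[symmetric] lborel_integral_shift(2)[of ?f] .
  have "(LINT y|lborel. ?f y) = (LINT w|lborel. ?g w)"
    unfolding fg[symmetric] lborel_integral_shift(1)[of ?f] ..
  also have "\<dots> = c / (4 * t\<^sup>2) * (D * (pi / a) powr (real CARD('d) / 2) / (2 * a))
     + c * (m\<^sup>2 * x $ i * x $ j / (4 * t\<^sup>2) - D / (2 * t)) * (pi / a) powr (real CARD('d) / 2)"
    using gaussian_first_moment[OF a, where 'd='d] gaussian_second_moment[OF a, where 'd='d]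
      gaussian_integrable[OF a, where 'a="real^'d"] gaussian_integral[OF a, where 'a="real^'d"]
    by (subst Bochner_Integration.integral_add, (intro Bochner_Integration.integrable_add integrable_mult_right; simp)+)+
       (simp add: D_def)
  also have "\<dots> = (pi / a) powr (real CARD('d) / 2) *
      ((m\<^sup>2 * x $ i * x $ j / (4 * t\<^sup>2) + D / (8 * a * t\<^sup>2) - D / (2 * t)) * c)"
    using a t by (simp add: field_simps)
  also have "m\<^sup>2 * x $ i * x $ j / (4 * t\<^sup>2) = x $ i * x $ j / (4 * (s + t)\<^sup>2)"
    using t s by (simp add: m_def power_divide)
  also have "x $ i * x $ j / (4 * (s + t)\<^sup>2) + D / (8 * a * t\<^sup>2) - D / (2 * t)
     = x $ i * x $ j / (4 * (s + t)\<^sup>2) - D / (2 * (s + t))"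
  \<comment> \<open>The variance 1/(2a) = 2st/(s + t) of the product Gaussian is what turns 1/(2t)
    into 1/(2(s + t)).\<close>
  proof -
    have "D / (8 * a * t\<^sup>2) - D / (2 * t) = - D / (2 * (s + t))"
      using s t by (simp add: a_def divide_simps power2_eq_square) (simp add: algebra_simps)
    then show ?thesis by simp
  qed
  finally show "(LINT y|lborel. exp (- (norm (x - y))\<^sup>2 / (4 * s)) *
      ((y $ i * y $ j / (4 * t\<^sup>2) - (if i = j then 1 / (2 * t) else 0)) * exp (- (norm y)\<^sup>2 / (4 * t))))
    = (4 * pi * s * t / (s + t)) powr (real CARD('d) / 2) *
      ((x $ i * x $ j / (4 * (s + t)\<^sup>2) - (if i = j then 1 / (2 * (s + t)) else 0))
        * exp (- (norm x)\<^sup>2 / (4 * (s + t))))"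
    unfolding Df pia c_def .
qed

lemma nn_integral_Gamma_scaled:
  fixes b c :: real
  assumes b: "b > 0" and c: "c > 0"
  shows "(\<integral>\<^sup>+s. ennreal (indicator {0<..} s * s powr (b - 1) * exp (- c * s)) \<partial>lborel) = ennreal (Gamma b / c powr b)"
proof -
  have "ennreal (Gamma b) = (\<integral>\<^sup>+t. ennreal (indicator {0..} t * t powr (b - 1) / exp t) \<partial>lborel)"
    by (rule Gamma_conv_nn_integral_real[OF b])
  also have "\<dots> = ennreal \<bar>c\<bar> * (\<integral>\<^sup>+s. ennreal (indicator {0..} (0 + c * s) * (0 + c * s) powr (b - 1) / exp (0 + c * s)) \<partial>lborel)"
    by (rule nn_integral_real_affine) (use c in auto)
  also have "\<dots> = ennreal c * (\<integral>\<^sup>+s. ennreal (c powr (b - 1)) * ennreal (indicator {0<..} s * s powr (b - 1) * exp (- c * s)) \<partial>lborel)"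
  proof -
    have "ennreal (indicator {0..} (c * s) * (c * s) powr (b - 1) / exp (c * s))
        = ennreal (c powr (b - 1)) * ennreal (indicator {0<..} s * s powr (b - 1) * exp (- c * s))" if "s \<noteq> 0" for s
      using c that by (subst ennreal_mult[symmetric]) (auto simp: powr_mult exp_minus field_simps zero_le_mult_iff split: split_indicator)
    then have "(\<integral>\<^sup>+s. ennreal (indicator {0..} (0 + c * s) * (0 + c * s) powr (b - 1) / exp (0 + c * s)) \<partial>lborel)
      = (\<integral>\<^sup>+s. ennreal (c powr (b - 1)) * ennreal (indicator {0<..} s * s powr (b - 1) * exp (- c * s)) \<partial>lborel)"
      by (intro nn_integral_cong_AE eventually_mono[OF AE_lborel_singleton[of 0]]) simp
    then show ?thesis using c by simp
  qed
  also have "\<dots> = ennreal (c powr b) * (\<integral>\<^sup>+s. ennreal (indicator {0<..} s * s powr (b - 1) * exp (- c * s)) \<partial>lborel)"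
    using c by (subst nn_integral_cmult) (auto simp: mult.assoc[symmetric] ennreal_mult[symmetric] powr_mult_base)
  finally have *: "ennreal (Gamma b) = ennreal (c powr b) * (\<integral>\<^sup>+s. ennreal (indicator {0<..} s * s powr (b - 1) * exp (- c * s)) \<partial>lborel)" .
  have "ennreal (Gamma b / c powr b) = ennreal (1 / c powr b) * ennreal (Gamma b)"
    using c b by (subst ennreal_mult[symmetric]) (auto intro: Gamma_real_nonneg)
  also have "\<dots> = (\<integral>\<^sup>+s. ennreal (indicator {0<..} s * s powr (b - 1) * exp (- c * s)) \<partial>lborel)"
    unfolding * mult.assoc[symmetric] using c by (subst ennreal_mult[symmetric]) auto
  finally show ?thesis ..
qed

text \<open>Subordination replaces polar coordinates: (1 + |x|^2)^{-a/2} is a Gamma integral over s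
  of e^{-s} times the Gaussian e^{-s|x|^2}. Integrating in x first costs s^{-d/2} and leaves a Gamma
  integral with exponent (a - d)/2, positive exactly when a > d.\<close>

lemma integrable_bracket_powr:
  fixes a :: real
  assumes a: "a > real DIM('a::euclidean_space)"
  shows "integrable lborel (\<lambda>x::'a. (1 + norm x) powr (- a))"
proof -
  let ?d = "real DIM('a)"
  have a0: "a > 0" using a by simp
  have *: "ennreal ((1 + norm x) powr (- a)) \<le> ennreal (1 / Gamma (a / 2)) *
     (\<integral>\<^sup>+s. ennreal (indicator {0<..} s * s powr (a / 2 - 1) * exp (- s) * exp (- s * (norm x)\<^sup>2)) \<partial>lborel)" for x :: 'a
  proof -
    have pos: "1 + (norm x)\<^sup>2 > 0" by (simp add: add_pos_nonneg)
    have G: "Gamma (a / 2) > 0" using a0 by (intro Gamma_real_pos) auto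
    have "(1 + norm x) powr (- a) = ((1 + norm x)\<^sup>2) powr (- a / 2)"
      by (simp add: powr_powr flip: powr_numeral)
    also have "\<dots> \<le> (1 + (norm x)\<^sup>2) powr (- a / 2)"
      using a0 pos by (intro powr_mono2') (auto simp: power2_sum)
    also have "\<dots> = 1 / Gamma (a / 2) * (Gamma (a / 2) / (1 + (norm x)\<^sup>2) powr (a / 2))"
      using G by (simp add: powr_minus field_simps)
    finally have "ennreal ((1 + norm x) powr (- a)) \<le> ennreal (1 / Gamma (a / 2)) * ennreal (Gamma (a / 2) / (1 + (norm x)\<^sup>2) powr (a / 2))"
      using G by (subst ennreal_mult[symmetric]) (auto intro: ennreal_leI)
    also have "ennreal (Gamma (a / 2) / (1 + (norm x)\<^sup>2) powr (a / 2))
       = (\<integral>\<^sup>+s. ennreal (indicator {0<..} s * s powr (a / 2 - 1) * exp (- (1 + (norm x)\<^sup>2) * s)) \<partial>lborel)"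
      by (rule nn_integral_Gamma_scaled[symmetric]) (use a0 pos in auto)
    also have "\<dots> = (\<integral>\<^sup>+s. ennreal (indicator {0<..} s * s powr (a / 2 - 1) * exp (- s) * exp (- s * (norm x)\<^sup>2)) \<partial>lborel)"
      by (intro nn_integral_cong) (simp add: mult_exp_exp mult.assoc algebra_simps)
    finally show ?thesis .
  qed
  have "(\<integral>\<^sup>+(x::'a). ennreal ((1 + norm x) powr (- a)) \<partial>lborel) \<le> (\<integral>\<^sup>+(x::'a). ennreal (1 / Gamma (a / 2)) *
     (\<integral>\<^sup>+s. ennreal (indicator {0<..} s * s powr (a / 2 - 1) * exp (- s) * exp (- s * (norm x)\<^sup>2)) \<partial>lborel) \<partial>lborel)"
    by (intro nn_integral_mono *)
  also have "\<dots> = ennreal (1 / Gamma (a / 2)) * (\<integral>\<^sup>+(x::'a).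
     (\<integral>\<^sup>+s. ennreal (indicator {0<..} s * s powr (a / 2 - 1) * exp (- s) * exp (- s * (norm x)\<^sup>2)) \<partial>lborel) \<partial>lborel)"
    by (rule nn_integral_cmult) measurable
  also have "(\<integral>\<^sup>+(x::'a).
     (\<integral>\<^sup>+s. ennreal (indicator {0<..} s * s powr (a / 2 - 1) * exp (- s) * exp (- s * (norm x)\<^sup>2)) \<partial>lborel) \<partial>lborel)
     = (\<integral>\<^sup>+s. (\<integral>\<^sup>+(x::'a).
      ennreal (indicator {0<..} s * s powr (a / 2 - 1) * exp (- s) * exp (- s * (norm x)\<^sup>2)) \<partial>lborel) \<partial>lborel)"
    by (rule lborel_pair.Fubini') measurable
  also have "\<dots> = (\<integral>\<^sup>+s. ennreal (pi powr (?d / 2)) * ennreal (indicator {0<..} s * s powr ((a - ?d) / 2 - 1) * exp (- 1 * s)) \<partial>lborel)"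
  proof (intro nn_integral_cong)
    fix s :: real
    show "(\<integral>\<^sup>+(x::'a). ennreal (indicator {0<..} s * s powr (a / 2 - 1) * exp (- s) * exp (- s * (norm x)\<^sup>2)) \<partial>lborel)
      = ennreal (pi powr (?d / 2)) * ennreal (indicator {0<..} s * s powr ((a - ?d) / 2 - 1) * exp (- 1 * s))"
    proof (cases "s > 0")
      case True
      have "(\<integral>\<^sup>+(x::'a). ennreal (indicator {0<..} s * s powr (a / 2 - 1) * exp (- s) * exp (- s * (norm x)\<^sup>2)) \<partial>lborel)
         = (\<integral>\<^sup>+(x::'a). ennreal (s powr (a / 2 - 1) * exp (- s)) * ennreal (exp (- s * (norm x)\<^sup>2)) \<partial>lborel)"
        using True by (intro nn_integral_cong) (simp add: ennreal_mult[symmetric])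
      also have "\<dots> = ennreal (s powr (a / 2 - 1) * exp (- s)) * ennreal ((pi / s) powr (?d / 2))"
        by (subst nn_integral_cmult) (simp_all only: gaussian_nn_integral[OF True], measurable)
      also have "\<dots> = ennreal (s powr (a / 2 - 1) * exp (- s) * (pi / s) powr (?d / 2))"
        by (simp add: ennreal_mult)
      also have "s powr (a / 2 - 1) * exp (- s) * (pi / s) powr (?d / 2) = pi powr (?d / 2) * (s powr ((a - ?d) / 2 - 1) * exp (- s))"
        using True by (simp add: powr_divide powr_diff diff_divide_distrib mult_ac)
      finally show ?thesis using True by (simp add: ennreal_mult)
    qed simp
  qed
  also have "\<dots> = ennreal (pi powr (?d / 2)) * ennreal (Gamma ((a - ?d) / 2) / 1 powr ((a - ?d) / 2))"
  proof -
    have g: "(\<integral>\<^sup>+s. ennreal (indicator {0<..} s * s powr ((a - ?d) / 2 - 1) * exp (- 1 * s)) \<partial>lborel)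
        = ennreal (Gamma ((a - ?d) / 2) / 1 powr ((a - ?d) / 2))"
      by (rule nn_integral_Gamma_scaled) (use a in auto)
    show ?thesis unfolding g[symmetric] by (rule nn_integral_cmult) measurable
  qed
  also have "ennreal (1 / Gamma (a / 2)) * \<dots> < \<infinity>" by (simp add: ennreal_mult_less_top)
  finally show ?thesis by (intro integrableI_nonneg) auto
qed

section \<open>Time integrals of heat kernels\<close>

text \<open>For b = d/2 and q = |x|^2 this is (4 pi)^{d/2} G_s(x). Leaving b free covers the
  derivatives of G_s as well, each of which brings further factors 1/s.\<close>

definition heat_weight :: "real \<Rightarrow> real \<Rightarrow> real \<Rightarrow> real" where
  "heat_weight b q s = s powr (- b) * exp (- q / (4 * s))"

definition heat_tail :: "real \<Rightarrow> real \<Rightarrow> real \<Rightarrow> real" where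
  "heat_tail b \<tau> q = (LINT s:{\<tau><..}|lborel. heat_weight b q s)"

lemma heat_weight_measurable [measurable]: "heat_weight b q \<in> borel_measurable borel"
  unfolding heat_weight_def[abs_def] by measurable

lemma heat_weight_nonneg: "0 \<le> heat_weight b q s"
  by (simp add: heat_weight_def)

lemma heat_weight_Suc: "s > 0 \<Longrightarrow> heat_weight (b + 1) q s = heat_weight b q s / s"
  by (simp add: heat_weight_def powr_diff)

text \<open>The substitution s -> 1/s turns the integral into the Gamma integral with exponent b - 1
  and rate q/4. Convergence at infinity requires b > 1, convergence at 0 requires q > 0.\<close>

lemma
  assumes q: "q > 0" and b: "b > 1"
  shows set_integrable_heat_weight_0: "set_integrable lborel {0<..} (heat_weight b q)"
    and heat_tail_0: "heat_tail b 0 q = Gamma (b - 1) * (4 / q) powr (b - 1)"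
proof -
  let ?f = "\<lambda>t. t powr (b - 2) * exp (- (q / 4) * t)"
  let ?I = "Gamma (b - 1) / (q / 4) powr (b - 1)"
  have nn: "(\<integral>\<^sup>+t. ennreal (indicator {0<..} t *\<^sub>R ?f t) \<partial>lborel) = ennreal ?I"
    using nn_integral_Gamma_scaled[of "b - 1" "q / 4"] q b by (simp add: mult.assoc)
  have G: "Gamma (b - 1) \<ge> 0" using b by (intro Gamma_real_nonneg) auto
  have "has_bochner_integral lborel (\<lambda>t. indicator {0<..} t *\<^sub>R ?f t) ?I"
    using nn G by (intro has_bochner_integral_nn_integral) auto
  then have f: "set_integrable lborel {0<..} ?f" "(LINT t:{0<..}|lborel. ?f t) = ?I"
    by (auto simp: set_integrable_def set_lebesgue_integral_def has_bochner_integral_iff)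
  have abs_f: "?f absolutely_integrable_on {0<..}"
    using f(1) unfolding set_integrable_def by (subst integrable_completion) auto
  have im: "(\<lambda>s::real. 1 / s) ` {0<..} = {0<..}"
  proof (intro equalityI subsetI)
    fix s :: real assume "s \<in> {0<..}"
    then show "s \<in> (\<lambda>s. 1 / s) ` {0<..}" by (intro image_eqI[of _ _ "1 / s"]) auto
  qed auto
  have "integral {0<..} ?f = ?I"
    using f set_borel_integral_eq_integral(2)[OF f(1)] by simp
  then have cv: "(\<lambda>s. \<bar>- 1 / s\<^sup>2\<bar> * ?f (1 / s)) absolutely_integrable_on {0<..} \<and>
      integral {0<..} (\<lambda>s. \<bar>- 1 / s\<^sup>2\<bar> * ?f (1 / s)) = ?I"
    using abs_f im
    by (subst has_absolute_integral_change_of_variables_1'[where g = "\<lambda>s. 1 / s"])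
       (auto intro!: derivative_eq_intros simp: power2_eq_square inj_on_def)
  have eq: "indicator {0<..} s *\<^sub>R (\<bar>- 1 / s\<^sup>2\<bar> * ?f (1 / s)) = indicator {0<..} s *\<^sub>R heat_weight b q s" for s :: real
  proof (cases "s > 0")
    case True
    have "s powr (- b) = (1 / s) powr (b - 2) / s\<^sup>2"
      using True by (simp add: powr_divide powr_diff powr_minus_divide)
    with True show ?thesis by (simp add: heat_weight_def)
  qed simp
  have h: "set_integrable lebesgue {0<..} (heat_weight b q)"
    using cv unfolding set_integrable_def eq by simp
  then show hw: "set_integrable lborel {0<..} (heat_weight b q)"
    unfolding set_integrable_def by (subst (asm) integrable_completion) auto
  have "heat_tail b 0 q = integral {0<..} (heat_weight b q)"
    unfolding heat_tail_def by (rule set_borel_integral_eq_integral(2)[OF hw])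
  also have "\<dots> = integral {0<..} (\<lambda>s. \<bar>- 1 / s\<^sup>2\<bar> * ?f (1 / s))"
    using eq by (intro Henstock_Kurzweil_Integration.integral_cong) (metis indicator_simps(1) scaleR_one)
  also have "\<dots> = Gamma (b - 1) * (4 / q) powr (b - 1)"
    using cv q by (simp add: powr_divide)
  finally show "heat_tail b 0 q = Gamma (b - 1) * (4 / q) powr (b - 1)" .
qed

text \<open>Away from s = 0 the sign of q is free. Negative q do occur: differentiating at q = 0,
  that is at the spatial origin, uses a two-sided neighbourhood. The comparison function is the
  weight with q = 1.\<close>

lemma set_integrable_heat_weight:
  assumes t: "\<tau> > 0" and b: "b > 1"
  shows "set_integrable lborel {\<tau><..} (heat_weight b q)"
proof (rule set_integrable_bound)
  have "set_integrable lborel {0<..} (\<lambda>s. exp ((\<bar>q\<bar> + 1) / (4 * \<tau>)) * heat_weight b 1 s)"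
    using set_integrable_heat_weight_0[of 1 b] b by (intro set_integrable_mult_right) auto
  then show "set_integrable lborel {\<tau><..} (\<lambda>s. exp ((\<bar>q\<bar> + 1) / (4 * \<tau>)) * heat_weight b 1 s)"
    by (rule set_integrable_subset) (use t in auto)
  show "set_borel_measurable lborel {\<tau><..} (heat_weight b q)"
    unfolding set_borel_measurable_def by measurable
  have "heat_weight b q s \<le> exp ((\<bar>q\<bar> + 1) / (4 * \<tau>)) * heat_weight b 1 s" if "s > \<tau>" for s
  proof -
    have "- q / (4 * s) \<le> (\<bar>q\<bar> + 1) / (4 * s) + - 1 / (4 * s)"
    proof -
      have "- q / (4 * s) \<le> \<bar>q\<bar> / (4 * s)" using that t by (intro divide_right_mono) auto
      then show ?thesis by (simp add: add_divide_distrib)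
    qed
    also have "(\<bar>q\<bar> + 1) / (4 * s) \<le> (\<bar>q\<bar> + 1) / (4 * \<tau>)"
      using that t by (intro divide_left_mono) auto
    finally have "exp (- q / (4 * s)) \<le> exp ((\<bar>q\<bar> + 1) / (4 * \<tau>)) * exp (- 1 / (4 * s))"
      by (simp add: mult_exp_exp)
    then show ?thesis
      unfolding heat_weight_def by (simp add: mult_left_mono mult.left_commute[of "exp _"])
  qed
  then show "AE s in lborel. s \<in> {\<tau><..} \<longrightarrow> norm (heat_weight b q s) \<le> norm (exp ((\<bar>q\<bar> + 1) / (4 * \<tau>)) * heat_weight b 1 s)"
    by (auto simp: heat_weight_nonneg abs_mult)
qed

text \<open>The Lagrange point of the second-order expansion lies within |h| r of 0, so its
  exponential costs at most e^{|h| r}; this is why q drops to q - |h| on the right.\<close>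

lemma exp_second_order_bound:
  fixes h q r :: real
  assumes "r \<ge> 0"
  shows "\<bar>exp (- (q + h) * r) - exp (- q * r) + h * r * exp (- q * r)\<bar> \<le> (h * r)\<^sup>2 * exp (- (q - \<bar>h\<bar>) * r)"
proof -
  obtain t where t: "\<bar>t\<bar> \<le> \<bar>- h * r\<bar>" "exp (- h * r) = (\<Sum>m<2. (- h * r) ^ m / fact m) + exp t / fact 2 * (- h * r)\<^sup>2"
    using Maclaurin_exp_le[of "- h * r" 2] by auto
  have e: "exp (- h * r) - 1 + h * r = exp t / 2 * (h * r)\<^sup>2"
    using t(2) by (simp add: numeral_2_eq_2)
  have "exp (- (q + h) * r) - exp (- q * r) + h * r * exp (- q * r) = exp (- q * r) * (exp (- h * r) - 1 + h * r)"
    by (simp add: algebra_simps mult_exp_exp)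
  also have "\<bar>\<dots>\<bar> = exp (- q * r) * exp t * (h * r)\<^sup>2 / 2"
    unfolding e by (simp add: abs_mult)
  also have "\<dots> \<le> exp (- q * r) * exp t * (h * r)\<^sup>2" by simp
  also have "\<dots> \<le> exp (- (q - \<bar>h\<bar>) * r) * (h * r)\<^sup>2"
    using t(1) assms unfolding mult_exp_exp by (intro mult_right_mono) (simp_all add: abs_mult algebra_simps)
  finally show ?thesis by (simp only: mult.commute)
qed

lemma DERIV_quadratic_bound:
  fixes f :: "real \<Rightarrow> real"
  assumes \<delta>: "\<delta> > 0" and bound: "\<And>h. \<bar>h\<bar> < \<delta> \<Longrightarrow> \<bar>f (q + h) - f q - D * h\<bar> \<le> C * h\<^sup>2"
  shows "(f has_real_derivative D) (at q)"
  unfolding DERIV_def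
proof (rule LIM_I)
  fix r :: real assume r: "r > 0"
  define c where "c = \<bar>C\<bar> + 1"
  have c: "c > 0" by (simp add: c_def)
  show "\<exists>s>0. \<forall>h. h \<noteq> 0 \<and> norm (h - 0) < s \<longrightarrow> norm ((f (q + h) - f q) / h - D) < r"
  proof (intro exI conjI allI impI)
    show "min \<delta> (r / c) > 0" using \<delta> r c by simp
    fix h :: real assume h: "h \<noteq> 0 \<and> norm (h - 0) < min \<delta> (r / c)"
    have "norm ((f (q + h) - f q) / h - D) = \<bar>f (q + h) - f q - D * h\<bar> / \<bar>h\<bar>"
      using h by (simp add: divide_simps flip: abs_divide)
    also have "\<dots> \<le> C * h\<^sup>2 / \<bar>h\<bar>" using bound[of h] h by (intro divide_right_mono) auto
    also have "\<dots> = C * \<bar>h\<bar>" by (cases "h \<ge> 0") (simp_all add: power2_eq_square)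
    also have "\<dots> \<le> c * \<bar>h\<bar>" by (intro mult_right_mono) (auto simp: c_def)
    also have "\<dots> < r" using h c by (simp add: less_divide_eq mult.commute)
    finally show "norm ((f (q + h) - f q) / h - D) < r" .
  qed
qed

text \<open>Differentiation under the integral sign, with the weight at q - \<delta> dominating the
  second-order remainder. The subtracted g serves the two-dimensional Newtonian potential, where the
  weight is not integrable by itself but its differences are.\<close>

lemma DERIV_heat_integral:
  assumes S: "S \<in> sets lborel" "S \<subseteq> {0<..}" and \<delta>: "\<delta> > 0"
    and int: "\<And>q'. \<bar>q' - q\<bar> < \<delta> \<Longrightarrow> set_integrable lborel S (\<lambda>s. heat_weight b q' s - g s)"
    and int1: "set_integrable lborel S (heat_weight (b + 1) q)"
    and int2: "set_integrable lborel S (heat_weight (b + 2) (q - \<delta>))"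
  shows "((\<lambda>q. LINT s:S|lborel. heat_weight b q s - g s) has_real_derivative
      - (LINT s:S|lborel. heat_weight (b + 1) q s) / 4) (at q)"
proof (rule DERIV_quadratic_bound[OF \<delta>])
  fix h :: real assume h: "\<bar>h\<bar> < \<delta>"
  have i: "set_integrable lborel S (\<lambda>s. heat_weight b (q + h) s - g s)" "set_integrable lborel S (\<lambda>s. heat_weight b q s - g s)"
    using int[of "q + h"] int[of q] h \<delta> by auto
  have i1: "set_integrable lborel S (\<lambda>s. h / 4 * heat_weight (b + 1) q s)"
    using int1 by (intro set_integrable_mult_right) auto
  have i2: "set_integrable lborel S (\<lambda>s. h\<^sup>2 / 16 * heat_weight (b + 2) (q - \<delta>) s)"
    using int2 by (intro set_integrable_mult_right) auto
  let ?r = "\<lambda>s. heat_weight b (q + h) s - g s - (heat_weight b q s - g s) + h / 4 * heat_weight (b + 1) q s"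
  have ir: "set_integrable lborel S ?r"
    by (rule set_integral_add(1)[OF set_integral_diff(1)[OF i] i1])
  have bd: "norm (?r s) \<le> h\<^sup>2 / 16 * heat_weight (b + 2) (q - \<delta>) s" if "s \<in> S" for s
  proof -
    have s: "s > 0" using that S by auto
    have w: "heat_weight b q s = s powr (- b) * exp (- q * (1 / (4 * s)))" for b q by (simp add: heat_weight_def)
    have "?r s = s powr (- b) * (exp (- (q + h) * (1 / (4 * s))) - exp (- q * (1 / (4 * s))) + h * (1 / (4 * s)) * exp (- q * (1 / (4 * s))))"
      using s heat_weight_Suc[OF s, of b q] unfolding w by (simp add: algebra_simps)
    also have "norm \<dots> \<le> s powr (- b) * ((h * (1 / (4 * s)))\<^sup>2 * exp (- (q - \<bar>h\<bar>) * (1 / (4 * s))))"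
    proof -
      have "\<bar>exp (- (q + h) * (1 / (4 * s))) - exp (- q * (1 / (4 * s))) + h * (1 / (4 * s)) * exp (- q * (1 / (4 * s)))\<bar>
          \<le> (h * (1 / (4 * s)))\<^sup>2 * exp (- (q - \<bar>h\<bar>) * (1 / (4 * s)))"
        using s by (intro exp_second_order_bound) auto
      then show ?thesis by (simp only: norm_mult real_norm_def abs_mult mult_left_mono powr_ge_zero abs_of_nonneg)
    qed
    also have "\<dots> \<le> s powr (- b) * ((h * (1 / (4 * s)))\<^sup>2 * exp (- (q - \<delta>) * (1 / (4 * s))))"
      using s h by (intro mult_left_mono) (auto intro!: divide_right_mono)
    also have "\<dots> = h\<^sup>2 / 16 * heat_weight (b + 2) (q - \<delta>) s"
      using s unfolding w by (simp add: powr_diff power_mult_distrib power_divide)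
    finally show ?thesis .
  qed
  have "(LINT s:S|lborel. ?r s) = (LINT s:S|lborel. heat_weight b (q + h) s - g s) - (LINT s:S|lborel. heat_weight b q s - g s)
     + h / 4 * (LINT s:S|lborel. heat_weight (b + 1) q s)"
    by (simp only: set_integral_add(2)[OF set_integral_diff(1)[OF i] i1] set_integral_diff(2)[OF i] set_integral_mult_right)
  moreover have "norm (LINT s:S|lborel. ?r s) \<le> (LINT s:S|lborel. h\<^sup>2 / 16 * heat_weight (b + 2) (q - \<delta>) s)"
    by (rule order_trans[OF set_integral_norm_bound[OF ir]]) (intro set_integral_mono i2 bd set_integrable_norm[OF ir])
  ultimately show "\<bar>(LINT s:S|lborel. heat_weight b (q + h) s - g s) - (LINT s:S|lborel. heat_weight b q s - g s) -
     - (LINT s:S|lborel. heat_weight (b + 1) q s) / 4 * h\<bar> \<le> (LINT s:S|lborel. heat_weight (b + 2) (q - \<delta>) s) / 16 * h\<^sup>2"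
    by (simp add: mult.commute)
qed

lemma DERIV_heat_tail:
  assumes "b > 1" and "\<tau> > 0 \<or> (\<tau> = 0 \<and> q > 0)"
  shows "(heat_tail b \<tau> has_real_derivative - heat_tail (b + 1) \<tau> q / 4) (at q)"
proof -
  \<comment> \<open>When \<tau> = 0 the neighbourhood has to stay inside q > 0; when \<tau> > 0 any
    radius serves.\<close>
  define \<delta> where "\<delta> = (if \<tau> > 0 then 1 else q / 2)"
  have \<delta>: "\<delta> > 0" using assms by (auto simp: \<delta>_def)
  have w: "set_integrable lborel {\<tau><..} (heat_weight b' q')" if "b' > 1" "q' \<ge> q - \<delta>" for b' q'
    using assms that by (cases "\<tau> > 0") (auto simp: \<delta>_def intro!: set_integrable_heat_weight set_integrable_heat_weight_0)
  have "((\<lambda>q. LINT s:{\<tau><..}|lborel. heat_weight b q s - 0) has_real_derivative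
      - (LINT s:{\<tau><..}|lborel. heat_weight (b + 1) q s) / 4) (at q)"
    by (rule DERIV_heat_integral[where \<delta> = \<delta>]) (use assms \<delta> in \<open>auto intro!: w\<close>)
  then show ?thesis by (simp add: heat_tail_def[abs_def])
qed

lemma heat_weight_integral_nonneg: "0 \<le> (LINT s:S|lborel. heat_weight b q s)"
  by (auto simp: set_lebesgue_integral_def heat_weight_nonneg intro!: integral_nonneg_AE)

lemma heat_tail_nonneg: "0 \<le> heat_tail b \<tau> q"
  unfolding heat_tail_def by (rule heat_weight_integral_nonneg)

text \<open>On (0, \<tau>] the bound e^{-q/(4s)} \<le> C (4s/q)^{b+M} gives a weight of size
  q^{-(b+M)} s^M. As M is arbitrary, the error of replacing \<tau> by 0 decays in q as fast as
  desired, at the price of a power of \<tau>.\<close>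

lemma heat_tail_diff_bound:
  assumes b: "b > 1" and M: "M \<ge> 0"
  shows "\<exists>C\<ge>0. \<forall>\<tau>>0. \<forall>q>0. \<bar>heat_tail b 0 q - heat_tail b \<tau> q\<bar> \<le> C * q powr (- (b + M)) * \<tau> powr (M + 1)"
proof -
  obtain C where C: "C \<ge> 0" "\<And>r. r \<ge> 0 \<Longrightarrow> r powr (b + M) \<le> C * exp (1 * r)"
    using powr_le_exp_bound[of 1 "b + M"] b M by auto
  let ?C = "C * 4 powr (b + M)"
  have "\<bar>heat_tail b 0 q - heat_tail b \<tau> q\<bar> \<le> ?C * q powr (- (b + M)) * \<tau> powr (M + 1)" if t: "\<tau> > 0" and q: "q > 0" for \<tau> q
  proof -
    have un: "{0<..} = {0<..\<tau>} \<union> {\<tau><..}" using t by auto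
    have i0: "set_integrable lborel {0<..} (heat_weight b q)" by (rule set_integrable_heat_weight_0[OF q b])
    have i1: "set_integrable lborel {0<..\<tau>} (heat_weight b q)" by (rule set_integrable_subset[OF i0]) (use t in auto)
    have "heat_tail b 0 q = (LINT s:{0<..\<tau>}|lborel. heat_weight b q s) + heat_tail b \<tau> q"
      unfolding heat_tail_def un using i1 set_integrable_heat_weight[OF t b] by (intro set_integral_Un) auto
    moreover have "0 \<le> (LINT s:{0<..\<tau>}|lborel. heat_weight b q s)"
      by (rule heat_weight_integral_nonneg)
    moreover have "(LINT s:{0<..\<tau>}|lborel. heat_weight b q s) \<le> (LINT s:{0<..\<tau>}|lborel. ?C * q powr (- (b + M)) * \<tau> powr M)"
    proof (rule set_integral_mono[OF i1])
      show "set_integrable lborel {0<..\<tau>} (\<lambda>s. ?C * q powr (- (b + M)) * \<tau> powr M)"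
        unfolding set_integrable_def by (intro integrable_scaleR_left) (use t in auto)
      fix s assume s: "s \<in> {0<..\<tau>}"
      have "(q / (4 * s)) powr (b + M) * exp (- q / (4 * s)) \<le> C"
        using C(2)[of "q / (4 * s)"] q s by (simp add: exp_minus field_simps)
      moreover have "e \<le> C * r powr (- k)" if "r powr k * e \<le> C" "r > 0" for r k e :: real
        using that by (simp add: powr_minus field_simps)
      ultimately have "exp (- q / (4 * s)) \<le> C * (q / (4 * s)) powr (- (b + M))"
        using q s by (metis divide_pos_pos mult_pos_pos zero_less_numeral greaterThanAtMost_iff)
      also have "(q / (4 * s)) powr (- (b + M)) = q powr (- (b + M)) * 4 powr (b + M) * s powr (b + M)"
      proof -
        have "(q / (4 * s)) powr (- k) = q powr (- k) * 4 powr k * s powr k" for k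
          using q s by (simp add: powr_divide powr_mult powr_minus field_simps)
        then show ?thesis .
      qed
      finally have "heat_weight b q s \<le> s powr (- b) * (C * (q powr (- (b + M)) * 4 powr (b + M) * s powr (b + M)))"
        unfolding heat_weight_def by (intro mult_left_mono) auto
      also have "\<dots> = ?C * q powr (- (b + M)) * (s powr (- b) * s powr (b + M))" by simp
      also have "s powr (- b) * s powr (b + M) = s powr M" by (simp flip: powr_add)
      also have "?C * q powr (- (b + M)) * s powr M \<le> ?C * q powr (- (b + M)) * \<tau> powr M"
        using s M C(1) by (intro mult_left_mono powr_mono2) auto
      finally show "heat_weight b q s \<le> ?C * q powr (- (b + M)) * \<tau> powr M" .
    qed
    moreover have "(LINT s:{0<..\<tau>}|lborel. ?C * q powr (- (b + M)) * \<tau> powr M) = ?C * q powr (- (b + M)) * \<tau> powr (M + 1)"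
      using t by (simp add: set_lebesgue_integral_def powr_add)
    ultimately show ?thesis by linarith
  qed
  then show ?thesis using C(1) by (intro exI[of _ ?C]) auto
qed

text \<open>The weight is bounded for s above \<open>\<tau>0\<close>, so the tail is Lipschitz in
  its lower limit. This ultimately makes the Oseen kernel continuous in time.\<close>

lemma heat_tail_lipschitz:
  assumes b: "b > 1" and t0: "\<tau>0 > 0" and t: "\<tau>0 \<le> \<tau>" "\<tau> \<le> \<tau>'"
  shows "\<bar>heat_tail b \<tau> q - heat_tail b \<tau>' q\<bar> \<le> \<tau>0 powr (- b) * exp (\<bar>q\<bar> / (4 * \<tau>0)) * (\<tau>' - \<tau>)"
proof -
  have un: "{\<tau><..} = {\<tau><..\<tau>'} \<union> {\<tau>'<..}" using t by auto
  have i0: "set_integrable lborel {\<tau><..} (heat_weight b q)" using t0 t by (intro set_integrable_heat_weight b) auto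
  have i1: "set_integrable lborel {\<tau><..\<tau>'} (heat_weight b q)" by (rule set_integrable_subset[OF i0]) (use t in auto)
  have i2: "set_integrable lborel {\<tau>'<..} (heat_weight b q)" using t0 t by (intro set_integrable_heat_weight b) auto
  have "heat_tail b \<tau> q = (LINT s:{\<tau><..\<tau>'}|lborel. heat_weight b q s) + heat_tail b \<tau>' q"
    unfolding heat_tail_def un using i1 i2 by (intro set_integral_Un) auto
  moreover have "0 \<le> (LINT s:{\<tau><..\<tau>'}|lborel. heat_weight b q s)"
    by (rule heat_weight_integral_nonneg)
  moreover have "(LINT s:{\<tau><..\<tau>'}|lborel. heat_weight b q s) \<le> (LINT s:{\<tau><..\<tau>'}|lborel. \<tau>0 powr (- b) * exp (\<bar>q\<bar> / (4 * \<tau>0)))"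
  proof (rule set_integral_mono[OF i1])
    show "set_integrable lborel {\<tau><..\<tau>'} (\<lambda>s. \<tau>0 powr (- b) * exp (\<bar>q\<bar> / (4 * \<tau>0)))"
      unfolding set_integrable_def by (intro integrable_scaleR_left) (use t in auto)
    fix s assume s: "s \<in> {\<tau><..\<tau>'}"
    have "- q / (4 * s) \<le> \<bar>q\<bar> / (4 * s)" using s t t0 by (intro divide_right_mono) auto
    also have "\<dots> \<le> \<bar>q\<bar> / (4 * \<tau>0)" using s t t0 by (intro divide_left_mono) auto
    finally show "heat_weight b q s \<le> \<tau>0 powr (- b) * exp (\<bar>q\<bar> / (4 * \<tau>0))"
      unfolding heat_weight_def using s t t0 b by (intro mult_mono powr_mono2') auto
  qed
  moreover have "(LINT s:{\<tau><..\<tau>'}|lborel. \<tau>0 powr (- b) * exp (\<bar>q\<bar> / (4 * \<tau>0))) = \<tau>0 powr (- b) * exp (\<bar>q\<bar> / (4 * \<tau>0)) * (\<tau>' - \<tau>)"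
    using t by (simp add: set_lebesgue_integral_def)
  ultimately show ?thesis by linarith
qed

lemma isCont_heat_tail_left:
  assumes b: "b > 1" and t: "\<tau> > 0"
  shows "isCont (\<lambda>\<tau>. heat_tail b \<tau> q) \<tau>"
proof -
  define L where "L = (\<tau> / 2) powr (- b) * exp (\<bar>q\<bar> / (4 * (\<tau> / 2)))"
  have L: "\<bar>heat_tail b \<tau>' q - heat_tail b \<tau> q\<bar> \<le> L * \<bar>\<tau>' - \<tau>\<bar>" if "\<tau>' > \<tau> / 2" for \<tau>'
    using heat_tail_lipschitz[OF b, of "\<tau> / 2" "\<tau>" "\<tau>'" q] heat_tail_lipschitz[OF b, of "\<tau> / 2" "\<tau>'" "\<tau>" q] that t
    unfolding L_def by (cases "\<tau> \<le> \<tau>'") (auto simp: abs_minus_commute)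
  have "((\<lambda>\<tau>'. heat_tail b \<tau>' q - heat_tail b \<tau> q) \<longlongrightarrow> 0) (at \<tau>)"
  proof (rule Lim_null_comparison)
    show "\<forall>\<^sub>F \<tau>' in at \<tau>. norm (heat_tail b \<tau>' q - heat_tail b \<tau> q) \<le> L * \<bar>\<tau>' - \<tau>\<bar>"
      using eventually_at_topological[of "\<lambda>\<tau>'. norm (heat_tail b \<tau>' q - heat_tail b \<tau> q) \<le> L * \<bar>\<tau>' - \<tau>\<bar>"] L t
      by (auto intro!: exI[of _ "{\<tau> / 2<..}"])
    have "((\<lambda>\<tau>'. L * \<bar>\<tau>' - \<tau>\<bar>) \<longlongrightarrow> L * \<bar>\<tau> - \<tau>\<bar>) (at \<tau>)" by (intro tendsto_intros)
    then show "((\<lambda>\<tau>'. L * \<bar>\<tau>' - \<tau>\<bar>) \<longlongrightarrow> 0) (at \<tau>)" by simp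
  qed
  then show ?thesis by (simp add: isCont_def LIM_zero_iff)
qed

text \<open>Trades powers of q for powers of s at the cost of half the exponent: q^k = (q/s)^k s^k,
  and (q/s)^k \<le> C e^{q/(8s)}. The rate 1/8 leaves e^{-q/(8s)}, which is the weight at
  q/2.\<close>

lemma heat_weight_power_bound:
  assumes k: "k \<ge> 0"
  shows "\<exists>C\<ge>0. \<forall>s>0. \<forall>q\<ge>0. q powr k * heat_weight b q s \<le> C * heat_weight (b - k) (q / 2) s"
proof -
  obtain C where C: "C \<ge> 0" "\<And>r. r \<ge> 0 \<Longrightarrow> r powr k \<le> C * exp (1 / 8 * r)"
    using powr_le_exp_bound[of "1 / 8" k] k by auto
  have "q powr k * heat_weight b q s \<le> C * heat_weight (b - k) (q / 2) s" if s: "s > 0" and q: "q \<ge> 0" for s q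
  proof -
    have "q powr k = (q / s) powr k * s powr k" using s q by (simp flip: powr_mult)
    then have "q powr k * heat_weight b q s = (q / s) powr k * (s powr k * s powr (- b)) * exp (- q / (4 * s))"
      by (simp add: heat_weight_def)
    also have "s powr k * s powr (- b) = s powr (- (b - k))" by (simp flip: powr_add)
    also have "(q / s) powr k * s powr (- (b - k)) * exp (- q / (4 * s)) \<le> C * exp (1 / 8 * (q / s)) * s powr (- (b - k)) * exp (- q / (4 * s))"
      using C(2)[of "q / s"] s q by (intro mult_right_mono) auto
    also have "\<dots> = C * s powr (- (b - k)) * exp (1 / 8 * (q / s) + - q / (4 * s))" by (simp only: mult_ac exp_add)
    also have "1 / 8 * (q / s) + - q / (4 * s) = - (q / 2) / (4 * s)" using s by (simp add: field_simps)
    finally show ?thesis by (simp add: heat_weight_def mult.assoc)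
  qed
  then show ?thesis using C(1) by auto
qed

lemma heat_tail_power_bound:
  assumes k: "k \<ge> 0" and b: "b - k > 1"
  shows "\<exists>C\<ge>0. \<forall>\<tau>>0. \<forall>q\<ge>0. q powr k * heat_tail b \<tau> q \<le> C * heat_tail (b - k) \<tau> (q / 2)"
proof -
  obtain C where C: "C \<ge> 0" "\<And>s q. s > 0 \<Longrightarrow> q \<ge> 0 \<Longrightarrow> q powr k * heat_weight b q s \<le> C * heat_weight (b - k) (q / 2) s"
    using heat_weight_power_bound[OF k, of b] by blast
  have "q powr k * heat_tail b \<tau> q \<le> C * heat_tail (b - k) \<tau> (q / 2)" if t: "\<tau> > 0" and q: "q \<ge> 0" for \<tau> q
  proof -
    have "(LINT s:{\<tau><..}|lborel. q powr k * heat_weight b q s) \<le> (LINT s:{\<tau><..}|lborel. C * heat_weight (b - k) (q / 2) s)"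
      using t q k b C by (intro set_integral_mono set_integrable_mult_right set_integrable_heat_weight) auto
    then show ?thesis by (simp add: heat_tail_def)
  qed
  then show ?thesis using C(1) by blast
qed

text \<open>With this b the Gaussian integral in x turns s^{-b} into s^{-3/2}, whose integral over s
  > \<tau> is 2 \<tau>^{-1/2}. This is one source of the t^{-1/2} in the L^1 bound of the
  kernel.\<close>

lemma nn_integral_heat_tail:
  assumes t: "\<tau> > 0" and c: "c > 0" and b: "b = real DIM('a::euclidean_space) / 2 + 3 / 2"
  shows "(\<integral>\<^sup>+(x::'a). ennreal (heat_tail b \<tau> (c * (norm x)\<^sup>2)) \<partial>lborel)
    \<le> ennreal ((4 * pi / c) powr (real DIM('a) / 2) * (2 * \<tau> powr (- 1 / 2)))"
proof -
  let ?d = "real DIM('a)"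
  have "b > 1" using b DIM_positive[where 'a='a] by simp
  have ht: "ennreal (heat_tail b \<tau> q) = (\<integral>\<^sup>+s. ennreal (indicator {\<tau><..} s * heat_weight b q s) \<partial>lborel)" for q
    unfolding heat_tail_def set_lebesgue_integral_def
    using set_integrable_heat_weight[OF t \<open>b > 1\<close>, of q]
    by (subst nn_integral_eq_integral) (auto simp: set_integrable_def heat_weight_nonneg)
  have [measurable]: "(\<lambda>p. heat_weight b (c * (norm (fst p :: 'a))\<^sup>2) (snd p)) \<in> borel_measurable (lborel \<Otimes>\<^sub>M lborel)"
    "(\<lambda>p. heat_weight b (c * (norm (snd p :: 'a))\<^sup>2) (fst p)) \<in> borel_measurable (lborel \<Otimes>\<^sub>M lborel)"
    unfolding heat_weight_def by measurable
  have "(\<integral>\<^sup>+(x::'a). ennreal (heat_tail b \<tau> (c * (norm x)\<^sup>2)) \<partial>lborel) =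
     (\<integral>\<^sup>+(x::'a). (\<integral>\<^sup>+s. ennreal (indicator {\<tau><..} s * heat_weight b (c * (norm x)\<^sup>2) s) \<partial>lborel) \<partial>lborel)"
    by (simp add: ht)
  also have "\<dots> = (\<integral>\<^sup>+s. (\<integral>\<^sup>+(x::'a). ennreal (indicator {\<tau><..} s * heat_weight b (c * (norm x)\<^sup>2) s) \<partial>lborel) \<partial>lborel)"
    by (rule lborel_pair.Fubini') measurable
  also have "\<dots> = (\<integral>\<^sup>+s. ennreal ((4 * pi / c) powr (?d / 2)) * ennreal (s powr (- 3 / 2)) * indicator {\<tau><..} s \<partial>lborel)"
  proof (intro nn_integral_cong)
    fix s :: real
    show "(\<integral>\<^sup>+(x::'a). ennreal (indicator {\<tau><..} s * heat_weight b (c * (norm x)\<^sup>2) s) \<partial>lborel)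
      = ennreal ((4 * pi / c) powr (?d / 2)) * ennreal (s powr (- 3 / 2)) * indicator {\<tau><..} s"
    proof (cases "s > \<tau>")
      case True
      then have s: "s > 0" using t by simp
      have "(\<integral>\<^sup>+(x::'a). ennreal (indicator {\<tau><..} s * heat_weight b (c * (norm x)\<^sup>2) s) \<partial>lborel)
         = (\<integral>\<^sup>+(x::'a). ennreal (s powr (- b)) * ennreal (exp (- (c / (4 * s)) * (norm x)\<^sup>2)) \<partial>lborel)"
        using True by (intro nn_integral_cong) (simp add: heat_weight_def ennreal_mult)
      also have "\<dots> = ennreal (s powr (- b)) * ennreal ((pi / (c / (4 * s))) powr (?d / 2))"
        using gaussian_nn_integral[of "c / (4 * s)", where 'a='a] s c by (subst nn_integral_cmult) auto
      also have "\<dots> = ennreal (s powr (- b) * ((4 * pi / c) * s) powr (?d / 2))"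
        by (simp add: ennreal_mult mult_ac)
      also have "s powr (- b) * ((4 * pi / c) * s) powr (?d / 2) = (4 * pi / c) powr (?d / 2) * (s powr (- b) * s powr (?d / 2))"
        using s c by (subst powr_mult) auto
      also have "s powr (- b) * s powr (?d / 2) = s powr (- 3 / 2)" by (simp add: b flip: powr_add)
      finally show ?thesis using True by (simp add: ennreal_mult)
    qed simp
  qed
  also have "\<dots> = ennreal ((4 * pi / c) powr (?d / 2)) * (\<integral>\<^sup>+s. ennreal (s powr (- 3 / 2)) * indicator {\<tau><..} s \<partial>lborel)"
    by (subst nn_integral_cmult[symmetric]) (auto simp: mult.assoc)
  also have "(\<integral>\<^sup>+s. ennreal (s powr (- 3 / 2)) * indicator {\<tau><..} s \<partial>lborel) \<le> (\<integral>\<^sup>+s. ennreal (s powr (- 3 / 2)) * indicator {\<tau>..} s \<partial>lborel)"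
    by (intro nn_integral_mono) (auto split: split_indicator)
  also have "\<dots> = ennreal (0 - - 2 * \<tau> powr (- 1 / 2))"
  proof (rule nn_integral_FTC_atLeast)
    show "((\<lambda>s. - 2 * s powr (- 1 / 2)) has_real_derivative s powr (- 3 / 2)) (at s)" if "\<tau> \<le> s" for s
      using that t by (auto intro!: derivative_eq_intros)
    have "((\<lambda>s::real. - 2 * s powr (- 1 / 2)) \<longlongrightarrow> - 2 * 0) at_top"
      by (intro tendsto_mult tendsto_const tendsto_neg_powr filterlim_ident) auto
    then show "((\<lambda>s::real. - 2 * s powr (- 1 / 2)) \<longlongrightarrow> 0) at_top" by simp
  qed auto
  finally show ?thesis by (simp add: ennreal_mult mult_left_mono)
qed

section \<open>The Newtonian potential\<close>

lemma partial_eqI: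
  assumes "((\<lambda>s. f (x + s *\<^sub>R axis i 1)) has_real_derivative D) (at 0)"
  shows "partial i f x = D"
  unfolding partial_def by (rule DERIV_imp_deriv[OF assms])

lemma partial_has_derivative:
  assumes "(f has_derivative f') (at x)"
  shows "partial i f x = f' (axis i 1)"
proof (rule partial_eqI)
  have l: "linear f'" using assms by (rule has_derivative_linear)
  have "((\<lambda>s. f (x + s *\<^sub>R axis i 1)) has_derivative (\<lambda>s. f' (s *\<^sub>R axis i 1))) (at 0)"
    by (rule has_derivative_compose[of "\<lambda>s. x + s *\<^sub>R axis i 1"]) (use assms in \<open>auto intro!: derivative_eq_intros\<close>)
  then show "((\<lambda>s. f (x + s *\<^sub>R axis i 1)) has_real_derivative f' (axis i 1)) (at 0)"
    unfolding has_field_derivative_def by (rule has_derivative_eq_rhs) (auto simp: linear_cmul[OF l])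
qed

lemma partial_cong_open:
  assumes "open S" "x \<in> S" "\<And>y. y \<in> S \<Longrightarrow> f y = g y"
  shows "partial i f x = partial i g x"
  unfolding partial_def
proof (rule deriv_cong_ev)
  have "continuous (at 0) (\<lambda>s. x + s *\<^sub>R axis i 1)" by (intro continuous_intros)
  then have "\<forall>\<^sub>F s in at 0. x + s *\<^sub>R axis i 1 \<in> S"
    using assms by (auto simp: continuous_at intro: topological_tendstoD)
  then have "\<forall>\<^sub>F s in nhds 0. x + s *\<^sub>R axis i 1 \<in> S"
    using assms by (simp add: eventually_nhds_conv_at)
  then show "\<forall>\<^sub>F s in nhds 0. f (x + s *\<^sub>R axis i 1) = g (x + s *\<^sub>R axis i 1)"
    by (rule eventually_mono) (rule assms)
qed simp

lemma partial_cong_nonzero: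
  assumes "x \<noteq> 0" "\<And>y. y \<noteq> 0 \<Longrightarrow> f y = g y"
  shows "partial i f x = partial i g x"
  by (rule partial_cong_open[of "- {0}"]) (use assms in auto)

lemma has_derivative_norm_power2:
  "((\<lambda>x::'a::real_inner. (norm x)\<^sup>2) has_derivative (\<lambda>h. 2 * (x \<bullet> h))) (at x)"
  unfolding power2_norm_eq_inner by (auto intro!: derivative_eq_intros simp: inner_commute)

lemma has_derivative_radial:
  assumes "(g has_real_derivative g') (at ((norm x)\<^sup>2))"
  shows "((\<lambda>x::'a::real_inner. g ((norm x)\<^sup>2)) has_derivative (\<lambda>h. g' * (2 * (x \<bullet> h)))) (at x)"
  by (rule has_derivative_compose[OF has_derivative_norm_power2, of g "(*) g'" x, simplified])
     (use assms in \<open>simp add: has_field_derivative_def\<close>)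

lemma has_derivative_component: "((\<lambda>x::real^'d. x $ i) has_derivative (\<lambda>h. h $ i)) (at x)"
  by (intro bounded_linear_imp_has_derivative bounded_linear_vec_nth)

definition heat_const :: "'d::finite itself \<Rightarrow> real" where
  "heat_const _ = (4 * pi) powr (- real CARD('d) / 2)"

text \<open>\<open>smooth_K t i j\<close> is \<open>\<integral>\<^sub>t\<^sup>\<infinity> \<partial>\<^sub>i\<partial>\<^sub>jG\<^sub>s ds\<close>, with the polynomial factors of \<open>\<partial>\<^sub>i\<partial>\<^sub>jG\<^sub>s\<close> taken out of the
  integral; \<open>smooth_DK t i j k\<close> is its \<open>k\<close>-th partial derivative.\<close>

definition smooth_K :: "real \<Rightarrow> 'd::finite \<Rightarrow> 'd \<Rightarrow> real^'d \<Rightarrow> real" where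
  "smooth_K t i j x = heat_const TYPE('d) *
     (x $ i * x $ j / 4 * heat_tail (real CARD('d) / 2 + 2) t ((norm x)\<^sup>2)
      - (if i = j then 1 / 2 else 0) * heat_tail (real CARD('d) / 2 + 1) t ((norm x)\<^sup>2))"

definition smooth_DK :: "real \<Rightarrow> 'd::finite \<Rightarrow> 'd \<Rightarrow> 'd \<Rightarrow> real^'d \<Rightarrow> real" where
  "smooth_DK t i j k x = heat_const TYPE('d) *
     (((if k = i then x $ j else 0) + (if k = j then x $ i else 0) + (if i = j then x $ k else 0)) / 4
        * heat_tail (real CARD('d) / 2 + 2) t ((norm x)\<^sup>2)
      - x $ i * x $ j * x $ k / 8 * heat_tail (real CARD('d) / 2 + 3) t ((norm x)\<^sup>2))"

lemma has_derivative_heat_tail_norm: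
  fixes x :: "real^'d"
  assumes "b > 1" "t > 0 \<or> (t = 0 \<and> x \<noteq> 0)"
  shows "((\<lambda>x. heat_tail b t ((norm x)\<^sup>2)) has_derivative (\<lambda>h. - heat_tail (b + 1) t ((norm x)\<^sup>2) / 4 * (2 * (x \<bullet> h)))) (at x)"
  by (rule has_derivative_radial, rule DERIV_heat_tail) (use assms in auto)

lemma DERIV_line_component:
  "((\<lambda>s. (x + s *\<^sub>R axis k 1 :: real^'d) $ i) has_real_derivative (if k = i then 1 else 0)) (at 0)"
  by (auto simp: axis_def intro!: derivative_eq_intros)

lemma DERIV_line_heat_tail:
  fixes x :: "real^'d"
  assumes "b > 1" "t > 0 \<or> (t = 0 \<and> x \<noteq> 0)"
  shows "((\<lambda>s. heat_tail b t ((norm (x + s *\<^sub>R axis k 1))\<^sup>2)) has_real_derivative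
     - heat_tail (b + 1) t ((norm x)\<^sup>2) * x $ k / 2) (at 0)"
proof -
  have "((\<lambda>s. heat_tail b t ((norm (x + s *\<^sub>R axis k 1))\<^sup>2)) has_derivative
     (\<lambda>s. - heat_tail (b + 1) t ((norm x)\<^sup>2) / 4 * (2 * (x \<bullet> (s *\<^sub>R axis k 1))))) (at 0)"
    by (rule has_derivative_compose[of "\<lambda>s. x + s *\<^sub>R axis k 1"])
       (use has_derivative_heat_tail_norm[OF assms] in \<open>auto intro!: derivative_eq_intros\<close>)
  then show ?thesis
    unfolding has_field_derivative_def by (rule has_derivative_eq_rhs) (auto simp: inner_axis)
qed

text \<open>Differentiating a tail raises its index by one and brings out -x_k/2. The diagonal term,
  of index d/2 + 1, therefore joins the terms of index d/2 + 2 and completes the symmetric bracket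
  of \<open>smooth_DK\<close>.\<close>

lemma partial_smooth_K:
  fixes x :: "real^'d"
  assumes t: "t > 0 \<or> (t = 0 \<and> x \<noteq> 0)"
  shows "partial k (smooth_K t i j) x = smooth_DK t i j k x"
proof (rule partial_eqI)
  let ?d = "real CARD('d)"
  have eq: "?d / 2 + 1 + 1 = ?d / 2 + 2" "?d / 2 + 2 + 1 = ?d / 2 + 3" by auto
  have d: "?d / 2 + 1 > 1" "?d / 2 + 2 > 1" by (auto simp: add_pos_pos)
  show "((\<lambda>s. smooth_K t i j (x + s *\<^sub>R axis k 1)) has_real_derivative smooth_DK t i j k x) (at 0)"
  proof -
    have gen: "((\<lambda>s. c * (X s * Y s / 4 * H2 s - e * H1 s)) has_real_derivative
        c * ((X' * Y 0 + X 0 * Y') / 4 * H2 0 + X 0 * Y 0 / 4 * H2' - e * H1')) (at 0)"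
      if "(X has_real_derivative X') (at 0)" "(Y has_real_derivative Y') (at 0)"
        "(H2 has_real_derivative H2') (at 0)" "(H1 has_real_derivative H1') (at 0)"
      for X Y H1 H2 X' Y' H1' H2' c e
      by (auto intro!: derivative_eq_intros that simp: field_simps)
    show ?thesis
      unfolding smooth_K_def
      by (rule DERIV_cong[OF gen[OF DERIV_line_component DERIV_line_component
            DERIV_line_heat_tail[OF d(2) t, unfolded eq] DERIV_line_heat_tail[OF d(1) t, unfolded eq]]])
         (simp add: smooth_DK_def algebra_simps add_divide_distrib)
  qed
qed

section \<open>The Newtonian potential as a time integral of heat kernels\<close>

definition newton_radial :: "nat \<Rightarrow> real \<Rightarrow> real" where
  "newton_radial n q = (let d = real n in
     if n = 2 then - ln q / (4 * pi) else q powr ((2 - d) / 2) / (d * (d - 2) * unit_ball_vol d))"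

lemma newton_eq_radial:
  assumes "x \<noteq> 0"
  shows "newton (x :: real^'d) = newton_radial CARD('d) ((norm x)\<^sup>2)"
proof -
  have "norm x powr (2 - real CARD('d)) = ((norm x)\<^sup>2) powr ((2 - real CARD('d)) / 2)"
    using assms by (simp add: powr_powr diff_divide_distrib flip: powr_numeral)
  moreover have "ln ((norm x)\<^sup>2) = 2 * ln (norm x)" using assms by (simp add: ln_realpow)
  ultimately show ?thesis by (simp add: newton_def newton_radial_def Let_def)
qed

lemma surface_constant:
  assumes "d > (0::real)"
  shows "d * unit_ball_vol d = 2 * pi powr (d / 2) / Gamma (d / 2)"
proof -
  have "Gamma (d / 2 + 1) = d / 2 * Gamma (d / 2)" using assms by (intro Gamma_plus1) (auto elim!: nonpos_Ints_cases)
  moreover have "Gamma (d / 2) > 0" using assms by (intro Gamma_real_pos) auto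
  ultimately show ?thesis unfolding unit_ball_vol_def using assms by (simp only:) (simp add: field_simps)
qed

text \<open>Both sides are multiples of q^{-d/2}, also in dimension 2, where the potential is a
  logarithm. Equality of the constants is the agreement of the sphere area in \<open>newton\<close>
  with the Gaussian normalisation, through Gamma(d/2).\<close>

lemma DERIV_newton_radial:
  assumes n: "n \<ge> 2" and q: "q > 0"
  shows "(newton_radial n has_real_derivative - ((4 * pi) powr (- real n / 2) * heat_tail (real n / 2 + 1) 0 q / 4)) (at q)"
proof -
  define d where "d = real n"
  have d: "d \<ge> 2" using n by (simp add: d_def)
  have G: "Gamma (d / 2) > 0" using d by (intro Gamma_real_pos) auto
  have "(newton_radial n has_real_derivative - (q powr (- d / 2) / (2 * (d * unit_ball_vol d)))) (at q)"
  proof (cases "n = 2")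
    case True
    then show ?thesis using q unfolding newton_radial_def[abs_def] Let_def d_def
      by (auto intro!: derivative_eq_intros simp: powr_minus unit_ball_vol_2 field_simps)
  next
    case False
    then have d2: "d > 2" using n by (simp add: d_def)
    have "- (q powr (- d / 2) / (2 * (d * unit_ball_vol d))) = q powr ((2 - d) / 2 - 1) * ((2 - d) / 2) / (d * (d - 2) * unit_ball_vol d)"
    proof -
      have "(2 - d) / 2 - 1 = - d / 2" by (simp add: field_simps)
      moreover have "unit_ball_vol d > 0" using d by simp
      moreover have "- (A / (2 * (d * v))) = A * (- e / 2) / (d * e * v)" if "v > 0" "e > 0" for A v e
        using that d2 by (simp add: field_simps)
      from this[of "unit_ball_vol d" "d - 2" "q powr (- d / 2)"]
      have "unit_ball_vol d > 0 \<Longrightarrow> - (q powr (- d / 2) / (2 * (d * unit_ball_vol d)))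
        = q powr (- d / 2) * ((2 - d) / 2) / (d * (d - 2) * unit_ball_vol d)" using d2 by simp
      ultimately show ?thesis by simp
    qed
    moreover have "newton_radial n = (\<lambda>q. q powr ((2 - d) / 2) / (d * (d - 2) * unit_ball_vol d))"
      using False by (simp add: newton_radial_def[abs_def] Let_def d_def)
    moreover have "((\<lambda>q. q powr ((2 - d) / 2) / (d * (d - 2) * unit_ball_vol d)) has_real_derivative
      ((2 - d) / 2 * q powr ((2 - d) / 2 - 1)) / (d * (d - 2) * unit_ball_vol d)) (at q)"
      by (intro DERIV_cdivide has_real_derivative_powr q)
    ultimately show ?thesis by (simp only: mult.commute)
  qed
  also have "- (q powr (- d / 2) / (2 * (d * unit_ball_vol d))) = - ((4 * pi) powr (- d / 2) * heat_tail (d / 2 + 1) 0 q / 4)"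
  proof -
    have "(4 * pi) powr (- d / 2) * (4 / q) powr (d / 2) = pi powr (- d / 2) * q powr (- d / 2)"
      using q by (simp add: powr_mult powr_divide powr_minus field_simps)
    then show ?thesis
      unfolding surface_constant[OF order_less_le_trans[OF zero_less_numeral d]]
      using heat_tail_0[OF q, of "d / 2 + 1"] d G by (simp add: powr_minus field_simps)
  qed
  finally show ?thesis by (simp add: d_def)
qed

text \<open>From 1 - e^{-a} \<le> a. A difference of two weights gains one factor 1/s, which makes
  it integrable at infinity for every b > 0.\<close>

lemma heat_weight_diff_bound:
  assumes s: "s > 0"
  shows "\<bar>heat_weight b q s - heat_weight b r s\<bar> \<le> \<bar>q - r\<bar> / 4 * heat_weight (b + 1) (min q r) s"
proof -
  have *: "\<bar>heat_weight b q s - heat_weight b r s\<bar> \<le> (r - q) / 4 * heat_weight (b + 1) q s" if "q \<le> r" for q r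
  proof -
    define e where "e = exp (- ((r - q) / (4 * s)))"
    have e: "1 - (r - q) / (4 * s) \<le> e" "e \<le> 1"
      using exp_ge_add_one_self[of "- ((r - q) / (4 * s))"] that s by (auto simp: e_def)
    have "heat_weight b q s - heat_weight b r s = heat_weight b q s * (1 - e)"
      by (simp add: heat_weight_def e_def algebra_simps mult_exp_exp diff_divide_distrib)
    moreover have "0 \<le> heat_weight b q s * (1 - e)" using e by (simp add: heat_weight_nonneg)
    moreover have "heat_weight b q s * (1 - e) \<le> heat_weight b q s * ((r - q) / (4 * s))"
      using e by (intro mult_left_mono) (auto simp: heat_weight_nonneg)
    moreover have "heat_weight b q s * ((r - q) / (4 * s)) = (r - q) / 4 * heat_weight (b + 1) q s"
      by (simp add: heat_weight_Suc[OF s])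
    ultimately show ?thesis by linarith
  qed
  show ?thesis
    using *[of q r] *[of r q] by (cases "q \<le> r") (auto simp: min_def abs_minus_commute)
qed

lemma set_integrable_heat_weight_diff:
  assumes "b > 0" "q > 0" "r > 0"
  shows "set_integrable lborel {0<..} (\<lambda>s. heat_weight b q s - heat_weight b r s)"
proof (rule set_integrable_bound)
  show "set_integrable lborel {0<..} (\<lambda>s. \<bar>q - r\<bar> / 4 * heat_weight (b + 1) (min q r) s)"
    using assms by (intro set_integrable_mult_right set_integrable_heat_weight_0) auto
  show "set_borel_measurable lborel {0<..} (\<lambda>s. heat_weight b q s - heat_weight b r s)"
    unfolding set_borel_measurable_def by measurable
  show "AE s in lborel. s \<in> {0<..} \<longrightarrow> norm (heat_weight b q s - heat_weight b r s) \<le> norm (\<bar>q - r\<bar> / 4 * heat_weight (b + 1) (min q r) s)"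
    using heat_weight_diff_bound by (auto simp: abs_mult heat_weight_nonneg)
qed

text \<open>Both sides have the same derivative in q and agree at q = 1, where the integrand
  vanishes identically. Subtracting the weight at q = 1 treats all dimensions uniformly.\<close>

lemma newton_radial_integral:
  assumes n: "n \<ge> 2" and q: "q > 0"
  shows "newton_radial n q = newton_radial n 1
    + (4 * pi) powr (- real n / 2) * (LINT s:{0<..}|lborel. heat_weight (real n / 2) q s - heat_weight (real n / 2) 1 s)"
proof -
  define c where "c = (4 * pi) powr (- real n / 2)"
  define b where "b = real n / 2"
  have b: "b \<ge> 1" using n by (simp add: b_def)
  let ?F = "\<lambda>q. LINT s:{0<..}|lborel. heat_weight b q s - heat_weight b 1 s"
  have pos: "q' > 0" if "\<bar>q' - q\<bar> * 2 < q" for q q' :: real using that by (auto simp: abs_if split: if_splits)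
  have DF: "(?F has_real_derivative - heat_tail (b + 1) 0 q / 4) (at q)" if "q > 0" for q
    unfolding heat_tail_def
    by (rule DERIV_heat_integral[where \<delta> = "q / 2"])
       (use that b pos in \<open>auto intro!: set_integrable_heat_weight_diff set_integrable_heat_weight_0\<close>)
  have "((\<lambda>q. newton_radial n q - c * ?F q) has_real_derivative 0) (at q within {0<..})" if "q \<in> {0<..}" for q
  proof -
    have "((\<lambda>q. newton_radial n q - c * ?F q) has_real_derivative
       - (c * heat_tail (b + 1) 0 q / 4) - c * (- heat_tail (b + 1) 0 q / 4)) (at q)"
      using DERIV_newton_radial[OF n, of q] that by (intro DERIV_diff DERIV_cmult DF) (auto simp: c_def b_def)
    then show ?thesis by (simp add: has_field_derivative_at_within)
  qed
  then obtain k where k: "\<And>q. q > 0 \<Longrightarrow> newton_radial n q - c * ?F q = k"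
    using has_field_derivative_zero_constant[of "{0<..}" "\<lambda>q. newton_radial n q - c * ?F q"] by auto
  have "?F 1 = 0" by (simp add: set_lebesgue_integral_def)
  with k[of 1] k[OF q] show ?thesis by (simp add: c_def b_def)
qed

lemma newton_integral:
  assumes d: "CARD('d) \<ge> 2" and x: "x \<noteq> 0"
  shows "newton (x :: real^'d) = newton_radial CARD('d) 1 + heat_const TYPE('d) *
    (LINT s:{0<..}|lborel. heat_weight (real CARD('d) / 2) ((norm x)\<^sup>2) s - heat_weight (real CARD('d) / 2) 1 s)"
  using newton_radial_integral[OF d, of "(norm x)\<^sup>2"] x by (simp add: newton_eq_radial heat_const_def)

text \<open>Up to its constant, p is d_i d_j G_t. These are the facts that Fubini requires against
  the Newtonian potential; the vanishing integral is a cancellation between the second moment and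
  the diagonal term.\<close>

lemma heat_second_derivative_bounds:
  fixes t :: real and i j :: "'d::finite"
  defines "p \<equiv> \<lambda>y::real^'d. (y $ i * y $ j / (4 * t\<^sup>2) - (if i = j then 1 / (2 * t) else 0)) * exp (- (norm y)\<^sup>2 / (4 * t))"
  assumes t: "t > 0"
  shows "\<exists>C\<ge>0. \<forall>y. \<bar>p y\<bar> \<le> C"
    and "integrable lborel (\<lambda>y. (1 + norm y) ^ m * \<bar>p y\<bar>)"
    and "integrable lborel p"
    and "(LINT y|lborel. p y) = 0"
proof -
  let ?a = "1 / (4 * t)"
  define A where "A = 1 / (4 * t\<^sup>2) + 1 / (2 * t)"
  have A: "A \<ge> 0" using t by (simp add: A_def)
  have a: "?a > 0" using t by simp
  have meas[measurable]: "p \<in> borel_measurable borel" unfolding p_def by measurable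
  have bd: "\<bar>p y\<bar> \<le> A * ((1 + norm y)\<^sup>2 * exp (- ?a * (norm y)\<^sup>2))" for y
  proof -
    have 1: "1 \<le> (1 + norm y)\<^sup>2" by simp
    have "\<bar>y $ i * y $ j\<bar> \<le> (1 + norm y)\<^sup>2"
      unfolding power2_eq_square abs_mult
      by (intro mult_mono) (use order_trans[OF component_le_norm_cart[of y]] in \<open>auto intro: add_increasing\<close>)
    then have "\<bar>y $ i * y $ j / (4 * t\<^sup>2)\<bar> \<le> 1 / (4 * t\<^sup>2) * (1 + norm y)\<^sup>2"
      using t by (simp add: divide_right_mono)
    moreover have "\<bar>if i = j then 1 / (2 * t) else 0\<bar> \<le> 1 / (2 * t) * (1 + norm y)\<^sup>2"
      using t mult_left_mono[OF 1, of "1 / (2 * t)"] by auto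
    ultimately have "\<bar>y $ i * y $ j / (4 * t\<^sup>2) - (if i = j then 1 / (2 * t) else 0)\<bar> \<le> A * (1 + norm y)\<^sup>2"
      unfolding A_def distrib_right by linarith
    then show ?thesis
      unfolding p_def abs_mult by (simp add: mult.assoc[symmetric] mult_right_mono)
  qed
  obtain C where C: "C \<ge> 0" "\<And>r. r \<ge> 0 \<Longrightarrow> r ^ 1 \<le> C * exp (?a * r)"
    using power_le_exp_bound[OF a, of 1] by blast
  have "\<bar>p y\<bar> \<le> A * (2 + 2 * C)" for y
  proof -
    have "(1 + norm y)\<^sup>2 \<le> 2 + 2 * (norm y)\<^sup>2"
      using zero_le_power2[of "1 - norm y"] by (simp add: power2_eq_square algebra_simps)
    also have "\<dots> \<le> (2 + 2 * C) * exp (?a * (norm y)\<^sup>2)"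
      using C(2)[of "(norm y)\<^sup>2"] t by (simp add: distrib_right add_mono)
    finally have "(1 + norm y)\<^sup>2 * exp (- ?a * (norm y)\<^sup>2) \<le> (2 + 2 * C) * exp (?a * (norm y)\<^sup>2) * exp (- ?a * (norm y)\<^sup>2)"
      by (rule mult_right_mono) simp
    also have "\<dots> = 2 + 2 * C" by (simp add: mult_exp_exp mult.assoc)
    finally show ?thesis using bd[of y] mult_left_mono[OF _ A] by fastforce
  qed
  then show "\<exists>C\<ge>0. \<forall>y. \<bar>p y\<bar> \<le> C" using A C(1) by (intro exI[of _ "A * (2 + 2 * C)"]) auto
  have int: "integrable lborel (\<lambda>y. (1 + norm y) ^ m * \<bar>p y\<bar>)" for m
  proof (rule Bochner_Integration.integrable_bound)
    show "integrable lborel (\<lambda>y::real^'d. A * ((1 + norm y) ^ (m + 2) * exp (- ?a * (norm y)\<^sup>2)))"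
      by (intro integrable_mult_right gaussian_moment_integrable a)
    have "norm ((1 + norm y) ^ m * \<bar>p y\<bar>) \<le> norm (A * ((1 + norm y) ^ (m + 2) * exp (- ?a * (norm y)\<^sup>2)))" for y
      using mult_left_mono[OF bd[of y], of "(1 + norm y) ^ m"] A
      by (simp add: abs_mult power_add power2_eq_square mult_ac)
    then show "AE y in lborel. norm ((1 + norm y) ^ m * \<bar>p y\<bar>) \<le> norm (A * ((1 + norm y) ^ (m + 2) * exp (- ?a * (norm y)\<^sup>2)))"
      by simp
  qed measurable
  then show "integrable lborel (\<lambda>y. (1 + norm y) ^ m * \<bar>p y\<bar>)" .
  have "integrable lborel (\<lambda>y. \<bar>p y\<bar>)" using int[of 0] by simp
  then show "integrable lborel p" by (rule integrable_abs_cancel) simp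
  have p: "p y = 1 / (4 * t\<^sup>2) * (y $ i * y $ j * exp (- ?a * (norm y)\<^sup>2)) - (if i = j then 1 / (2 * t) else 0) * exp (- ?a * (norm y)\<^sup>2)" for y
    by (simp add: p_def left_diff_distrib)
  show "(LINT y|lborel. p y) = 0"
    unfolding p using gaussian_second_moment[OF a, where 'd='d] gaussian_integrable[OF a, where 'a="real^'d"]
      gaussian_integral[OF a, where 'a="real^'d"] t
    by (subst Bochner_Integration.integral_diff) (auto simp: power2_eq_square)
qed

lemma heat_weight_1_bounded: "b \<ge> 0 \<Longrightarrow> \<exists>C\<ge>0. \<forall>s>0. heat_weight b 1 s \<le> C"
proof -
  assume b: "b \<ge> 0"
  obtain C where C: "C \<ge> 0" "\<And>r. r \<ge> 0 \<Longrightarrow> r powr b \<le> C * exp (1 / 4 * r)"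
    using powr_le_exp_bound[of "1 / 4" b] b by auto
  have "heat_weight b 1 s \<le> C" if s: "s > 0" for s
  proof -
    have "heat_weight b 1 s = (1 / s) powr b * exp (- (1 / 4 * (1 / s)))"
      using s by (simp add: heat_weight_def powr_divide powr_minus_divide)
    also have "\<dots> \<le> C * exp (1 / 4 * (1 / s)) * exp (- (1 / 4 * (1 / s)))"
      using C(2)[of "1 / s"] s by (intro mult_right_mono) auto
    also have "\<dots> = C" by (simp add: mult_exp_exp mult.assoc)
    finally show ?thesis .
  qed
  then show ?thesis using C(1) by blast
qed

text \<open>The weight at \<open>\<bar>z\<bar>\<^sup>2\<close> alone is not integrable in \<open>s\<close> near infinity when \<open>d = 2\<close>; the subtracted
  constant repairs this, and it is invisible against \<open>\<partial>\<^sub>i\<partial>\<^sub>jG\<^sub>t\<close>, which has integral 0.\<close>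

lemma newton_convolution_integrable:
  fixes x :: "real^'d" and p :: "real^'d \<Rightarrow> real"
  assumes d: "CARD('d) \<ge> 2" and P: "\<And>y. \<bar>p y\<bar> \<le> P"
    and p2: "integrable lborel (\<lambda>y. (1 + norm y) ^ 2 * \<bar>p y\<bar>)" and p0: "integrable lborel p"
  shows "integrable (lborel \<Otimes>\<^sub>M lborel) (\<lambda>(s, y). indicator {0<..} s *
    ((heat_weight (real CARD('d) / 2) ((norm (x - y))\<^sup>2) s - heat_weight (real CARD('d) / 2) 1 s) * p y))"
    (is "integrable _ (\<lambda>(s, y). ?f s y)")
proof -
  define b where "b = real CARD('d) / 2"
  have b: "b \<ge> 1" using d by (simp add: b_def)
  have [measurable]: "p \<in> borel_measurable borel" using p0 by (auto dest: borel_measurable_integrable)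
  have [measurable]: "(\<lambda>q. heat_weight b ((norm (x - snd q))\<^sup>2) (fst q)) \<in> borel_measurable (lborel \<Otimes>\<^sub>M lborel)"
    unfolding heat_weight_def by measurable
  have fm[measurable]: "(\<lambda>(s, y). ?f s y) \<in> borel_measurable (lborel \<Otimes>\<^sub>M lborel)"
    unfolding b_def[symmetric] split_beta' by measurable
  obtain C1 where C1: "C1 \<ge> 0" "\<And>s. s > 0 \<Longrightarrow> heat_weight b 1 s \<le> C1"
    using heat_weight_1_bounded[of b] b by auto
  define Q where "Q = (LINT y|lborel. \<bar>p y\<bar>)"
  define Q2 where "Q2 = (LINT y|lborel. (1 + norm y) ^ 2 * \<bar>p y\<bar>)"
  have Q: "Q \<ge> 0" "Q2 \<ge> 0" by (auto simp: Q_def Q2_def intro!: integral_nonneg_AE)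
  have P0: "P \<ge> 0" using P[of 0] by linarith
  define X where "X = (1 + norm x)\<^sup>2 + 1"
  \<comment> \<open>An integrable majorant in s of the L^1 norm in y. For s \<le> 1 the weight has
    y-integral (4 pi)^b and p is bounded by P; for s > 1 the two weights are compared, using that |
    |x - y|^2 - 1 | is at most X (1 + |y|)^2.\<close>
  define B where "B s = (if s \<in> {0<..1} then (4 * pi) powr b * P + C1 * Q else if s > 1 then X / 4 * Q2 * s powr (- (b + 1)) else 0)" for s :: real
  have gi: "integrable lborel (\<lambda>y. heat_weight b ((norm (x - y))\<^sup>2) s)"
    and gv: "(LINT y|lborel. heat_weight b ((norm (x - y))\<^sup>2) s) = (4 * pi) powr b" if s: "s > 0" for s
  proof -
    have eq: "heat_weight b ((norm (x - y))\<^sup>2) s = s powr (- b) * (\<lambda>y. exp (- (1 / (4 * s)) * (norm y)\<^sup>2)) (x - y)" for y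
      by (simp add: heat_weight_def)
    show "integrable lborel (\<lambda>y. heat_weight b ((norm (x - y))\<^sup>2) s)"
      unfolding eq using s gaussian_integrable[of "1 / (4 * s)", where 'a="real^'d"]
      by (intro integrable_mult_right, subst lborel_integral_reflect(2)) auto
    have "(LINT y|lborel. (\<lambda>y. exp (- (1 / (4 * s)) * (norm y)\<^sup>2)) (x - y)) = (pi / (1 / (4 * s))) powr b"
      using s gaussian_integral[of "1 / (4 * s)", where 'a="real^'d"]
      by (subst lborel_integral_reflect(1)) (auto simp: b_def)
    then show "(LINT y|lborel. heat_weight b ((norm (x - y))\<^sup>2) s) = (4 * pi) powr b"
      unfolding eq using s by (simp add: powr_mult powr_minus field_simps)
  qed
  have h: "integrable lborel (\<lambda>y. ?f s y) \<and> (LINT y|lborel. \<bar>?f s y\<bar>) \<le> B s" for s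
  proof -
    consider "s \<le> 0" | "0 < s" "s \<le> 1" | "s > 1" by linarith
    then show ?thesis
    proof cases
      case 1 then show ?thesis by (simp add: B_def)
    next
      case 2
      let ?g = "\<lambda>y. P * heat_weight b ((norm (x - y))\<^sup>2) s + C1 * \<bar>p y\<bar>"
      have ig: "integrable lborel ?g"
        using gi[OF 2(1)] p0 by auto
      have le: "\<bar>?f s y\<bar> \<le> ?g y" for y
      proof -
        have "\<bar>?f s y\<bar> = \<bar>heat_weight b ((norm (x - y))\<^sup>2) s * p y - heat_weight b 1 s * p y\<bar>"
          using 2 by (simp add: b_def left_diff_distrib)
        also have "\<dots> \<le> heat_weight b ((norm (x - y))\<^sup>2) s * \<bar>p y\<bar> + heat_weight b 1 s * \<bar>p y\<bar>"
          by (rule order_trans[OF abs_triangle_ineq4]) (simp add: abs_mult heat_weight_nonneg)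
        also have "\<dots> \<le> heat_weight b ((norm (x - y))\<^sup>2) s * P + C1 * \<bar>p y\<bar>"
          using P C1(2)[OF 2(1)] by (intro add_mono mult_left_mono mult_right_mono) (auto simp: heat_weight_nonneg)
        finally show ?thesis by (simp add: mult.commute)
      qed
      have "integrable lborel (\<lambda>y. ?f s y)"
      proof (rule Bochner_Integration.integrable_bound[OF ig])
        show "AE y in lborel. norm (?f s y) \<le> norm (?g y)"
          unfolding real_norm_def by (intro AE_I2 order_trans[OF le abs_ge_self])
      qed measurable
      moreover have "(LINT y|lborel. \<bar>?f s y\<bar>) \<le> (LINT y|lborel. ?g y)"
        using calculation by (intro integral_mono ig le) auto
      moreover have "(LINT y|lborel. ?g y) = B s"
        using gi[OF 2(1)] gv[OF 2(1)] p0 2 by (simp add: B_def Q_def mult.commute)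
      ultimately show ?thesis by simp
    next
      case 3
      let ?g = "\<lambda>y. X / 4 * s powr (- (b + 1)) * ((1 + norm y)\<^sup>2 * \<bar>p y\<bar>)"
      have ig: "integrable lborel ?g" using p2 by auto
      have le: "\<bar>?f s y\<bar> \<le> ?g y" for y
      proof -
        have "\<bar>heat_weight b ((norm (x - y))\<^sup>2) s - heat_weight b 1 s\<bar> \<le> \<bar>(norm (x - y))\<^sup>2 - 1\<bar> / 4 * heat_weight (b + 1) (min ((norm (x - y))\<^sup>2) 1) s"
          using 3 by (intro heat_weight_diff_bound) auto
        also have "heat_weight (b + 1) (min ((norm (x - y))\<^sup>2) 1) s \<le> s powr (- (b + 1))"
          using 3 unfolding heat_weight_def by (intro mult_left_le) auto
        also have "\<bar>(norm (x - y))\<^sup>2 - 1\<bar> \<le> X * (1 + norm y)\<^sup>2"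
        proof -
          have "norm (x - y) \<le> (1 + norm x) * (1 + norm y)"
            using norm_triangle_ineq4[of x y] mult_nonneg_nonneg[OF norm_ge_zero[of x] norm_ge_zero[of y]]
            unfolding distrib_left distrib_right mult_1 mult_1_right by linarith
          then have "(norm (x - y))\<^sup>2 \<le> (1 + norm x)\<^sup>2 * (1 + norm y)\<^sup>2"
            by (metis norm_ge_zero power_mono power_mult_distrib)
          moreover have "1 \<le> (1 + norm y)\<^sup>2" by simp
          moreover have "0 \<le> (norm (x - y))\<^sup>2" by simp
          ultimately show ?thesis unfolding X_def distrib_right mult_1 abs_le_iff by linarith
        qed
        finally have "\<bar>heat_weight b ((norm (x - y))\<^sup>2) s - heat_weight b 1 s\<bar> \<le> X * (1 + norm y)\<^sup>2 / 4 * s powr (- (b + 1))"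
          by (simp add: mult_right_mono mult_left_mono divide_right_mono)
        then have "\<bar>heat_weight b ((norm (x - y))\<^sup>2) s - heat_weight b 1 s\<bar> * \<bar>p y\<bar> \<le> X * (1 + norm y)\<^sup>2 / 4 * s powr (- (b + 1)) * \<bar>p y\<bar>"
          by (rule mult_right_mono) simp
        then show ?thesis using 3 by (simp add: abs_mult b_def[symmetric] mult_ac)
      qed
      have "integrable lborel (\<lambda>y. ?f s y)"
      proof (rule Bochner_Integration.integrable_bound[OF ig])
        show "AE y in lborel. norm (?f s y) \<le> norm (?g y)"
          unfolding real_norm_def by (intro AE_I2 order_trans[OF le abs_ge_self])
      qed measurable
      moreover have "(LINT y|lborel. \<bar>?f s y\<bar>) \<le> (LINT y|lborel. ?g y)"
        using calculation by (intro integral_mono ig le) auto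
      moreover have "(LINT y|lborel. ?g y) = B s"
        using 3 by (simp add: B_def Q2_def)
      ultimately show ?thesis by simp
    qed
  qed
  have B: "integrable lborel B"
  proof -
    have "set_integrable lborel {1<..} (\<lambda>s::real. s powr (- (b + 1)))"
      using set_integrable_heat_weight[of 1 "b + 1" 0] b by (simp add: heat_weight_def[abs_def])
    then have "integrable lborel (\<lambda>s::real. X / 4 * Q2 * (indicator {1<..} s * s powr (- (b + 1))))"
      unfolding set_integrable_def by (intro integrable_mult_right) auto
    moreover have "integrable lborel (\<lambda>s::real. indicator {0<..1} s *\<^sub>R ((4 * pi) powr b * P + C1 * Q))"
      by (intro integrable_scaleR_left) auto
    ultimately have "integrable lborel (\<lambda>s::real. X / 4 * Q2 * (indicator {1<..} s * s powr (- (b + 1))) + indicator {0<..1} s *\<^sub>R ((4 * pi) powr b * P + C1 * Q))"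
      by (rule Bochner_Integration.integrable_add)
    also have "(\<lambda>s::real. X / 4 * Q2 * (indicator {1<..} s * s powr (- (b + 1))) + indicator {0<..1} s *\<^sub>R ((4 * pi) powr b * P + C1 * Q)) = B"
      by (auto simp: B_def split: split_indicator)
    finally show ?thesis .
  qed
  show ?thesis
  proof (rule lborel_pair.Fubini_integrable[OF fm])
    show "AE s in lborel. integrable lborel (\<lambda>y. case (s, y) of (s, y) \<Rightarrow> ?f s y)" using h by auto
    have "norm (LINT y|lborel. norm (?f s y)) \<le> norm (B s)" for s
    proof -
      have "0 \<le> (LINT y|lborel. norm (?f s y))" by (rule integral_nonneg_AE) simp
      then have "norm (LINT y|lborel. norm (?f s y)) = (LINT y|lborel. norm (?f s y))" by simp
      also have "\<dots> \<le> B s" using h[of s] by simp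
      finally show ?thesis by simp
    qed
    moreover have "(\<lambda>s. LINT y|lborel. norm (?f s y)) \<in> borel_measurable lborel"
      using fm by (intro lborel.borel_measurable_lebesgue_integral) (auto simp: split_beta' intro!: borel_measurable_norm)
    ultimately show "integrable lborel (\<lambda>s. LINT y|lborel. norm (case (s, y) of (s, y) \<Rightarrow> ?f s y))"
      by (intro Bochner_Integration.integrable_bound[OF B]) auto
  qed
qed

section \<open>The Oseen kernel\<close>

lemma newton_conv_heat_second_derivative:
  fixes x :: "real^'d" and i j :: 'd
  assumes d: "CARD('d) \<ge> 2" and t: "t > 0"
  shows "(LINT y|lborel. newton (x - y) * (heat_const TYPE('d) * t powr (- real CARD('d) / 2) *
      ((y $ i * y $ j / (4 * t\<^sup>2) - (if i = j then 1 / (2 * t) else 0)) * exp (- (norm y)\<^sup>2 / (4 * t)))))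
    = smooth_K t i j x"
proof -
  define b where "b = real CARD('d) / 2"
  define c where "c = heat_const TYPE('d)"
  define \<delta> where "\<delta> = (if i = j then 1 / 2 else 0 :: real)"
  define q where "q = (norm x)\<^sup>2"
  have b: "b \<ge> 1" using d by (simp add: b_def)
  have c: "c > 0" by (simp add: c_def heat_const_def)
  define p where "p = (\<lambda>y::real^'d. (y $ i * y $ j / (4 * t\<^sup>2) - (if i = j then 1 / (2 * t) else 0)) * exp (- (norm y)\<^sup>2 / (4 * t)))"
  obtain P where P: "\<And>y. \<bar>p y\<bar> \<le> P"
    using heat_second_derivative_bounds(1)[OF t, where i = i and j = j] unfolding p_def by blast
  have p2: "integrable lborel (\<lambda>y. (1 + norm y) ^ 2 * \<bar>p y\<bar>)"
    and ip: "integrable lborel p" and p0: "(LINT y|lborel. p y) = 0"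
    using heat_second_derivative_bounds(2)[OF t, where m = 2 and i = i and j = j]
      heat_second_derivative_bounds(3,4)[OF t, where i = i and j = j] unfolding p_def by auto
  let ?f = "\<lambda>s y. indicator {0<..} s * ((heat_weight b ((norm (x - y))\<^sup>2) s - heat_weight b 1 s) * p y)"
  have int: "integrable (lborel \<Otimes>\<^sub>M lborel) (\<lambda>(s, y). ?f s y)"
    using newton_convolution_integrable[OF d P p2 ip, of x] unfolding b_def .
  define F where "F y = (LINT s|lborel. ?f s y)" for y
  have iF: "integrable lborel F"
    unfolding F_def using lborel_pair.integrable_snd[OF int] .
  \<comment> \<open>The semigroup property evaluates the first weight; the subtracted weight does
    not depend on y and disappears because p has integral 0.\<close>
  have inner: "(LINT y|lborel. ?f s y) = indicator {0<..} s * ((4 * pi * s * t / (s + t)) powr b * s powr (- b) *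
      ((x $ i * x $ j / (4 * (s + t)\<^sup>2) - \<delta> / (s + t)) * exp (- q / (4 * (s + t)))))" for s
  proof (cases "s > 0")
    case True
    note sg = heat_second_derivative_semigroup[OF True t, of x i j]
    have "?f s y = s powr (- b) * (exp (- (norm (x - y))\<^sup>2 / (4 * s)) * p y) - heat_weight b 1 s * p y" for y
      using True by (simp add: heat_weight_def algebra_simps)
    then have "(LINT y|lborel. ?f s y) = s powr (- b) * (LINT y|lborel. exp (- (norm (x - y))\<^sup>2 / (4 * s)) * p y) - heat_weight b 1 s * (LINT y|lborel. p y)"
      using sg(1) ip by (simp add: p_def)
    also have "(LINT y|lborel. exp (- (norm (x - y))\<^sup>2 / (4 * s)) * p y) = (4 * pi * s * t / (s + t)) powr b *
      ((x $ i * x $ j / (4 * (s + t)\<^sup>2) - (if i = j then 1 / (2 * (s + t)) else 0)) * exp (- q / (4 * (s + t))))"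
      using sg(2) unfolding p_def b_def q_def .
    also have "(if i = j then 1 / (2 * (s + t)) else 0) = \<delta> / (s + t)" by (simp add: \<delta>_def)
    finally show ?thesis using True by (simp add: p0 mult_ac)
  qed simp
  have w: "c * t powr (- b) * (LINT y|lborel. ?f s y)
    = indicator {0<..} s * (x $ i * x $ j / 4 * heat_weight (b + 2) q (s + t) - \<delta> * heat_weight (b + 1) q (s + t))" for s
  proof (cases "s > 0")
    case True
    have k1: "c * t powr (- b) * ((4 * pi * s * t / (s + t)) powr b * s powr (- b)) = (s + t) powr (- b)"
    proof -
      have "(4 * pi * s * t / (s + t)) powr b = (4 * pi) powr b * s powr b * t powr b * (s + t) powr (- b)"
        using True t by (simp add: powr_divide powr_mult powr_minus_divide)
      moreover have "c = (4 * pi) powr (- b)" by (simp add: c_def heat_const_def b_def)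
      ultimately show ?thesis using True t by (simp add: powr_minus field_simps)
    qed
    have k2: "heat_weight (b + 2) q (s + t) = (s + t) powr (- b) * exp (- q / (4 * (s + t))) / (s + t)\<^sup>2"
      using True t by (simp add: heat_weight_def powr_diff)
    have k3: "heat_weight (b + 1) q (s + t) = (s + t) powr (- b) * exp (- q / (4 * (s + t))) / (s + t)"
      using True t by (simp add: heat_weight_def powr_diff)
    have "c * t powr (- b) * (LINT y|lborel. ?f s y)
      = (c * t powr (- b) * ((4 * pi * s * t / (s + t)) powr b * s powr (- b))) *
        ((x $ i * x $ j / (4 * (s + t)\<^sup>2) - \<delta> / (s + t)) * exp (- q / (4 * (s + t))))"
      unfolding inner using True by simp
    also have "\<dots> = x $ i * x $ j / 4 * heat_weight (b + 2) q (s + t) - \<delta> * heat_weight (b + 1) q (s + t)"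
      unfolding k1 k2 k3 by (simp add: left_diff_distrib right_diff_distrib mult_ac)
    finally show ?thesis using True by simp
  qed (simp add: inner)
  have "(LINT y|lborel. newton (x - y) * (c * t powr (- b) * p y))
    = (LINT y|lborel. newton_radial CARD('d) 1 * c * t powr (- b) * p y + c * (c * t powr (- b)) * F y)"
  \<comment> \<open>The representation of the potential fails only at y = x. Its additive constant
    is carried along here and is killed next by the zero integral of p.\<close>
  proof (rule integral_cong_AE)
    have "newton (x - y) * (c * t powr (- b) * p y) = newton_radial CARD('d) 1 * c * t powr (- b) * p y + c * (c * t powr (- b)) * F y"
      if "y \<noteq> x" for y
    proof -
      have "F y = (LINT s:{0<..}|lborel. heat_weight b ((norm (x - y))\<^sup>2) s - heat_weight b 1 s) * p y"
        unfolding F_def set_lebesgue_integral_def by (simp flip: mult.assoc)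
      then show ?thesis
        using newton_integral[OF d, of "x - y"] that by (simp add: b_def c_def algebra_simps)
    qed
    then show "AE y in lborel. newton (x - y) * (c * t powr (- b) * p y)
       = newton_radial CARD('d) 1 * c * t powr (- b) * p y + c * (c * t powr (- b)) * F y"
      by (intro eventually_mono[OF AE_lborel_singleton[of x]]) simp
  qed (use iF ip in \<open>auto dest!: borel_measurable_integrable simp: newton_def[abs_def] Let_def\<close>)
  also have "\<dots> = c * (c * t powr (- b) * (LINT y|lborel. F y))"
    using iF ip p0 by simp
  also have "(LINT y|lborel. F y) = (LINT s|lborel. LINT y|lborel. ?f s y)"
    unfolding F_def using lborel_pair.Fubini_integral[OF int] by simp
  also have "c * t powr (- b) * (LINT s|lborel. LINT y|lborel. ?f s y) =
     (LINT s|lborel. indicator {0<..} s * (x $ i * x $ j / 4 * heat_weight (b + 2) q (s + t) - \<delta> * heat_weight (b + 1) q (s + t)))"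
    unfolding w[symmetric] by simp
  \<comment> \<open>Everything depends on s + t only, so a shift of s moves the range from (0,
    infinity) to (t, infinity) and produces the tails.\<close>
  also have "\<dots> = (LINT s|lborel. (\<lambda>s. indicator {t<..} s * (x $ i * x $ j / 4 * heat_weight (b + 2) q s - \<delta> * heat_weight (b + 1) q s)) (t + s))"
    by (intro Bochner_Integration.integral_cong) (auto simp: add.commute split: split_indicator)
  also have "\<dots> = (LINT s|lborel. indicator {t<..} s * (x $ i * x $ j / 4 * heat_weight (b + 2) q s - \<delta> * heat_weight (b + 1) q s))"
    by (rule lborel_integral_shift)
  also have "\<dots> = (LINT s:{t<..}|lborel. x $ i * x $ j / 4 * heat_weight (b + 2) q s - \<delta> * heat_weight (b + 1) q s)"
    by (simp add: set_lebesgue_integral_def)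
  also have "\<dots> = x $ i * x $ j / 4 * heat_tail (b + 2) t q - \<delta> * heat_tail (b + 1) t q"
    using t b by (subst set_integral_diff(2)) (auto intro!: set_integrable_mult_right set_integrable_heat_weight simp: heat_tail_def)
  finally show ?thesis
    by (simp add: smooth_K_def p_def b_def[symmetric] c_def[symmetric] \<delta>_def[symmetric] q_def[symmetric])
qed

lemma DERIV_line_norm_power2:
  "((\<lambda>s. (norm (x + s *\<^sub>R axis k 1 :: real^'d))\<^sup>2) has_real_derivative 2 * x $ k) (at 0)"
proof -
  have "((\<lambda>s. (norm (x + s *\<^sub>R axis k 1))\<^sup>2) has_derivative (\<lambda>s. 2 * (x \<bullet> (s *\<^sub>R axis k 1)))) (at 0)"
    by (rule has_derivative_compose[of "\<lambda>s. x + s *\<^sub>R axis k 1"])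
       (use has_derivative_norm_power2[of x] in \<open>auto intro!: derivative_eq_intros\<close>)
  then show ?thesis
    unfolding has_field_derivative_def by (rule has_derivative_eq_rhs) (auto simp: inner_axis)
qed

lemma DERIV_line_heat_kernel:
  fixes x :: "real^'d"
  shows "((\<lambda>s. heat_kernel t (x + s *\<^sub>R axis k 1)) has_real_derivative - x $ k / (2 * t) * heat_kernel t x) (at 0)"
proof -
  have "((\<lambda>s. c * exp (- (norm (x + s *\<^sub>R axis k 1))\<^sup>2 / (4 * t))) has_real_derivative
     - x $ k / (2 * t) * (c * exp (- (norm x)\<^sup>2 / (4 * t)))) (at 0)" for c
    by (rule DERIV_cong, (rule DERIV_cmult DERIV_fun_exp DERIV_cdivide DERIV_minus DERIV_line_norm_power2)+)
       (cases "t = 0", simp_all add: field_simps)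
  then show ?thesis unfolding heat_kernel_def .
qed

lemma partial_heat_kernel:
  "partial k (heat_kernel t) x = - x $ k / (2 * t) * heat_kernel t (x :: real^'d)"
  by (rule partial_eqI[OF DERIV_line_heat_kernel])

lemma partial_partial_heat_kernel:
  assumes "t > 0"
  shows "partial i (partial j (heat_kernel t)) (x :: real^'d) = heat_const TYPE('d) * t powr (- real CARD('d) / 2) *
      ((x $ i * x $ j / (4 * t\<^sup>2) - (if i = j then 1 / (2 * t) else 0)) * exp (- (norm x)\<^sup>2 / (4 * t)))"
proof -
  have p: "partial j (heat_kernel t) = (\<lambda>x::real^'d. - x $ j / (2 * t) * heat_kernel t x)"
    by (rule ext) (rule partial_heat_kernel)
  have "partial i (partial j (heat_kernel t)) x = - (if i = j then 1 else 0) / (2 * t) * heat_kernel t x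
      + - x $ i / (2 * t) * heat_kernel t x * (- x $ j / (2 * t))"
    unfolding p
    by (rule partial_eqI, rule DERIV_cong, (rule DERIV_mult DERIV_cdivide DERIV_minus DERIV_line_component DERIV_line_heat_kernel)+) simp
  also have "\<dots> = (x $ i * x $ j / (4 * t\<^sup>2) - (if i = j then 1 / (2 * t) else 0)) * heat_kernel t x"
    using assms by (simp add: algebra_simps power2_eq_square)
  also have "heat_kernel t x = heat_const TYPE('d) * t powr (- real CARD('d) / 2) * exp (- (norm x)\<^sup>2 / (4 * t))"
    using assms by (simp add: heat_kernel_def heat_const_def powr_mult)
  finally show ?thesis by simp
qed

lemma matrix_div_heat_kernel:
  "matrix_div (\<lambda>x. heat_kernel t x *\<^sub>R outer (axis i 1) (axis j 1)) (x :: real^'d)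
     = (\<chi> k. if k = i then partial j (heat_kernel t) x else 0)"
proof -
  have "(\<lambda>x. (heat_kernel t x *\<^sub>R outer (axis i 1) (axis j 1)) $ k $ l) =
      (\<lambda>x::real^'d. if k = i \<and> l = j then heat_kernel t x else 0)" for k l :: 'd
    by (auto simp: outer_def axis_def)
  moreover have "partial l (\<lambda>x::real^'d. 0) x = 0" for l by (simp add: partial_def)
  moreover have "partial l (\<lambda>x::real^'d. if k = i \<and> l = j then heat_kernel t x else 0) x
      = (if l = j then (if k = i then partial j (heat_kernel t) x else 0) else 0)" for k l
    using calculation(2) by auto
  ultimately show ?thesis
    unfolding matrix_div_def by (simp add: vec_eq_iff sum.delta)
qed

text \<open>The field under the projector has d_j G_t as its i-th component and divergence d_i d_j
  G_t. The identity part of the projector leaves a Gaussian term, and the gradient part gives the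
  regularised third derivatives of the Newtonian potential.\<close>

lemma oseen_eq:
  fixes x :: "real^'d"
  assumes d: "CARD('d) \<ge> 2" and t: "t > 0"
  shows "oseen t i j x $ k = (if k = i then - x $ j / (2 * t) * heat_kernel t x else 0) + smooth_DK t i j k x"
proof -
  let ?v = "matrix_div (\<lambda>x::real^'d. heat_kernel t x *\<^sub>R outer (axis i 1) (axis j 1))"
  have div: "divergence ?v y = partial i (partial j (heat_kernel t)) y" for y
  proof -
    have "(\<lambda>y. ?v y $ l) = (\<lambda>y. if l = i then partial j (heat_kernel t) y else 0)" for l
      by (simp add: matrix_div_heat_kernel)
    moreover have "partial l (\<lambda>y. if l = i then partial j (heat_kernel t) y else 0) y
       = (if l = i then partial i (partial j (heat_kernel t)) y else 0)" for l
      by (auto simp: partial_def)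
    ultimately show ?thesis unfolding divergence_def by simp
  qed
  have "inv_neg_laplacian (divergence ?v) z = smooth_K t i j z" for z
  proof -
    have "inv_neg_laplacian (divergence ?v) z = (LINT y|lborel. newton (z - y) * partial i (partial j (heat_kernel t)) y)"
      unfolding inv_neg_laplacian_def div partial_partial_heat_kernel[OF t]
      by (rule integral_completion) (simp add: newton_def[abs_def] Let_def)
    then show ?thesis
      unfolding partial_partial_heat_kernel[OF t] newton_conv_heat_second_derivative[OF d t] .
  qed
  then have "inv_neg_laplacian (divergence ?v) = smooth_K t i j" by (rule ext)
  then show ?thesis
    unfolding oseen_def leray_def using t
    by (simp add: grad_def matrix_div_heat_kernel partial_heat_kernel partial_smooth_K)
qed

lemma partial_newton:
  fixes x :: "real^'d"
  assumes d: "CARD('d) \<ge> 2" and x: "x \<noteq> 0"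
  shows "partial j newton x = - (heat_const TYPE('d) / 2) * (x $ j * heat_tail (real CARD('d) / 2 + 1) 0 ((norm x)\<^sup>2))"
proof -
  have "partial j newton x = partial j (\<lambda>x::real^'d. newton_radial CARD('d) ((norm x)\<^sup>2)) x"
    using x by (rule partial_cong_nonzero) (rule newton_eq_radial)
  also have "\<dots> = - ((4 * pi) powr (- real CARD('d) / 2) * heat_tail (real CARD('d) / 2 + 1) 0 ((norm x)\<^sup>2) / 4) * (2 * (x \<bullet> axis j 1))"
    by (rule partial_has_derivative, rule has_derivative_radial, rule DERIV_newton_radial) (use d x in auto)
  finally show ?thesis by (simp add: heat_const_def inner_axis)
qed

lemma K_eq:
  fixes x :: "real^'d"
  assumes d: "CARD('d) \<ge> 2" and x: "x \<noteq> 0"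
  shows "K i j x = smooth_K 0 i j x"
proof -
  have "K i j x = partial i (\<lambda>x. - (heat_const TYPE('d) / 2) * (x $ j * heat_tail (real CARD('d) / 2 + 1) 0 ((norm x)\<^sup>2))) x"
    unfolding K_def using x by (rule partial_cong_nonzero) (rule partial_newton[OF d])
  also have "\<dots> = - (heat_const TYPE('d) / 2) * ((if i = j then 1 else 0) * heat_tail (real CARD('d) / 2 + 1) 0 ((norm x)\<^sup>2)
      + - heat_tail (real CARD('d) / 2 + 1 + 1) 0 ((norm x)\<^sup>2) * x $ i / 2 * x $ j)"
  proof (rule partial_eqI)
    have "real CARD('d) / 2 + 1 > 1" by simp
    note ht = DERIV_line_heat_tail[OF this, of 0 x i]
    show "((\<lambda>s. - (heat_const TYPE('d) / 2) * ((x + s *\<^sub>R axis i 1) $ j * heat_tail (real CARD('d) / 2 + 1) 0 ((norm (x + s *\<^sub>R axis i 1))\<^sup>2)))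
       has_real_derivative - (heat_const TYPE('d) / 2) * ((if i = j then 1 else 0) * heat_tail (real CARD('d) / 2 + 1) 0 ((norm x)\<^sup>2)
      + - heat_tail (real CARD('d) / 2 + 1 + 1) 0 ((norm x)\<^sup>2) * x $ i / 2 * x $ j)) (at 0)"
      by (rule DERIV_cong, (rule DERIV_cmult DERIV_mult DERIV_line_component ht)+) (use x in auto)
  qed
  finally show ?thesis by (auto simp: smooth_K_def algebra_simps)
qed

text \<open>Puts the singular kernel into the same formula as the Oseen kernel, with lower limit 0
  in place of t, so that the two are compared tail by tail.\<close>

lemma partial_K:
  fixes x :: "real^'d"
  assumes d: "CARD('d) \<ge> 2" and x: "x \<noteq> 0"
  shows "partial k (K i j) x = smooth_DK 0 i j k x"
proof -
  have "partial k (K i j) x = partial k (smooth_K 0 i j) x"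
    using x by (rule partial_cong_nonzero) (rule K_eq[OF d])
  then show ?thesis using x by (simp add: partial_smooth_K)
qed

section \<open>Functions homogeneous away from the origin\<close>

text \<open>A syntactic class in place of "smooth and positively homogeneous of degree r off the
  origin": powers of the norm, closed under coordinate factors, scalars and sums. It is closed under
  \<open>partial\<close>, so decay, differentiability and symmetry of derivatives of every order
  follow by induction. Equations are imposed for x \<noteq> 0 only.\<close>

inductive homog :: "real \<Rightarrow> (real^'d::finite \<Rightarrow> real) \<Rightarrow> bool" where
  base: "(\<And>x. x \<noteq> 0 \<Longrightarrow> f x = norm x powr r) \<Longrightarrow> homog r f"
| coord: "homog r g \<Longrightarrow> (\<And>x. x \<noteq> 0 \<Longrightarrow> f x = x $ k * g x) \<Longrightarrow> homog (r + 1) f"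
| cmult: "homog r g \<Longrightarrow> (\<And>x. x \<noteq> 0 \<Longrightarrow> f x = c * g x) \<Longrightarrow> homog r f"
| add: "homog r g \<Longrightarrow> homog r h \<Longrightarrow> (\<And>x. x \<noteq> 0 \<Longrightarrow> f x = g x + h x) \<Longrightarrow> homog r f"

lemma homog_cong:
  assumes "homog r g" "\<And>x. x \<noteq> 0 \<Longrightarrow> f x = g x"
  shows "homog r f"
  by (rule homog.cmult[OF assms(1), where c = 1]) (use assms in auto)

lemma homog_intros:
  "homog r (\<lambda>x. norm x powr r)"
  "homog r g \<Longrightarrow> homog (r + 1) (\<lambda>x. x $ k * g x)"
  "homog r g \<Longrightarrow> homog r (\<lambda>x. c * g x)"
  "homog r g \<Longrightarrow> homog r h \<Longrightarrow> homog r (\<lambda>x. g x + h x)"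
  by (auto intro: homog.intros)

lemma homog_zero: "homog r (\<lambda>x. 0)"
  by (rule homog.cmult[OF homog_intros(1), where c = 0]) simp

lemma has_derivative_norm_powr:
  fixes x :: "real^'d"
  assumes "x \<noteq> 0"
  shows "((\<lambda>x. norm x powr r) has_derivative (\<lambda>h. \<Sum>i\<in>UNIV. h $ i * (r * (x $ i * norm x powr (r - 2))))) (at x)"
proof -
  have eq: "norm x powr r = ((norm x)\<^sup>2) powr (r / 2)" for x :: "real^'d" and r
  proof (cases "x = 0")
    case False then show ?thesis by (simp add: powr_powr flip: powr_numeral)
  qed simp
  have "((\<lambda>x. ((norm x)\<^sup>2) powr (r / 2)) has_derivative (\<lambda>h. (r / 2 * ((norm x)\<^sup>2) powr (r / 2 - 1)) * (2 * (x \<bullet> h)))) (at x)"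
    by (rule has_derivative_radial, rule has_real_derivative_powr) (use assms in auto)
  then show ?thesis
    unfolding eq
    by (rule has_derivative_eq_rhs)
       (auto simp: inner_vec_def sum_distrib_left sum_distrib_right diff_divide_distrib mult_ac intro!: sum.cong)
qed

text \<open>Differentiability and closure under derivatives are obtained in one induction, with an
  abstract gradient g. Only a total derivative makes \<open>partial\<close> computable, so g is
  identified with the partial derivatives afterwards.\<close>

lemma homog_derivative:
  assumes "homog r f"
  shows "\<exists>g. (\<forall>i. homog (r - 1) (g i)) \<and>
    (\<forall>x. x \<noteq> 0 \<longrightarrow> (f has_derivative (\<lambda>h. \<Sum>i\<in>UNIV. h $ i * g i x)) (at x))"
  using assms
proof induction
  have tr: "(f has_derivative f') (at x)" if "(g has_derivative f') (at x)" "x \<noteq> 0" "\<And>y. y \<noteq> 0 \<Longrightarrow> f y = g y"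
    for f g :: "real^'d \<Rightarrow> real" and f' x
    by (rule has_derivative_transform_within_open[OF that(1), of "- {0}"]) (use that in auto)
  {
    case (base f r)
    show ?case
    proof (intro exI[of _ "\<lambda>i x. r * (x $ i * norm x powr (r - 2))"] conjI allI impI)
      show "homog (r - 1) (\<lambda>x. r * (x $ i * norm x powr (r - 2)))" for i
        using homog_intros(3)[OF homog_intros(2)[OF homog_intros(1), of "r - 2"]] by simp
      show "(f has_derivative (\<lambda>h. \<Sum>i\<in>UNIV. h $ i * (r * (x $ i * norm x powr (r - 2))))) (at x)" if "x \<noteq> 0" for x
        by (rule tr[OF has_derivative_norm_powr]) (use that base in auto)
    qed
  next
    case (coord r g f k)
    then obtain g' where g': "\<And>i. homog (r - 1) (g' i)"
      "\<And>x. x \<noteq> 0 \<Longrightarrow> (g has_derivative (\<lambda>h. \<Sum>i\<in>UNIV. h $ i * g' i x)) (at x)" by blast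
    show ?case
    proof (intro exI[of _ "\<lambda>i x. (if i = k then g x else 0) + x $ k * g' i x"] conjI allI impI)
      show "homog (r + 1 - 1) (\<lambda>x. (if i = k then g x else 0) + x $ k * g' i x)" for i
      proof -
        have "homog r (\<lambda>x. if i = k then g x else 0)" using coord(1) homog_zero by (cases "i = k") auto
        moreover have "homog r (\<lambda>x. x $ k * g' i x)" using homog_intros(2)[OF g'(1)] by simp
        ultimately show ?thesis by (simp add: homog_intros(4))
      qed
      show "(f has_derivative (\<lambda>h. \<Sum>i\<in>UNIV. h $ i * ((if i = k then g x else 0) + x $ k * g' i x))) (at x)" if x: "x \<noteq> 0" for x
      proof (rule tr[OF _ x coord(2)])
        have sd: "(\<Sum>i\<in>UNIV. h $ i * (if i = k then c else 0)) = c * h $ k" for h :: "real^'a" and c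
          by (simp add: if_distrib[where f = "\<lambda>t. _ * t"] mult.commute cong: if_cong)
        have "((\<lambda>x. x $ k * g x) has_derivative (\<lambda>h. x $ k * (\<Sum>i\<in>UNIV. h $ i * g' i x) + h $ k * g x)) (at x)"
          by (rule has_derivative_mult[OF has_derivative_component g'(2)[OF x]])
        then show "((\<lambda>x. x $ k * g x) has_derivative (\<lambda>h. \<Sum>i\<in>UNIV. h $ i * ((if i = k then g x else 0) + x $ k * g' i x))) (at x)"
          by (rule has_derivative_eq_rhs)
             (auto simp: distrib_left sum.distrib sum_distrib_left sd mult.left_commute)
      qed
    qed
  next
    case (cmult r g f c)
    then obtain g' where g': "\<And>i. homog (r - 1) (g' i)"
      "\<And>x. x \<noteq> 0 \<Longrightarrow> (g has_derivative (\<lambda>h. \<Sum>i\<in>UNIV. h $ i * g' i x)) (at x)" by blast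
    show ?case
    proof (intro exI[of _ "\<lambda>i x. c * g' i x"] conjI allI impI)
      show "(f has_derivative (\<lambda>h. \<Sum>i\<in>UNIV. h $ i * (c * g' i x))) (at x)" if x: "x \<noteq> 0" for x
      proof (rule tr[OF _ x cmult(2)])
        have "((\<lambda>x. c * g x) has_derivative (\<lambda>h. c * (\<Sum>i\<in>UNIV. h $ i * g' i x))) (at x)"
          by (rule has_derivative_mult_right[OF g'(2)[OF x]])
        then show "((\<lambda>x. c * g x) has_derivative (\<lambda>h. \<Sum>i\<in>UNIV. h $ i * (c * g' i x))) (at x)"
          by (rule has_derivative_eq_rhs) (simp add: sum_distrib_left mult_ac)
      qed
    qed (intro homog_intros g')
  next
    case (add r g h f)
    then obtain g' where g': "\<And>i. homog (r - 1) (g' i)"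
      "\<And>x. x \<noteq> 0 \<Longrightarrow> (g has_derivative (\<lambda>h. \<Sum>i\<in>UNIV. h $ i * g' i x)) (at x)" by blast
    from add obtain h' where h': "\<And>i. homog (r - 1) (h' i)"
      "\<And>x. x \<noteq> 0 \<Longrightarrow> (h has_derivative (\<lambda>v. \<Sum>i\<in>UNIV. v $ i * h' i x)) (at x)" by blast
    show ?case
    proof (intro exI[of _ "\<lambda>i x. g' i x + h' i x"] conjI allI impI)
      show "(f has_derivative (\<lambda>v. \<Sum>i\<in>UNIV. v $ i * (g' i x + h' i x))) (at x)" if x: "x \<noteq> 0" for x
      proof (rule tr[OF _ x add(3)])
        have "((\<lambda>x. g x + h x) has_derivative (\<lambda>v. (\<Sum>i\<in>UNIV. v $ i * g' i x) + (\<Sum>i\<in>UNIV. v $ i * h' i x))) (at x)"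
          by (rule has_derivative_add[OF g'(2)[OF x] h'(2)[OF x]])
        then show "((\<lambda>x. g x + h x) has_derivative (\<lambda>v. \<Sum>i\<in>UNIV. v $ i * (g' i x + h' i x))) (at x)"
          by (rule has_derivative_eq_rhs) (simp add: sum.distrib distrib_left)
      qed
    qed (intro homog_intros g' h')
  }
qed

lemma sum_axis: "(\<Sum>i\<in>UNIV. axis k 1 $ i * g i) = (g k :: real)"
  by (simp add: axis_def if_distrib if_distribR cong: if_cong)

lemma homog_has_derivative:
  assumes "homog r f" "x \<noteq> 0"
  shows "(f has_derivative (\<lambda>h. \<Sum>i\<in>UNIV. h $ i * partial i f x)) (at x)"
proof -
  obtain g where g: "(f has_derivative (\<lambda>h. \<Sum>i\<in>UNIV. h $ i * g i x)) (at x)"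
    using homog_derivative[OF assms(1)] assms(2) by blast
  then have "partial k f x = g k x" for k
    by (simp add: partial_has_derivative[OF g] sum_axis)
  with g show ?thesis by simp
qed

lemma homog_partial:
  assumes "homog r f"
  shows "homog (r - 1) (partial i f)"
proof -
  obtain g where g: "\<And>i. homog (r - 1) (g i)" "\<And>x. x \<noteq> 0 \<Longrightarrow> (f has_derivative (\<lambda>h. \<Sum>i\<in>UNIV. h $ i * g i x)) (at x)"
    using homog_derivative[OF assms(1)] by blast
  have "partial i f x = g i x" if "x \<noteq> 0" for x
    by (simp add: partial_has_derivative[OF g(2)[OF that]] sum_axis)
  then show ?thesis by (intro homog_cong[OF g(1)])
qed

lemma homog_isCont: "homog r f \<Longrightarrow> x \<noteq> 0 \<Longrightarrow> isCont f x"
  using homog_has_derivative has_derivative_continuous by blast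

lemma homog_bound:
  assumes "homog r f"
  shows "\<exists>C\<ge>0. \<forall>x. x \<noteq> 0 \<longrightarrow> \<bar>f x\<bar> \<le> C * norm x powr r"
  using assms
proof induction
  case (base f r)
  then show ?case by (intro exI[of _ 1]) auto
next
  case (coord r g f k)
  then obtain C where C: "C \<ge> 0" "\<And>x. x \<noteq> 0 \<Longrightarrow> \<bar>g x\<bar> \<le> C * norm x powr r" by blast
  have "\<bar>f x\<bar> \<le> C * norm x powr (r + 1)" if "x \<noteq> 0" for x
  proof -
    have "\<bar>f x\<bar> = \<bar>x $ k\<bar> * \<bar>g x\<bar>" using coord(2)[OF that] by (simp add: abs_mult)
    also have "\<dots> \<le> norm x * (C * norm x powr r)"
      using C(2)[OF that] by (intro mult_mono component_le_norm_cart) auto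
    finally show ?thesis using that by (simp add: powr_add mult_ac)
  qed
  then show ?case using C(1) by blast
next
  case (cmult r g f c)
  then obtain C where C: "C \<ge> 0" "\<And>x. x \<noteq> 0 \<Longrightarrow> \<bar>g x\<bar> \<le> C * norm x powr r" by blast
  have "\<bar>f x\<bar> \<le> \<bar>c\<bar> * C * norm x powr r" if "x \<noteq> 0" for x
    using cmult(2)[OF that] mult_left_mono[OF C(2)[OF that], of "\<bar>c\<bar>"] by (simp add: abs_mult mult.assoc)
  then show ?case using C(1) by (intro exI[of _ "\<bar>c\<bar> * C"]) auto
next
  case (add r g h f)
  then obtain C where C: "C \<ge> 0" "\<And>x. x \<noteq> 0 \<Longrightarrow> \<bar>g x\<bar> \<le> C * norm x powr r" by blast
  from add obtain D where D: "D \<ge> 0" "\<And>x. x \<noteq> 0 \<Longrightarrow> \<bar>h x\<bar> \<le> D * norm x powr r" by blast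
  have "\<bar>f x\<bar> \<le> (C + D) * norm x powr r" if "x \<noteq> 0" for x
    using add(3)[OF that] C(2)[OF that] D(2)[OF that] by (simp add: distrib_right)
  then show ?case using C(1) D(1) by (intro exI[of _ "C + D"]) auto
qed

lemma partial_homog_rules:
  assumes g: "homog r g" and x: "x \<noteq> 0"
  shows partial_coord_mult: "partial i (\<lambda>x. x $ k * g x) x = (if i = k then g x else 0) + x $ k * partial i g x"
    and partial_cmult: "partial i (\<lambda>x. c * g x) x = c * partial i g x"
    and partial_add: "homog r' h \<Longrightarrow> partial i (\<lambda>x. g x + h x) x = partial i g x + partial i h x"
proof -
  note D = homog_has_derivative[OF g x]
  show "partial i (\<lambda>x. x $ k * g x) x = (if i = k then g x else 0) + x $ k * partial i g x"
    by (subst partial_has_derivative[OF has_derivative_mult[OF has_derivative_component D]]) (simp add: sum_axis, simp add: axis_def)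
  show "partial i (\<lambda>x. c * g x) x = c * partial i g x"
    by (subst partial_has_derivative[OF has_derivative_mult_right[OF D]]) (simp add: sum_axis)
  show "partial i (\<lambda>x. g x + h x) x = partial i g x + partial i h x" if "homog r' h"
    by (subst partial_has_derivative[OF has_derivative_add[OF D homog_has_derivative[OF that x]]]) (simp add: sum_axis)
qed

lemma partial_norm_powr:
  assumes "x \<noteq> 0"
  shows "partial i (\<lambda>x::real^'d. norm x powr r) x = r * (x $ i * norm x powr (r - 2))"
  by (subst partial_has_derivative[OF has_derivative_norm_powr[OF assms]]) (simp add: sum_axis)

text \<open>Symmetry is read off from each constructor: the second derivatives of |x|^r are explicit
  and symmetric, and the product rule with a coordinate produces a symmetric expression from a
  symmetric one.\<close>

lemma homog_partial_commute:
  assumes "homog r f" "x \<noteq> 0"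
  shows "partial i (partial j f) x = partial j (partial i f) x"
  using assms
proof induction
  case (base f r)
  have "partial j f y = r * (y $ j * norm y powr (r - 2))" if "y \<noteq> 0" for j y
    using partial_cong_nonzero[OF that base(1)] partial_norm_powr[OF that] by simp
  then have *: "partial i (partial j f) x = partial i (\<lambda>y. r * (y $ j * norm y powr (r - 2))) x" for i j
    by (intro partial_cong_nonzero base(2))
  have "partial i (partial j f) x = r * ((if i = j then norm x powr (r - 2) else 0) + x $ j * ((r - 2) * (x $ i * norm x powr (r - 2 - 2))))" for i j
    unfolding * by (simp add: partial_cmult[OF homog_intros(2)[OF homog_intros(1)] base(2)]
      partial_coord_mult[OF homog_intros(1) base(2)] partial_norm_powr[OF base(2)])
  then show ?case by simp
next
  case (coord r g f k)
  have "partial j f y = (if j = k then g y else 0) + y $ k * partial j g y" if "y \<noteq> 0" for j y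
    using partial_cong_nonzero[OF that coord(2)] partial_coord_mult[OF coord(1) that] by simp
  then have *: "partial i (partial j f) x = partial i (\<lambda>y. (if j = k then g y else 0) + y $ k * partial j g y) x" for i j
    by (intro partial_cong_nonzero coord)
  have "partial i (partial j f) x = (if j = k then partial i g x else 0) + ((if i = k then partial j g x else 0) + x $ k * partial i (partial j g) x)" for i j
  proof -
    have h: "homog r (\<lambda>y. if j = k then g y else 0)" using coord(1) homog_zero by (cases "j = k") auto
    have "partial i (\<lambda>y. if j = k then g y else 0) x = (if j = k then partial i g x else 0)"
      by (auto simp: partial_def)
    then show ?thesis
      unfolding * by (simp add: partial_add[OF h coord(4) homog_intros(2)[OF homog_partial[OF coord(1)]]]
        partial_coord_mult[OF homog_partial[OF coord(1)] coord(4)])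
  qed
  then show ?case using coord(3)[OF coord(4)] by simp
next
  case (cmult r g f c)
  have "partial j f y = c * partial j g y" if "y \<noteq> 0" for j y
    using partial_cong_nonzero[OF that cmult(2)] partial_cmult[OF cmult(1) that] by simp
  then have "partial i (partial j f) x = partial i (\<lambda>y. c * partial j g y) x" for i j
    by (intro partial_cong_nonzero cmult)
  then show ?case using cmult(3)[OF cmult(4)] by (simp add: partial_cmult[OF homog_partial[OF cmult(1)] cmult(4)])
next
  case (add r g h f)
  have "partial j f y = partial j g y + partial j h y" if "y \<noteq> 0" for j y
    using partial_cong_nonzero[OF that add(3)] partial_add[OF add(1) that add(2)] by simp
  then have "partial i (partial j f) x = partial i (\<lambda>y. partial j g y + partial j h y) x" for i j
    by (intro partial_cong_nonzero add)
  then show ?case using add(4)[OF add(6)] add(5)[OF add(6)]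
    by (simp add: partial_add[OF homog_partial[OF add(1)] add(6) homog_partial[OF add(2)]])
qed

section \<open>Iterated partial derivatives on the class\<close>

lemma homog_partial_power: "homog r f \<Longrightarrow> homog (r - real n) ((partial i ^^ n) f)"
proof (induction n)
  case (Suc n)
  then show ?case using homog_partial[of "r - real n" "(partial i ^^ n) f" i] by (simp add: algebra_simps)
qed simp

lemma partial_power_cong:
  assumes "\<And>x. x \<noteq> 0 \<Longrightarrow> f x = g x" "x \<noteq> 0"
  shows "(partial i ^^ n) f x = (partial i ^^ n) g x"
  using assms(2) by (induction n arbitrary: x) (auto simp: assms(1) intro: partial_cong_nonzero)

lemma homog_partial_power_commute:
  assumes "homog r f" "x \<noteq> 0"
  shows "partial k ((partial i ^^ n) f) x = (partial i ^^ n) (partial k f) x"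
  using assms(2)
proof (induction n arbitrary: x)
  case (Suc n)
  have "partial k (partial i ((partial i ^^ n) f)) x = partial i (partial k ((partial i ^^ n) f)) x"
    by (rule homog_partial_commute[OF homog_partial_power[OF assms(1)] Suc.prems])
  also have "\<dots> = partial i ((partial i ^^ n) (partial k f)) x"
    by (rule partial_cong_nonzero[OF Suc.prems Suc.IH])
  finally show ?case by simp
qed simp

text \<open>\<open>mi_partial\<close> with the enumeration as a parameter, which permits induction
  over partial lists of coordinates.\<close>

definition list_partial :: "'d list \<Rightarrow> 'd multi_index \<Rightarrow> (real^'d \<Rightarrow> real) \<Rightarrow> real^'d::finite \<Rightarrow> real" where
  "list_partial ks \<alpha> f = foldr (\<lambda>i. partial i ^^ \<alpha> i) ks f"

lemma list_partial_simps [simp]: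
  "list_partial [] \<alpha> f = f" "list_partial (i # ks) \<alpha> f = (partial i ^^ \<alpha> i) (list_partial ks \<alpha> f)"
  by (simp_all add: list_partial_def)

lemma homog_list_partial: "homog r f \<Longrightarrow> homog (r - real (sum_list (map \<alpha> ks))) (list_partial ks \<alpha> f)"
proof (induction ks)
  case (Cons i ks)
  then show ?case using homog_partial_power[OF Cons.IH[OF Cons.prems], of "\<alpha> i" i] by (simp add: algebra_simps)
qed simp

lemma list_partial_commute:
  assumes "homog r f" "x \<noteq> 0"
  shows "partial k (list_partial ks \<alpha> f) x = list_partial ks \<alpha> (partial k f) x"
  using assms(2)
proof (induction ks arbitrary: x)
  case (Cons i ks)
  show ?case
    using homog_partial_power_commute[OF homog_list_partial[OF assms(1)] Cons.prems, where k = k and i = i]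
      partial_power_cong[OF Cons.IH Cons.prems] by simp
qed simp

text \<open>The new derivative is commuted inwards until it meets the block of its own coordinate.
  Distinctness guarantees that this block occurs once, so the order is raised by exactly
  one.\<close>

lemma list_partial_upd:
  assumes "homog r f" "distinct ks" "k \<in> set ks" "x \<noteq> 0"
  shows "partial k (list_partial ks \<alpha> f) x = list_partial ks (\<alpha>(k := Suc (\<alpha> k))) f x"
  using assms(2-)
proof (induction ks arbitrary: x)
  case (Cons i ks)
  show ?case
  proof (cases "i = k")
    case True
    then have "list_partial ks (\<alpha>(k := Suc (\<alpha> k))) f = list_partial ks \<alpha> f"
      unfolding list_partial_def using Cons.prems by (intro foldr_cong) auto
    with True show ?thesis by (simp only: list_partial_simps fun_upd_same funpow.simps o_apply)
  next
    case False
    have IH: "partial k (list_partial ks \<alpha> f) y = list_partial ks (\<alpha>(k := Suc (\<alpha> k))) f y" if "y \<noteq> 0" for y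
      by (rule Cons.IH[OF _ _ that]) (use Cons.prems False in auto)
    have "partial k (list_partial (i # ks) \<alpha> f) x = (partial i ^^ \<alpha> i) (partial k (list_partial ks \<alpha> f)) x"
      unfolding list_partial_simps by (rule homog_partial_power_commute[OF homog_list_partial[OF assms(1)] Cons.prems(3)])
    also have "\<dots> = (partial i ^^ \<alpha> i) (list_partial ks (\<alpha>(k := Suc (\<alpha> k))) f) x"
      by (rule partial_power_cong[OF IH Cons.prems(3)])
    moreover have "(\<alpha>(k := Suc (\<alpha> k))) i = \<alpha> i" using False by simp
    ultimately show ?thesis by (simp only: list_partial_simps)
  qed
qed simp

lemma mi_partial_list:
  obtains ks :: "'d::finite list" where "distinct ks" "set ks = UNIV" "mi_partial = list_partial ks"
proof
  let ?is = "SOME is. distinct is \<and> set is = (UNIV :: 'd set)"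
  have "\<exists>is. distinct is \<and> set is = (UNIV :: 'd set)" using finite_distinct_list[of "UNIV :: 'd set"] by auto
  from someI_ex[OF this] show "distinct ?is" "set ?is = UNIV" by auto
  show "mi_partial = list_partial ?is" by (intro ext) (simp add: mi_partial_def list_partial_def)
qed

lemma homog_mi_partial: "homog r f \<Longrightarrow> homog (r - real (mi_abs \<alpha>)) (mi_partial \<alpha> f)"
  and mi_partial_commute: "homog r f \<Longrightarrow> x \<noteq> 0 \<Longrightarrow> partial k (mi_partial \<alpha> f) x = mi_partial \<alpha> (partial k f) x"
  and mi_partial_upd: "homog r f \<Longrightarrow> x \<noteq> 0 \<Longrightarrow> partial k (mi_partial \<alpha> f) x = mi_partial (\<alpha>(k := Suc (\<alpha> k))) f x"
  for f :: "real^'d::finite \<Rightarrow> real"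
proof -
  obtain ks :: "'d list" where ks: "distinct ks" "set ks = UNIV" "mi_partial = list_partial ks"
    by (rule mi_partial_list)
  have s: "sum_list (map \<alpha> ks) = mi_abs \<alpha>"
    using ks by (simp add: mi_abs_def sum_list_distinct_conv_sum_set)
  show "homog r f \<Longrightarrow> homog (r - real (mi_abs \<alpha>)) (mi_partial \<alpha> f)"
    using homog_list_partial[of r f \<alpha> ks] ks s by simp
  show "homog r f \<Longrightarrow> x \<noteq> 0 \<Longrightarrow> partial k (mi_partial \<alpha> f) x = mi_partial \<alpha> (partial k f) x"
    using list_partial_commute[of r f x k ks \<alpha>] ks by simp
  show "homog r f \<Longrightarrow> x \<noteq> 0 \<Longrightarrow> partial k (mi_partial \<alpha> f) x = mi_partial (\<alpha>(k := Suc (\<alpha> k))) f x"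
    using list_partial_upd[of r f ks k x \<alpha>] ks by simp
qed

lemma mi_partial_zero [simp]: "mi_partial (\<lambda>_. 0) f = f"
proof -
  have "foldr (\<lambda>i. partial i ^^ 0) ks f = f" for ks by (induction ks) auto
  then show ?thesis unfolding mi_partial_def by simp
qed

lemma finite_mi_abs_le: "finite {\<alpha>::'d::finite multi_index. mi_abs \<alpha> \<le> n}"
proof (rule finite_subset)
  show "{\<alpha>::'d multi_index. mi_abs \<alpha> \<le> n} \<subseteq> {\<alpha>. \<forall>i. (i \<in> UNIV \<longrightarrow> \<alpha> i \<in> {..n}) \<and> (i \<notin> UNIV \<longrightarrow> \<alpha> i = 0)}"
  proof clarsimp
    fix \<alpha> :: "'d multi_index" and i assume "mi_abs \<alpha> \<le> n"
    moreover have "\<alpha> i \<le> mi_abs \<alpha>" unfolding mi_abs_def by (rule member_le_sum) auto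
    ultimately show "\<alpha> i \<le> n" by simp
  qed
  show "finite {\<alpha>::'d multi_index. \<forall>i. (i \<in> UNIV \<longrightarrow> \<alpha> i \<in> {..n}) \<and> (i \<notin> UNIV \<longrightarrow> \<alpha> i = 0)}"
    by (rule finite_set_of_finite_funs) auto
qed

lemma finite_mi_abs_eq: "finite {\<alpha>::'d::finite multi_index. mi_abs \<alpha> = n}"
  by (rule finite_subset[OF _ finite_mi_abs_le[of n]]) auto

section \<open>Taylor expansion in multi-indices\<close>

lemma mi_power_upd: "mi_power y (\<alpha>(k := Suc (\<alpha> k))) = y $ k * mi_power (y :: real^'d) \<alpha>"
proof -
  have "mi_power y (\<alpha>(k := Suc (\<alpha> k))) = y $ k ^ Suc (\<alpha> k) * (\<Prod>i\<in>UNIV - {k}. y $ i ^ \<alpha> i)"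
    unfolding mi_power_def by (subst prod.remove[of _ k]) auto
  also have "\<dots> = y $ k * mi_power y \<alpha>"
    unfolding mi_power_def by (subst (2) prod.remove[of _ k]) auto
  finally show ?thesis .
qed

lemma mi_abs_upd: "mi_abs (\<alpha>(k := Suc (\<alpha> k))) = Suc (mi_abs \<alpha>)"
proof -
  have "mi_abs (\<alpha>(k := Suc (\<alpha> k))) = Suc (\<alpha> k) + (\<Sum>i\<in>UNIV - {k}. \<alpha> i)"
    unfolding mi_abs_def by (subst sum.remove[of _ k]) auto
  also have "\<dots> = Suc (mi_abs \<alpha>)"
    unfolding mi_abs_def by (subst (2) sum.remove[of _ k]) auto
  finally show ?thesis .
qed

lemma mi_fact_upd: "mi_fact (\<alpha>(k := Suc (\<alpha> k))) = real (Suc (\<alpha> k)) * mi_fact \<alpha>"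
proof -
  have "mi_fact (\<alpha>(k := Suc (\<alpha> k))) = fact (Suc (\<alpha> k)) * (\<Prod>i\<in>UNIV - {k}. fact (\<alpha> i))"
    unfolding mi_fact_def by (subst prod.remove[of _ k]) auto
  also have "\<dots> = real (Suc (\<alpha> k)) * mi_fact \<alpha>"
    unfolding mi_fact_def by (subst (2) prod.remove[of _ k]) auto
  finally show ?thesis .
qed

lemma mi_fact_pos: "mi_fact \<alpha> > 0"
  unfolding mi_fact_def by (intro prod_pos) auto

lemma mi_power_bound: "\<bar>mi_power y \<alpha>\<bar> \<le> norm (y :: real^'d) ^ mi_abs \<alpha>"
proof -
  have "\<bar>mi_power y \<alpha>\<bar> = (\<Prod>i\<in>UNIV. \<bar>y $ i\<bar> ^ \<alpha> i)" by (simp add: mi_power_def abs_prod power_abs)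
  also have "\<dots> \<le> (\<Prod>i\<in>UNIV. norm y ^ \<alpha> i)"
    by (intro prod_mono) (auto intro: power_mono component_le_norm_cart)
  also have "\<dots> = norm y ^ mi_abs \<alpha>" by (simp add: mi_abs_def power_sum)
  finally show ?thesis .
qed

lemma mi_power_minus: "mi_power (- y) \<alpha> = (- 1) ^ mi_abs \<alpha> * mi_power (y :: real^'d) \<alpha>"
proof -
  have "mi_power (- y) \<alpha> = (\<Prod>i\<in>UNIV. (- 1) ^ \<alpha> i * y $ i ^ \<alpha> i)"
    unfolding mi_power_def by (intro prod.cong) (auto simp flip: power_mult_distrib)
  then show ?thesis by (simp add: prod.distrib mi_power_def mi_abs_def power_sum)
qed

definition taylor_term :: "(real^'d::finite \<Rightarrow> real) \<Rightarrow> real^'d \<Rightarrow> nat \<Rightarrow> real^'d \<Rightarrow> real" where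
  "taylor_term f y n x = (\<Sum>\<alpha> | mi_abs \<alpha> = n. mi_power y \<alpha> / mi_fact \<alpha> * mi_partial \<alpha> f x)"

text \<open>The pairs \<open>(\<alpha>, k)\<close> are reindexed by \<open>(\<alpha> + e\<^sub>k, k)\<close>; a multi-index \<open>\<beta>\<close> of order \<open>n + 1\<close>
  then occurs with total weight \<open>\<Sum>\<^sub>k \<beta>\<^sub>k = n + 1\<close>.\<close>

lemma sum_multi_index_Suc:
  fixes F :: "'d::finite multi_index \<Rightarrow> real" and y :: "real^'d"
  shows "(\<Sum>\<alpha> | mi_abs \<alpha> = n. \<Sum>k\<in>UNIV. mi_power y \<alpha> / mi_fact \<alpha> * (y $ k * F (\<alpha>(k := Suc (\<alpha> k)))))
    = real (Suc n) * (\<Sum>\<beta> | mi_abs \<beta> = Suc n. mi_power y \<beta> / mi_fact \<beta> * F \<beta>)"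
proof -
  let ?G = "\<lambda>\<beta>. mi_power y \<beta> / mi_fact \<beta> * F \<beta>"
  have "(\<Sum>\<alpha> | mi_abs \<alpha> = n. \<Sum>k\<in>UNIV. mi_power y \<alpha> / mi_fact \<alpha> * (y $ k * F (\<alpha>(k := Suc (\<alpha> k)))))
     = (\<Sum>(\<alpha>, k)\<in>{\<alpha>. mi_abs \<alpha> = n} \<times> UNIV. mi_power y \<alpha> / mi_fact \<alpha> * (y $ k * F (\<alpha>(k := Suc (\<alpha> k)))))"
    by (simp add: sum.cartesian_product)
  also have "\<dots> = (\<Sum>(\<beta>, k)\<in>{(\<beta>, k). mi_abs \<beta> = Suc n \<and> \<beta> k > 0}. real (\<beta> k) * ?G \<beta>)"
  proof (rule sum.reindex_bij_witness[of _ "\<lambda>(\<beta>, k). (\<beta>(k := \<beta> k - 1), k)" "\<lambda>(\<alpha>, k). (\<alpha>(k := Suc (\<alpha> k)), k)"])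
    fix a assume "a \<in> {(\<beta>::'d multi_index, k). mi_abs \<beta> = Suc n \<and> \<beta> k > 0}"
    then obtain \<beta> k where a: "a = (\<beta>, k)" "mi_abs \<beta> = Suc n" "\<beta> k > 0" by auto
    have "(\<beta>(k := \<beta> k - 1))(k := Suc ((\<beta>(k := \<beta> k - 1)) k)) = \<beta>" using a(3) by auto
    then have "mi_abs (\<beta>(k := \<beta> k - 1)) = n" using mi_abs_upd[of "\<beta>(k := \<beta> k - 1)" k] a(2) by simp
    then show "(case a of (\<beta>, k) \<Rightarrow> (\<beta>(k := \<beta> k - 1), k)) \<in> {\<alpha>. mi_abs \<alpha> = n} \<times> UNIV" by (simp add: a(1))
  next
    fix a :: "'d multi_index \<times> 'd" assume "a \<in> {\<alpha>. mi_abs \<alpha> = n} \<times> UNIV"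
    show "(case case a of (\<alpha>, k) \<Rightarrow> (\<alpha>(k := Suc (\<alpha> k)), k) of (\<beta>, k) \<Rightarrow> real (\<beta> k) * ?G \<beta>)
      = (case a of (\<alpha>, k) \<Rightarrow> mi_power y \<alpha> / mi_fact \<alpha> * (y $ k * F (\<alpha>(k := Suc (\<alpha> k)))))"
      by (cases a) (simp add: mi_power_upd mi_fact_upd del: of_nat_Suc fun_upd_apply, simp)
  qed (auto simp: mi_abs_upd simp del: fun_upd_apply, auto)
  also have "\<dots> = (\<Sum>(\<beta>, k)\<in>{\<beta>. mi_abs \<beta> = Suc n} \<times> UNIV. real (\<beta> k) * ?G \<beta>)"
    by (intro sum.mono_neutral_left) (auto intro!: finite_cartesian_product finite_mi_abs_eq)
  also have "\<dots> = (\<Sum>\<beta> | mi_abs \<beta> = Suc n. \<Sum>k\<in>UNIV. real (\<beta> k) * ?G \<beta>)"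
    by (simp add: sum.cartesian_product)
  also have "\<dots> = (\<Sum>\<beta> | mi_abs \<beta> = Suc n. real (Suc n) * ?G \<beta>)"
  proof (intro sum.cong refl)
    fix \<beta> :: "'d multi_index" assume "\<beta> \<in> {\<beta>. mi_abs \<beta> = Suc n}"
    then have "(\<Sum>k\<in>UNIV. real (\<beta> k)) = real (Suc n)" by (simp add: mi_abs_def flip: of_nat_sum)
    then show "(\<Sum>k\<in>UNIV. real (\<beta> k) * ?G \<beta>) = real (Suc n) * ?G \<beta>"
      by (simp only: sum_distrib_right[symmetric])
  qed
  finally show ?thesis by (simp add: sum_distrib_left)
qed

text \<open>The factor n + 1 is the total weight from the reindexing above, so n! times the n-th
  term is the n-th derivative of f along the segment.\<close>

lemma DERIV_taylor_term:
  assumes f: "homog r f" and x: "x + \<theta> *\<^sub>R y \<noteq> 0"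
  shows "((\<lambda>\<theta>. taylor_term f y n (x + \<theta> *\<^sub>R y)) has_real_derivative real (Suc n) * taylor_term f y (Suc n) (x + \<theta> *\<^sub>R y)) (at \<theta>)"
proof -
  let ?z = "x + \<theta> *\<^sub>R y"
  have D: "((\<lambda>\<theta>. mi_partial \<alpha> f (x + \<theta> *\<^sub>R y)) has_real_derivative (\<Sum>k\<in>UNIV. y $ k * mi_partial (\<alpha>(k := Suc (\<alpha> k))) f ?z)) (at \<theta>)" for \<alpha>
  proof -
    have "((\<lambda>\<theta>. mi_partial \<alpha> f (x + \<theta> *\<^sub>R y)) has_derivative (\<lambda>h. \<Sum>i\<in>UNIV. (h *\<^sub>R y) $ i * partial i (mi_partial \<alpha> f) ?z)) (at \<theta>)"
      by (rule has_derivative_compose[where f = "\<lambda>\<theta>. x + \<theta> *\<^sub>R y" and g = "mi_partial \<alpha> f",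
            OF _ homog_has_derivative[OF homog_mi_partial[OF f] x]]) (auto intro!: derivative_eq_intros)
    then show ?thesis
      unfolding has_field_derivative_def
      by (rule has_derivative_eq_rhs) (auto simp: mi_partial_upd[OF f x] sum_distrib_left sum_distrib_right mult_ac simp del: fun_upd_apply)
  qed
  have "((\<lambda>\<theta>. taylor_term f y n (x + \<theta> *\<^sub>R y)) has_real_derivative
     (\<Sum>\<alpha> | mi_abs \<alpha> = n. mi_power y \<alpha> / mi_fact \<alpha> * (\<Sum>k\<in>UNIV. y $ k * mi_partial (\<alpha>(k := Suc (\<alpha> k))) f ?z))) (at \<theta>)"
    unfolding taylor_term_def by (intro DERIV_sum DERIV_cmult D)
  also have "(\<Sum>\<alpha> | mi_abs \<alpha> = n. mi_power y \<alpha> / mi_fact \<alpha> * (\<Sum>k\<in>UNIV. y $ k * mi_partial (\<alpha>(k := Suc (\<alpha> k))) f ?z))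
     = real (Suc n) * taylor_term f y (Suc n) ?z"
    unfolding taylor_term_def sum_multi_index_Suc[symmetric] by (simp add: sum_distrib_left del: fun_upd_apply)
  finally show ?thesis .
qed

lemma taylor_expansion:
  assumes f: "homog r f" and n: "n > 0" and seg: "\<And>\<theta>. 0 \<le> \<theta> \<Longrightarrow> \<theta> \<le> 1 \<Longrightarrow> x + \<theta> *\<^sub>R y \<noteq> 0"
  obtains \<theta> where "0 < \<theta>" "\<theta> < 1" "f (x + y) = (\<Sum>m<n. taylor_term f y m x) + taylor_term f y n (x + \<theta> *\<^sub>R y)"
proof -
  have "mi_abs \<alpha> = 0 \<longleftrightarrow> \<alpha> = (\<lambda>_. 0)" for \<alpha> :: "'a \<Rightarrow> nat" by (auto simp: mi_abs_def)
  then have t0: "taylor_term f y 0 z = f z" for z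
    by (simp add: taylor_term_def mi_power_def mi_fact_def)
  have "\<exists>t>0. t < 1 \<and> f (x + 1 *\<^sub>R y) = (\<Sum>m<n. (fact m * taylor_term f y m (x + 0 *\<^sub>R y)) / fact m * 1 ^ m)
     + (fact n * taylor_term f y n (x + t *\<^sub>R y)) / fact n * 1 ^ n"
  \<comment> \<open>The one-dimensional expansion of f along the segment from x to x + y, evaluated
    at parameter 1.\<close>
  proof (rule Maclaurin[where diff = "\<lambda>m \<theta>. fact m * taylor_term f y m (x + \<theta> *\<^sub>R y)"])
    show "(\<lambda>\<theta>. fact 0 * taylor_term f y 0 (x + \<theta> *\<^sub>R y)) = (\<lambda>\<theta>. f (x + \<theta> *\<^sub>R y))" by (simp add: t0)
    show "\<forall>m t. m < n \<and> 0 \<le> t \<and> t \<le> 1 \<longrightarrow> ((\<lambda>\<theta>. fact m * taylor_term f y m (x + \<theta> *\<^sub>R y)) has_real_derivative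
        fact (Suc m) * taylor_term f y (Suc m) (x + t *\<^sub>R y)) (at t)"
      using DERIV_cmult[OF DERIV_taylor_term[OF f seg], of _ "fact _"] by (auto simp: mult_ac)
  qed (use n in auto)
  then show ?thesis using that by auto
qed

lemma taylor_term_bound:
  assumes f: "homog r f"
  shows "\<exists>C\<ge>0. \<forall>x y. x \<noteq> 0 \<longrightarrow> \<bar>taylor_term f y n x\<bar> \<le> C * norm y ^ n * norm x powr (r - real n)"
proof -
  have "\<exists>C\<ge>0. \<forall>x. x \<noteq> 0 \<longrightarrow> \<bar>mi_partial \<alpha> f x\<bar> \<le> C * norm x powr (r - real (mi_abs \<alpha>))" for \<alpha> :: "'a multi_index"
    by (rule homog_bound[OF homog_mi_partial[OF f]])
  then obtain C where C: "\<And>\<alpha>. C \<alpha> \<ge> 0" "\<And>\<alpha> x. x \<noteq> 0 \<Longrightarrow> \<bar>mi_partial \<alpha> f x\<bar> \<le> C \<alpha> * norm x powr (r - real (mi_abs \<alpha>))"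
    by metis
  have "\<bar>taylor_term f y n x\<bar> \<le> (\<Sum>\<alpha> | mi_abs \<alpha> = n. C \<alpha> / mi_fact \<alpha>) * norm y ^ n * norm x powr (r - real n)" if x: "x \<noteq> 0" for x y
  proof -
    have "\<bar>taylor_term f y n x\<bar> \<le> (\<Sum>\<alpha> | mi_abs \<alpha> = n. \<bar>mi_power y \<alpha> / mi_fact \<alpha> * mi_partial \<alpha> f x\<bar>)"
      unfolding taylor_term_def by (rule sum_abs)
    also have "\<dots> \<le> (\<Sum>\<alpha> | mi_abs \<alpha> = n. norm y ^ n / mi_fact \<alpha> * (C \<alpha> * norm x powr (r - real n)))"
    proof (rule sum_mono)
      fix \<alpha> :: "'a multi_index" assume "\<alpha> \<in> {\<alpha>. mi_abs \<alpha> = n}"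
      then show "\<bar>mi_power y \<alpha> / mi_fact \<alpha> * mi_partial \<alpha> f x\<bar> \<le> norm y ^ n / mi_fact \<alpha> * (C \<alpha> * norm x powr (r - real n))"
        using C(2)[OF x, of \<alpha>] mi_power_bound[of y \<alpha>] mi_fact_pos[of \<alpha>] unfolding abs_mult
        by (intro mult_mono) (auto simp: abs_of_pos intro: divide_right_mono)
    qed
    also have "\<dots> = (\<Sum>\<alpha> | mi_abs \<alpha> = n. C \<alpha> / mi_fact \<alpha>) * norm y ^ n * norm x powr (r - real n)"
      by (simp add: sum_distrib_right sum_distrib_left mult_ac)
    finally show ?thesis .
  qed
  moreover have "(\<Sum>\<alpha> | mi_abs \<alpha> = n. C \<alpha> / mi_fact \<alpha>) \<ge> 0"
    by (intro sum_nonneg divide_nonneg_pos C mi_fact_pos)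
  ultimately show ?thesis by blast
qed

definition taylor_poly :: "(real^'d::finite \<Rightarrow> real) \<Rightarrow> real^'d \<Rightarrow> nat \<Rightarrow> real^'d \<Rightarrow> real" where
  "taylor_poly f y n x = (\<Sum>\<alpha> | mi_abs \<alpha> \<le> n. mi_power y \<alpha> / mi_fact \<alpha> * mi_partial \<alpha> f x)"

lemma taylor_poly_eq: "taylor_poly f y n x = (\<Sum>m\<le>n. taylor_term f y m x)"
proof -
  have "{\<alpha>::'a \<Rightarrow> nat. mi_abs \<alpha> \<le> n} = (\<Union>m\<in>{..n}. {\<alpha>. mi_abs \<alpha> = m})" by auto
  then show ?thesis
    unfolding taylor_poly_def taylor_term_def
    by (simp only:) (subst sum.UNION_disjoint, auto simp: finite_mi_abs_eq)
qed

text \<open>For |y| \<le> |x|/2 the whole segment stays at distance at least |x|/2 from the origin.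
  The remainder carries |y|^{n+1}; one factor |y| is exchanged for |x|, because for r = -(d + 1) the
  exponent r - n is already the claimed rate, and moments of order n then suffice.\<close>

lemma taylor_remainder_bound:
  assumes f: "homog r f" and r: "r \<le> 0"
  shows "\<exists>C\<ge>0. \<forall>x y. x \<noteq> 0 \<longrightarrow> norm y \<le> norm x / 2 \<longrightarrow>
    \<bar>f (x + y) - taylor_poly f y n x\<bar> \<le> C * norm y ^ n * norm x powr (r - real n)"
proof -
  obtain C where C: "C \<ge> 0" "\<And>x y. x \<noteq> 0 \<Longrightarrow> \<bar>taylor_term f y (Suc n) x\<bar> \<le> C * norm y ^ Suc n * norm x powr (r - real (Suc n))"
    using taylor_term_bound[OF f, of "Suc n"] by blast
  let ?e = "r - real (Suc n)"
  let ?C = "C * (1 / 2) powr ?e"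
  have "\<bar>f (x + y) - taylor_poly f y n x\<bar> \<le> ?C * norm y ^ n * norm x powr (r - real n)"
    if x: "x \<noteq> 0" and y: "norm y \<le> norm x / 2" for x y
  proof -
    have ge: "norm x / 2 \<le> norm (x + \<theta> *\<^sub>R y)" if "0 \<le> \<theta>" "\<theta> \<le> 1" for \<theta>
    proof -
      have "norm x \<le> norm (x + \<theta> *\<^sub>R y) + norm (\<theta> *\<^sub>R y)" using norm_triangle_ineq4[of "x + \<theta> *\<^sub>R y" "\<theta> *\<^sub>R y"] by simp
      moreover have "norm (\<theta> *\<^sub>R y) \<le> norm y" using that by (simp add: mult_left_le_one_le)
      ultimately show ?thesis using y by simp
    qed
    have nz: "x + \<theta> *\<^sub>R y \<noteq> 0" if "0 \<le> \<theta>" "\<theta> \<le> 1" for \<theta>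
      using ge[OF that] x by auto
    obtain \<theta> where t: "0 < \<theta>" "\<theta> < 1" "f (x + y) = (\<Sum>m<Suc n. taylor_term f y m x) + taylor_term f y (Suc n) (x + \<theta> *\<^sub>R y)"
      by (rule taylor_expansion[where n = "Suc n" and x = x and y = y, OF f]) (use nz in auto)
    have "\<bar>f (x + y) - taylor_poly f y n x\<bar> = \<bar>taylor_term f y (Suc n) (x + \<theta> *\<^sub>R y)\<bar>"
      using t(3) by (simp add: taylor_poly_eq lessThan_Suc_atMost)
    also have "\<dots> \<le> C * norm y ^ Suc n * norm (x + \<theta> *\<^sub>R y) powr ?e"
      using t by (intro C nz) auto
    also have "\<dots> \<le> C * norm y ^ Suc n * (norm x / 2) powr ?e"
      using t x r C(1) by (intro mult_left_mono powr_mono2' ge) auto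
    also have "(norm x / 2) powr ?e = (1 / 2) powr ?e * norm x powr ?e"
      using x by (simp flip: powr_mult)
    also have "C * norm y ^ Suc n * ((1 / 2) powr ?e * norm x powr ?e) = ?C * norm y ^ n * (norm y * norm x powr ?e)"
      by simp
    also have "\<dots> \<le> ?C * norm y ^ n * (norm x * norm x powr ?e)"
      using y C(1) norm_ge_zero[of y] by (intro mult_left_mono mult_right_mono) (auto simp del: norm_ge_zero)
    also have "norm x * norm x powr ?e = norm x powr (r - real n)"
      using x by (simp add: powr_mult_base algebra_simps)
    finally show ?thesis .
  qed
  then show ?thesis using C(1) by (intro exI[of _ ?C]) auto
qed

text \<open>Where y is large compared with x, the lower terms are raised to order n by |x|^{n-m}
  \<le> (2|y|)^{n-m}.\<close>

lemma taylor_poly_bound: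
  assumes f: "homog r f"
  shows "\<exists>C\<ge>0. \<forall>x y. x \<noteq> 0 \<longrightarrow> norm x / 2 \<le> norm y \<longrightarrow>
    \<bar>taylor_poly f y n x\<bar> \<le> C * norm y ^ n * norm x powr (r - real n)"
proof -
  have "\<exists>C\<ge>0. \<forall>x y. x \<noteq> 0 \<longrightarrow> \<bar>taylor_term f y m x\<bar> \<le> C * norm y ^ m * norm x powr (r - real m)" for m
    by (rule taylor_term_bound[OF f])
  then obtain C where C: "\<And>m. C m \<ge> 0" "\<And>m x y. x \<noteq> 0 \<Longrightarrow> \<bar>taylor_term f y m x\<bar> \<le> C m * norm y ^ m * norm x powr (r - real m)"
    by metis
  have "\<bar>taylor_poly f y n x\<bar> \<le> (\<Sum>m\<le>n. C m * 2 ^ (n - m)) * norm y ^ n * norm x powr (r - real n)"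
    if x: "x \<noteq> 0" and y: "norm x / 2 \<le> norm y" for x y
  proof -
    have "\<bar>taylor_poly f y n x\<bar> \<le> (\<Sum>m\<le>n. \<bar>taylor_term f y m x\<bar>)"
      unfolding taylor_poly_eq by (rule sum_abs)
    also have "\<dots> \<le> (\<Sum>m\<le>n. C m * 2 ^ (n - m) * (norm y ^ n * norm x powr (r - real n)))"
    proof (rule sum_mono)
      fix m assume "m \<in> {..n}"
      then have m: "m \<le> n" by simp
      have "norm x powr (r - real m) = norm x powr (r - real n) * norm x ^ (n - m)"
        using x m by (simp add: powr_realpow[symmetric] of_nat_diff flip: powr_add)
      also have "norm x ^ (n - m) \<le> (2 * norm y) ^ (n - m)" using y by (intro power_mono) auto
      finally have "norm x powr (r - real m) \<le> norm x powr (r - real n) * (2 * norm y) ^ (n - m)"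
        by (simp add: mult_left_mono)
      then have "C m * norm y ^ m * norm x powr (r - real m) \<le> C m * norm y ^ m * (norm x powr (r - real n) * (2 * norm y) ^ (n - m))"
        using C(1) by (intro mult_left_mono) auto
      also have "\<dots> = C m * 2 ^ (n - m) * (norm y ^ (m + (n - m)) * norm x powr (r - real n))"
        by (simp add: power_mult_distrib power_add mult_ac)
      also have "m + (n - m) = n" using m by simp
      finally show "\<bar>taylor_term f y m x\<bar> \<le> C m * 2 ^ (n - m) * (norm y ^ n * norm x powr (r - real n))"
        using C(2)[OF x, of y m] by simp
    qed
    also have "\<dots> = (\<Sum>m\<le>n. C m * 2 ^ (n - m)) * norm y ^ n * norm x powr (r - real n)"
      by (simp add: sum_distrib_right mult.assoc)
    finally show ?thesis .
  qed
  moreover have "(\<Sum>m\<le>n. C m * 2 ^ (n - m)) \<ge> 0" by (intro sum_nonneg mult_nonneg_nonneg C) auto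
  ultimately show ?thesis by blast
qed

section \<open>Estimates of the Oseen kernel\<close>

text \<open>The tail from 0 is an explicit power, so the gradient of the Newtonian potential is a
  multiple of x_j |x|^{-d} in every dimension. The class is entered at the gradient because the
  logarithm in dimension 2 is not homogeneous.\<close>

lemma homog_K:
  assumes d: "CARD('d) \<ge> 2"
  shows "homog (- real CARD('d)) (K i j :: real^'d \<Rightarrow> real)"
proof -
  let ?d = "real CARD('d)"
  have "homog (- ?d + 1) (partial j newton :: real^'d \<Rightarrow> real)"
  proof (rule homog_cong)
    show "homog (- ?d + 1) (\<lambda>x::real^'d. - (heat_const TYPE('d) / 2) * (Gamma (?d / 2) * 4 powr (?d / 2)) * (x $ j * norm x powr (- ?d)))"
      by (intro homog_intros)
    fix x :: "real^'d" assume x: "x \<noteq> 0"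
    have "heat_tail (?d / 2 + 1) 0 ((norm x)\<^sup>2) = Gamma (?d / 2) * (4 / (norm x)\<^sup>2) powr (?d / 2)"
      using x by (subst heat_tail_0) auto
    also have "(4 / (norm x)\<^sup>2) powr (?d / 2) = 4 powr (?d / 2) * norm x powr (- ?d)"
      using x by (simp add: powr_divide powr_minus_divide powr_powr flip: powr_numeral)
    finally show "partial j newton x = - (heat_const TYPE('d) / 2) * (Gamma (?d / 2) * 4 powr (?d / 2)) * (x $ j * norm x powr (- ?d))"
      by (simp add: partial_newton[OF d x])
  qed
  from homog_partial[OF this] show ?thesis by (simp add: K_def)
qed

lemma homog_partial_K:
  assumes d: "CARD('d) \<ge> 2"
  shows "homog (- (real CARD('d) + 1)) (partial k (K i j) :: real^'d \<Rightarrow> real)"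
  using homog_partial[OF homog_K[OF d, of i j], of k] by (simp only: diff_conv_add_uminus minus_add_distrib)

lemma norm_eq_power2_powr: "norm x = ((norm x)\<^sup>2) powr (1 / 2)"
  by (simp add: powr_half_sqrt)

lemma smooth_DK_linear_bound:
  fixes z :: "real^'d"
  shows "\<bar>((if k = i then z $ j else 0) + (if k = j then z $ i else 0) + (if i = j then z $ k else 0)) / 4 * a
    - z $ i * z $ j * z $ k / 8 * b\<bar> \<le> norm z * \<bar>a\<bar> + norm z ^ 3 * \<bar>b\<bar>"
    (is "\<bar>?A * a - ?B * b\<bar> \<le> _")
proof -
  have A: "\<bar>?A\<bar> \<le> norm z"
    using component_le_norm_cart[of z i] component_le_norm_cart[of z j] component_le_norm_cart[of z k] norm_ge_zero[of z]
    by (auto split: if_splits)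
  have "\<bar>z $ i * z $ j * z $ k\<bar> \<le> norm z * norm z * norm z"
    unfolding abs_mult by (intro mult_mono component_le_norm_cart) auto
  then have B: "\<bar>?B\<bar> \<le> norm z ^ 3" by (simp add: power3_eq_cube)
  have "\<bar>?A * a - ?B * b\<bar> \<le> \<bar>?A\<bar> * \<bar>a\<bar> + \<bar>?B\<bar> * \<bar>b\<bar>"
    by (rule order_trans[OF abs_triangle_ineq4]) (simp only: abs_mult order_refl)
  also have "\<dots> \<le> norm z * \<bar>a\<bar> + norm z ^ 3 * \<bar>b\<bar>"
    using A B by (intro add_mono mult_right_mono) auto
  finally show ?thesis .
qed

lemma smooth_DK_diff_bound:
  fixes z :: "real^'d"
  shows "\<bar>smooth_DK t i j k z - smooth_DK t' i j k z\<bar> \<le> heat_const TYPE('d) *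
    (norm z * \<bar>heat_tail (real CARD('d) / 2 + 2) t ((norm z)\<^sup>2) - heat_tail (real CARD('d) / 2 + 2) t' ((norm z)\<^sup>2)\<bar>
     + norm z ^ 3 * \<bar>heat_tail (real CARD('d) / 2 + 3) t ((norm z)\<^sup>2) - heat_tail (real CARD('d) / 2 + 3) t' ((norm z)\<^sup>2)\<bar>)"
proof -
  have "c * (A * a - B * b) - c * (A * a' - B * b') = c * (A * (a - a') - B * (b - b'))" for c A B a a' b b' :: real
    by (simp add: algebra_simps)
  then show ?thesis
    unfolding smooth_DK_def by (simp only: abs_mult) (intro mult_mono smooth_DK_linear_bound; simp add: heat_const_def)
qed

lemma smooth_DK_bound:
  fixes z :: "real^'d"
  shows "\<bar>smooth_DK t i j k z\<bar> \<le> heat_const TYPE('d) *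
    (norm z * heat_tail (real CARD('d) / 2 + 2) t ((norm z)\<^sup>2) + norm z ^ 3 * heat_tail (real CARD('d) / 2 + 3) t ((norm z)\<^sup>2))"
proof -
  have "\<bar>smooth_DK t i j k z\<bar> \<le> heat_const TYPE('d) *
    (norm z * \<bar>heat_tail (real CARD('d) / 2 + 2) t ((norm z)\<^sup>2)\<bar> + norm z ^ 3 * \<bar>heat_tail (real CARD('d) / 2 + 3) t ((norm z)\<^sup>2)\<bar>)"
    unfolding smooth_DK_def abs_mult by (intro mult_mono smooth_DK_linear_bound) (simp_all add: heat_const_def)
  then show ?thesis by (simp only: abs_of_nonneg heat_tail_nonneg)
qed

lemma partial_heat_kernel_bound:
  fixes z :: "real^'d"
  assumes t: "t > 0"
  shows "\<bar>- z $ j / (2 * t) * heat_kernel t z\<bar> \<le> heat_const TYPE('d) * (norm z * heat_weight (real CARD('d) / 2 + 1) ((norm z)\<^sup>2) t)"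
proof -
  have "heat_kernel t z = heat_const TYPE('d) * (t * heat_weight (real CARD('d) / 2 + 1) ((norm z)\<^sup>2) t)"
    using t by (simp add: heat_kernel_def heat_const_def powr_mult heat_weight_def powr_diff)
  then have "\<bar>- z $ j / (2 * t) * heat_kernel t z\<bar> = \<bar>z $ j\<bar> / 2 * (heat_const TYPE('d) * heat_weight (real CARD('d) / 2 + 1) ((norm z)\<^sup>2) t)"
    using t by (simp add: abs_mult heat_const_def heat_weight_nonneg)
  also have "\<dots> \<le> norm z * (heat_const TYPE('d) * heat_weight (real CARD('d) / 2 + 1) ((norm z)\<^sup>2) t)"
    using component_le_norm_cart[of z j] norm_ge_zero[of z]
    by (intro mult_right_mono) (auto simp: heat_const_def heat_weight_nonneg simp del: norm_ge_zero)
  finally show ?thesis by (simp add: mult_ac)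
qed

lemma abs_if_add: "\<bar>(if P then a else 0) + b\<bar> \<le> \<bar>a\<bar> + \<bar>b :: real\<bar>"
  by auto

text \<open>The difference consists of the Gaussian term and of tail integrals over (0, t]. Both are
  O(t^{M+1}) times an arbitrary negative power of |z|, hence uniform for t \<le> T.\<close>

lemma oseen_partial_K_diff:
  fixes T N :: real and i j k :: "'d::finite"
  assumes d: "CARD('d) \<ge> 2" and N: "N \<ge> 0"
  shows "\<exists>C\<ge>0. \<forall>t. 0 < t \<longrightarrow> t \<le> T \<longrightarrow> (\<forall>z::real^'d. norm z \<ge> 1 / 2 \<longrightarrow>
     \<bar>oseen t i j z $ k - partial k (K i j) z\<bar> \<le> C * norm z powr (- (real CARD('d) + 1 + N)))"
proof -
  let ?d = "real CARD('d)"
  \<comment> \<open>Powers of q = |z|^2 count double. With this M all three terms become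
    |z|^{-(d+3+N)}, two orders better than claimed.\<close>
  define M where "M = N / 2"
  have M: "M \<ge> 0" using N by (simp add: M_def)
  have b: "?d / 2 + 2 > 1" "?d / 2 + 3 > 1" by auto
  obtain C2 where C2: "C2 \<ge> 0" "\<And>t q. t > 0 \<Longrightarrow> q > 0 \<Longrightarrow>
      \<bar>heat_tail (?d / 2 + 2) 0 q - heat_tail (?d / 2 + 2) t q\<bar> \<le> C2 * q powr (- (?d / 2 + 2 + M)) * t powr (M + 1)"
    using heat_tail_diff_bound[OF b(1) M] by blast
  obtain C3 where C3: "C3 \<ge> 0" "\<And>t q. t > 0 \<Longrightarrow> q > 0 \<Longrightarrow>
      \<bar>heat_tail (?d / 2 + 3) 0 q - heat_tail (?d / 2 + 3) t q\<bar> \<le> C3 * q powr (- (?d / 2 + 3 + M)) * t powr (M + 1)"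
    using heat_tail_diff_bound[OF b(2) M] by blast
  \<comment> \<open>The traded power is chosen so that s^{M+1} remains, matching the two tail
    estimates.\<close>
  obtain C1 where C1: "C1 \<ge> 0" "\<And>s q. s > 0 \<Longrightarrow> q \<ge> 0 \<Longrightarrow>
      q powr (?d / 2 + 2 + M) * heat_weight (?d / 2 + 1) q s \<le> C1 * heat_weight (?d / 2 + 1 - (?d / 2 + 2 + M)) (q / 2) s"
    using heat_weight_power_bound[of "?d / 2 + 2 + M" "?d / 2 + 1"] M by auto
  define C where "C = heat_const TYPE('d) * (C1 + C2 + C3) * T powr (M + 1) * 4"
  have hc: "heat_const TYPE('d) > 0" by (simp add: heat_const_def)
  have "\<bar>oseen t i j z $ k - partial k (K i j) z\<bar> \<le> C * norm z powr (- (?d + 1 + N))"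
    if t: "0 < t" "t \<le> T" and z: "norm z \<ge> 1 / 2" for t and z :: "real^'d"
  proof -
    define q where "q = (norm z)\<^sup>2"
    have z0: "z \<noteq> 0" "norm z > 0" using z by auto
    have q: "q > 0" using z0 by (simp add: q_def)
    have tT: "t powr (M + 1) \<le> T powr (M + 1)" using t M by (intro powr_mono2) auto
    let ?p = "norm z powr (- (?d + 3 + N))"
    have qp: "q powr a = norm z powr (2 * a)" for a
      using z0 by (simp add: q_def powr_powr flip: powr_numeral)
    have p2: "norm z * q powr (- (?d / 2 + 2 + M)) = ?p"
    proof -
      have "1 + 2 * (- (?d / 2 + 2 + M)) = - (?d + 3 + N)" by (simp add: M_def)
      then show ?thesis unfolding qp by (subst powr_mult_base) (simp, simp only:)
    qed
    have p3: "norm z ^ 3 * q powr (- (?d / 2 + 3 + M)) = ?p"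
    proof -
      have "norm z ^ 3 = norm z powr 3" using z0 by simp
      moreover have "3 + 2 * (- (?d / 2 + 3 + M)) = - (?d + 3 + N)" by (simp add: M_def)
      ultimately show ?thesis unfolding qp by (simp only: powr_add[symmetric])
    qed
    have t1: "norm z * heat_weight (?d / 2 + 1) q t \<le> C1 * ?p * T powr (M + 1)"
    proof -
      have "heat_weight (?d / 2 + 1) q t = q powr (- (?d / 2 + 2 + M)) * (q powr (?d / 2 + 2 + M) * heat_weight (?d / 2 + 1) q t)"
        using q by (simp flip: mult.assoc powr_add)
      also have "\<dots> \<le> q powr (- (?d / 2 + 2 + M)) * (C1 * heat_weight (?d / 2 + 1 - (?d / 2 + 2 + M)) (q / 2) t)"
        using t q by (intro mult_left_mono C1(2)) auto
      also have "heat_weight (?d / 2 + 1 - (?d / 2 + 2 + M)) (q / 2) t \<le> t powr (M + 1)"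
      proof -
        have "- (?d / 2 + 1 - (?d / 2 + 2 + M)) = M + 1" by simp
        then show ?thesis unfolding heat_weight_def using q t by (simp add: mult_left_le)
      qed
      also have "t powr (M + 1) \<le> T powr (M + 1)" by (rule tT)
      finally have "heat_weight (?d / 2 + 1) q t \<le> q powr (- (?d / 2 + 2 + M)) * (C1 * T powr (M + 1))"
        using C1(1) by (simp add: mult_left_mono)
      then have "norm z * heat_weight (?d / 2 + 1) q t \<le> norm z * (q powr (- (?d / 2 + 2 + M)) * (C1 * T powr (M + 1)))"
        by (intro mult_left_mono) auto
      also have "\<dots> = C1 * (norm z * q powr (- (?d / 2 + 2 + M))) * T powr (M + 1)" by simp
      finally show ?thesis unfolding p2 .
    qed
    have t2: "norm z * \<bar>heat_tail (?d / 2 + 2) t q - heat_tail (?d / 2 + 2) 0 q\<bar> \<le> C2 * ?p * T powr (M + 1)"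
    proof -
      have "norm z * \<bar>heat_tail (?d / 2 + 2) t q - heat_tail (?d / 2 + 2) 0 q\<bar> \<le> norm z * (C2 * q powr (- (?d / 2 + 2 + M)) * t powr (M + 1))"
        using C2(2)[OF t(1) q] by (intro mult_left_mono) (auto simp: abs_minus_commute)
      also have "\<dots> = C2 * (norm z * q powr (- (?d / 2 + 2 + M))) * t powr (M + 1)" by simp
      also have "\<dots> \<le> C2 * ?p * T powr (M + 1)" unfolding p2 using C2(1) by (intro mult_left_mono tT) auto
      finally show ?thesis .
    qed
    have t3: "norm z ^ 3 * \<bar>heat_tail (?d / 2 + 3) t q - heat_tail (?d / 2 + 3) 0 q\<bar> \<le> C3 * ?p * T powr (M + 1)"
    proof -
      have "norm z ^ 3 * \<bar>heat_tail (?d / 2 + 3) t q - heat_tail (?d / 2 + 3) 0 q\<bar> \<le> norm z ^ 3 * (C3 * q powr (- (?d / 2 + 3 + M)) * t powr (M + 1))"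
        using C3(2)[OF t(1) q] by (intro mult_left_mono) (auto simp: abs_minus_commute)
      also have "\<dots> = C3 * (norm z ^ 3 * q powr (- (?d / 2 + 3 + M))) * t powr (M + 1)" by simp
      also have "\<dots> \<le> C3 * ?p * T powr (M + 1)" unfolding p3 using C3(1) by (intro mult_left_mono tT) auto
      finally show ?thesis .
    qed
    have "\<bar>oseen t i j z $ k - partial k (K i j) z\<bar>
      \<le> \<bar>- z $ j / (2 * t) * heat_kernel t z\<bar> + \<bar>smooth_DK t i j k z - smooth_DK 0 i j k z\<bar>"
      unfolding oseen_eq[OF d t(1)] partial_K[OF d z0(1)] add_diff_eq[symmetric] by (rule abs_if_add)
    also have "\<dots> \<le> heat_const TYPE('d) * (norm z * heat_weight (?d / 2 + 1) q t)
       + heat_const TYPE('d) * (norm z * \<bar>heat_tail (?d / 2 + 2) t q - heat_tail (?d / 2 + 2) 0 q\<bar>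
         + norm z ^ 3 * \<bar>heat_tail (?d / 2 + 3) t q - heat_tail (?d / 2 + 3) 0 q\<bar>)"
      unfolding q_def by (intro add_mono partial_heat_kernel_bound smooth_DK_diff_bound t)
    also have "\<dots> \<le> heat_const TYPE('d) * (C1 * ?p * T powr (M + 1)) + heat_const TYPE('d) * (C2 * ?p * T powr (M + 1) + C3 * ?p * T powr (M + 1))"
      using hc t1 t2 t3 by (intro add_mono mult_left_mono) auto
    also have "\<dots> = heat_const TYPE('d) * (C1 + C2 + C3) * T powr (M + 1) * ?p" by (simp add: algebra_simps)
    \<comment> \<open>The surplus factor |z|^{-2} is at most 4 because |z| \<ge> 1/2; this is the 4
      in C.\<close>
    also have "?p \<le> 4 * norm z powr (- (?d + 1 + N))"
    proof -
      have "- (?d + 3 + N) = - 2 + - (?d + 1 + N)" by simp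
      then have "?p = norm z powr (- 2) * norm z powr (- (?d + 1 + N))" by (simp only: powr_add)
      also have "norm z powr (- 2) \<le> (1 / 2) powr (- 2)" using z by (intro powr_mono2') auto
      also have "(1 / 2 :: real) powr (- 2) = 4" by (simp add: powr_minus power2_eq_square)
      finally show ?thesis by (simp add: mult_right_mono)
    qed
    finally show ?thesis
      using hc C1(1) C2(1) C3(1) by (simp add: C_def mult_left_mono mult.assoc)
  qed
  moreover have "C \<ge> 0" using hc C1(1) C2(1) C3(1) by (simp add: C_def)
  ultimately show ?thesis by blast
qed

text \<open>The exponents arise by trading the polynomial factors |z| and |z|^3 for powers of time:
  d/2 + 1 - 1/2 for the Gaussian term, d/2 + 2 - 1/2 and d/2 + 3 - 3/2 for the tails. The halved
  argument is the price of the trade. Scaling then gives an L^1 norm of order t^{-1/2}.\<close>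

definition oseen_majorant :: "real \<Rightarrow> real^'d::finite \<Rightarrow> real" where
  "oseen_majorant t z = heat_weight (real CARD('d) / 2 + 1 / 2) ((norm z)\<^sup>2 / 2) t
     + heat_tail (real CARD('d) / 2 + 3 / 2) t ((norm z)\<^sup>2 / 2)"

lemma oseen_majorant_nonneg: "0 \<le> oseen_majorant t z"
  by (simp add: oseen_majorant_def heat_weight_nonneg heat_tail_nonneg)

lemma oseen_component_bound:
  fixes i j k :: "'d::finite"
  assumes d: "CARD('d) \<ge> 2"
  shows "\<exists>C\<ge>0. \<forall>t>0. \<forall>z::real^'d. \<bar>oseen t i j z $ k\<bar> \<le> C * oseen_majorant t z"
proof -
  let ?d = "real CARD('d)"
  obtain C1 where C1: "C1 \<ge> 0" "\<And>s q. s > 0 \<Longrightarrow> q \<ge> 0 \<Longrightarrow>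
      q powr (1 / 2) * heat_weight (?d / 2 + 1) q s \<le> C1 * heat_weight (?d / 2 + 1 - 1 / 2) (q / 2) s"
    using heat_weight_power_bound[of "1 / 2" "?d / 2 + 1"] by auto
  obtain C2 where C2: "C2 \<ge> 0" "\<And>s q. s > 0 \<Longrightarrow> q \<ge> 0 \<Longrightarrow>
      q powr (1 / 2) * heat_tail (?d / 2 + 2) s q \<le> C2 * heat_tail (?d / 2 + 2 - 1 / 2) s (q / 2)"
    using heat_tail_power_bound[of "1 / 2" "?d / 2 + 2"] by auto
  obtain C3 where C3: "C3 \<ge> 0" "\<And>s q. s > 0 \<Longrightarrow> q \<ge> 0 \<Longrightarrow>
      q powr (3 / 2) * heat_tail (?d / 2 + 3) s q \<le> C3 * heat_tail (?d / 2 + 3 - 3 / 2) s (q / 2)"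
    using heat_tail_power_bound[of "3 / 2" "?d / 2 + 3"] by auto
  have e: "?d / 2 + 1 - 1 / 2 = ?d / 2 + 1 / 2" "?d / 2 + 2 - 1 / 2 = ?d / 2 + 3 / 2" "?d / 2 + 3 - 3 / 2 = ?d / 2 + 3 / 2" by auto
  define C where "C = heat_const TYPE('d) * (C1 + C2 + C3)"
  have hc: "heat_const TYPE('d) > 0" by (simp add: heat_const_def)
  have "\<bar>oseen t i j z $ k\<bar> \<le> C * oseen_majorant t z" if t: "t > 0" for t and z :: "real^'d"
  proof -
    define q where "q = (norm z)\<^sup>2"
    define w where "w = heat_weight (?d / 2 + 1 / 2) (q / 2) t"
    define h where "h = heat_tail (?d / 2 + 3 / 2) t (q / 2)"
    have wh: "w \<ge> 0" "h \<ge> 0" by (auto simp: w_def h_def heat_weight_nonneg heat_tail_nonneg)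
    have q: "q \<ge> 0" by (simp add: q_def)
    have n1: "norm z = q powr (1 / 2)" unfolding q_def by (rule norm_eq_power2_powr)
    have n3: "norm z ^ 3 = q powr (3 / 2)"
    proof (cases "z = 0")
      case False
      then show ?thesis by (simp add: q_def powr_powr flip: powr_numeral)
    qed (simp add: q_def)
    have "\<bar>oseen t i j z $ k\<bar> \<le> \<bar>- z $ j / (2 * t) * heat_kernel t z\<bar> + \<bar>smooth_DK t i j k z\<bar>"
      unfolding oseen_eq[OF d t(1)] by (rule abs_if_add)
    also have "\<dots> \<le> heat_const TYPE('d) * (norm z * heat_weight (?d / 2 + 1) q t)
       + heat_const TYPE('d) * (norm z * heat_tail (?d / 2 + 2) t q + norm z ^ 3 * heat_tail (?d / 2 + 3) t q)"
      unfolding q_def by (intro add_mono partial_heat_kernel_bound smooth_DK_bound t)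
    also have "\<dots> \<le> heat_const TYPE('d) * (C1 * w) + heat_const TYPE('d) * (C2 * h + C3 * h)"
      using C1(2)[OF t q] C2(2)[OF t q] C3(2)[OF t q] hc unfolding e n1[symmetric] n3[symmetric] w_def h_def
      by (intro add_mono mult_left_mono) auto
    also have "\<dots> \<le> C * (w + h)"
      using C1(1) C2(1) C3(1) hc wh unfolding C_def by (simp add: algebra_simps)
    finally show ?thesis by (simp add: oseen_majorant_def w_def h_def q_def)
  qed
  moreover have "C \<ge> 0" using hc C1(1) C2(1) C3(1) by (simp add: C_def)
  ultimately show ?thesis by blast
qed

lemma norm_vec_bound:
  fixes v :: "real^'d"
  assumes "\<And>k. \<bar>v $ k\<bar> \<le> c k"
  shows "norm v \<le> (\<Sum>k\<in>UNIV. c k)"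
  by (rule order_trans[OF norm_le_l1_cart sum_mono]) (rule assms)

lemma oseen_bound:
  assumes d: "CARD('d::finite) \<ge> 2"
  shows "\<exists>C\<ge>0. \<forall>i j. \<forall>t>0. \<forall>z::real^'d. norm (oseen t i j z) \<le> C * oseen_majorant t z"
proof -
  have "\<exists>C. \<forall>i j k. C i j k \<ge> 0 \<and> (\<forall>t>0. \<forall>z::real^'d. \<bar>oseen t i j z $ k\<bar> \<le> C i j k * oseen_majorant t z)"
    using oseen_component_bound[OF d] by metis
  then obtain C where C: "\<And>i j k. C i j k \<ge> 0" "\<And>i j k t (z::real^'d). t > 0 \<Longrightarrow> \<bar>oseen t i j z $ k\<bar> \<le> C i j k * oseen_majorant t z"
    by blast
  define D where "D = (\<Sum>i\<in>UNIV. \<Sum>j\<in>UNIV. \<Sum>k\<in>UNIV. C i j k)"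
  have "norm (oseen t i j z) \<le> D * oseen_majorant t z" if "t > 0" for t i j and z :: "real^'d"
  proof -
    have "norm (oseen t i j z) \<le> (\<Sum>k\<in>UNIV. C i j k * oseen_majorant t z)"
      using that by (intro norm_vec_bound C)
    also have "\<dots> = (\<Sum>k\<in>UNIV. C i j k) * oseen_majorant t z" by (simp add: sum_distrib_right)
    also have "(\<Sum>k\<in>UNIV. C i j k) \<le> (\<Sum>j\<in>UNIV. \<Sum>k\<in>UNIV. C i j k)"
      by (rule member_le_sum[of j UNIV "\<lambda>j. \<Sum>k\<in>UNIV. C i j k"]) (auto intro: sum_nonneg C)
    also have "\<dots> \<le> D"
      unfolding D_def by (rule member_le_sum[of i UNIV "\<lambda>i. \<Sum>j\<in>UNIV. \<Sum>k\<in>UNIV. C i j k"]) (auto intro: sum_nonneg C)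
    finally show ?thesis by (simp add: mult_right_mono oseen_majorant_nonneg)
  qed
  moreover have "D \<ge> 0" unfolding D_def by (intro sum_nonneg C)
  ultimately show ?thesis by blast
qed

section \<open>Continuity, integrability and boundedness of the Oseen kernel\<close>

lemma isCont_heat_tail: "b > 1 \<Longrightarrow> t > 0 \<Longrightarrow> isCont (heat_tail b t) q"
  by (rule DERIV_isCont[OF DERIV_heat_tail]) auto

lemma continuous_heat_tail_norm:
  assumes "b > 1" "t > 0"
  shows "continuous_on UNIV (\<lambda>z::real^'d. heat_tail b t ((norm z)\<^sup>2 * c))"
  by (rule continuous_on_compose2[where s = UNIV and t = UNIV and g = "heat_tail b t"])
     (use assms in \<open>auto intro!: continuous_intros continuous_at_imp_continuous_on isCont_heat_tail\<close>)

lemma continuous_on_oseen: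
  assumes d: "CARD('d) \<ge> 2" and t: "t > 0"
  shows "continuous_on UNIV (oseen t i j :: real^'d \<Rightarrow> real^'d)"
proof -
  have "oseen t i j = (\<lambda>z::real^'d. \<chi> k. (if k = i then - z $ j / (2 * t) * heat_kernel t z else 0) + smooth_DK t i j k z)"
    by (rule ext) (simp add: vec_eq_iff oseen_eq[OF d t])
  moreover have c: "continuous_on UNIV (\<lambda>z::real^'d. if P then z $ l else 0)" for P l
    by (cases P) (auto intro!: continuous_intros)
  have "continuous_on UNIV (\<lambda>z::real^'d. smooth_DK t i j k z)" for k
    using continuous_heat_tail_norm[of "real CARD('d) / 2 + 2" t 1, where 'd='d]
      continuous_heat_tail_norm[of "real CARD('d) / 2 + 3" t 1, where 'd='d] t
      c[of "k = i" j] c[of "k = j" i] c[of "i = j" k]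
    unfolding smooth_DK_def by (auto intro!: continuous_intros)
  moreover have "continuous_on UNIV (\<lambda>z::real^'d. if k = i then - z $ j / (2 * t) * heat_kernel t z else 0)" for k
    using t unfolding heat_kernel_def by (cases "k = i") (auto intro!: continuous_intros)
  ultimately show ?thesis by (auto intro!: continuous_on_vec_lambda continuous_on_add)
qed

lemma oseen_measurable: "CARD('d) \<ge> 2 \<Longrightarrow> t > 0 \<Longrightarrow> (oseen t i j :: real^'d \<Rightarrow> real^'d) \<in> borel_measurable borel"
  by (intro borel_measurable_continuous_onI continuous_on_oseen)

lemma continuous_on_oseen_time:
  fixes z :: "real^'d"
  assumes d: "CARD('d) \<ge> 2"
  shows "continuous_on {0<..} (\<lambda>t. oseen t i j z)"
proof -
  have h: "continuous_on {0<..} (\<lambda>t. heat_tail b t q)" if "b > 1" for b q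
    by (rule continuous_at_imp_continuous_on) (auto intro: isCont_heat_tail_left that)
  have "continuous_on {0<..} (\<lambda>t. smooth_DK t i j k z)" for k
    unfolding smooth_DK_def by (intro continuous_intros h) auto
  moreover have "continuous_on {0<..} (\<lambda>t. if k = i then - z $ j / (2 * t) * heat_kernel t z else 0)" for k
    unfolding heat_kernel_def by (cases "k = i") (auto intro!: continuous_intros)
  ultimately have "continuous_on {0<..} (\<lambda>t. \<chi> k. (if k = i then - z $ j / (2 * t) * heat_kernel t z else 0) + smooth_DK t i j k z)"
    by (intro continuous_on_vec_lambda continuous_on_add)
  then show ?thesis
    by (rule continuous_on_eq) (simp add: vec_eq_iff oseen_eq[OF d])
qed

lemma oseen_majorant_integral:
  "\<exists>C\<ge>0. \<forall>t>0. integrable lborel (oseen_majorant t :: real^'d::finite \<Rightarrow> real) \<and>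
     (LINT z|lborel. oseen_majorant t (z :: real^'d)) \<le> C * t powr (- 1 / 2)"
proof -
  let ?d = "real CARD('d)"
  \<comment> \<open>The halved argument makes the Gaussian e^{-|z|^2/(8t)}, with integral (8 pi
    t)^{d/2}. The second summand is the tail, with its factor 2 from integrating s^{-3/2}.\<close>
  define C where "C = (8 * pi) powr (?d / 2) + 2 * (8 * pi) powr (?d / 2)"
  have "integrable lborel (oseen_majorant t :: real^'d \<Rightarrow> real) \<and>
     (LINT z|lborel. oseen_majorant t (z :: real^'d)) \<le> C * t powr (- 1 / 2)" if t: "t > 0" for t
  proof -
    let ?w = "\<lambda>z::real^'d. heat_weight (?d / 2 + 1 / 2) ((norm z)\<^sup>2 / 2) t"
    let ?h = "\<lambda>z::real^'d. heat_tail (?d / 2 + 3 / 2) t ((norm z)\<^sup>2 / 2)"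
    have eq: "?w z = t powr (- (?d / 2 + 1 / 2)) * exp (- (1 / (8 * t)) * (norm z)\<^sup>2)" for z
      by (simp add: heat_weight_def)
    have a: "1 / (8 * t) > 0" using t by simp
    have iw: "integrable lborel ?w"
      unfolding eq by (intro integrable_mult_right gaussian_integrable a)
    have "(LINT z|lborel. ?w z) = t powr (- (?d / 2 + 1 / 2)) * (pi / (1 / (8 * t))) powr (?d / 2)"
      unfolding eq using gaussian_integral[OF a, where 'a="real^'d"] by simp
    also have "\<dots> = (8 * pi) powr (?d / 2) * (t powr (- (?d / 2 + 1 / 2)) * t powr (?d / 2))"
      using t by (simp add: powr_mult)
    also have "t powr (- (?d / 2 + 1 / 2)) * t powr (?d / 2) = t powr (- 1 / 2)" by (simp flip: powr_add)
    finally have lw: "(LINT z|lborel. ?w z) = (8 * pi) powr (?d / 2) * t powr (- 1 / 2)" .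
    have mh: "?h \<in> borel_measurable lborel"
      using borel_measurable_continuous_onI[OF continuous_heat_tail_norm[of "?d / 2 + 3 / 2" t "1 / 2", where 'd='d]] t by simp
    have nn: "(\<integral>\<^sup>+z. ennreal (?h z) \<partial>lborel) \<le> ennreal ((4 * pi / (1 / 2)) powr (?d / 2) * (2 * t powr (- 1 / 2)))"
      using nn_integral_heat_tail[OF t, of "1 / 2" "?d / 2 + 3 / 2", where 'a="real^'d"] by simp
    have ih: "integrable lborel ?h"
      using mh nn by (intro integrableI_nonneg) (auto simp: heat_tail_nonneg intro: le_less_trans)
    have "ennreal (LINT z|lborel. ?h z) \<le> ennreal ((4 * pi / (1 / 2)) powr (?d / 2) * (2 * t powr (- 1 / 2)))"
      using nn nn_integral_eq_integral[OF ih] by (simp add: heat_tail_nonneg)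
    then have lh: "(LINT z|lborel. ?h z) \<le> 2 * (8 * pi) powr (?d / 2) * t powr (- 1 / 2)"
      by (simp add: ennreal_le_iff mult_ac)
    show ?thesis
      unfolding oseen_majorant_def[abs_def] using iw ih lw lh by (simp add: C_def algebra_simps)
  qed
  moreover have "C \<ge> 0" by (simp add: C_def)
  ultimately show ?thesis by blast
qed

text \<open>Supplies the dominating constant when the kernel time stays away from 0, for
  integrability in y and for continuity in time.\<close>

lemma oseen_majorant_bounded:
  assumes t0: "t0 > 0"
  shows "\<exists>C\<ge>0. \<forall>t\<ge>t0. \<forall>z::real^'d::finite. oseen_majorant t z \<le> C"
proof -
  let ?d = "real CARD('d)"
  define C where "C = t0 powr (- (?d / 2 + 1 / 2)) + heat_tail (?d / 2 + 3 / 2) t0 0"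
  have b: "?d / 2 + 3 / 2 > 1" by (simp add: add_pos_pos)
  have "oseen_majorant t z \<le> C" if t: "t \<ge> t0" for t and z :: "real^'d"
  proof -
    have "heat_weight (?d / 2 + 1 / 2) ((norm z)\<^sup>2 / 2) t \<le> t powr (- (?d / 2 + 1 / 2))"
      using t t0 unfolding heat_weight_def by (intro mult_left_le) auto
    also have "\<dots> \<le> t0 powr (- (?d / 2 + 1 / 2))"
      using t t0 by (intro powr_mono2') (auto simp: add_nonneg_nonneg)
    finally have 1: "heat_weight (?d / 2 + 1 / 2) ((norm z)\<^sup>2 / 2) t \<le> t0 powr (- (?d / 2 + 1 / 2))" .
    have "heat_tail (?d / 2 + 3 / 2) t ((norm z)\<^sup>2 / 2) \<le> (LINT s:{t<..}|lborel. heat_weight (?d / 2 + 3 / 2) 0 s)"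
      unfolding heat_tail_def
    proof (intro set_integral_mono set_integrable_heat_weight b)
      fix s assume "s \<in> {t<..}"
      then show "heat_weight (?d / 2 + 3 / 2) ((norm z)\<^sup>2 / 2) s \<le> heat_weight (?d / 2 + 3 / 2) 0 s"
        using t t0 unfolding heat_weight_def by (intro mult_left_mono) auto
    qed (use t t0 in auto)
    also have "\<dots> \<le> heat_tail (?d / 2 + 3 / 2) t0 0"
      unfolding heat_tail_def set_lebesgue_integral_def
      using set_integrable_heat_weight[OF t0 b, of 0] set_integrable_heat_weight[of t, OF _ b, of 0] t t0
      by (intro integral_mono) (auto simp: set_integrable_def heat_weight_nonneg split: split_indicator)
    finally show ?thesis using 1 by (simp add: oseen_majorant_def C_def)
  qed
  moreover have "C \<ge> 0" by (simp add: C_def heat_tail_nonneg)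
  ultimately show ?thesis by blast
qed

text \<open>The Taylor polynomial of order N at x, with increment -y, of the gradient of K i j.
  Integrated against u_i u_j it produces the moments with the signs of the theorem.\<close>

definition kernel_poly :: "nat \<Rightarrow> 'd \<Rightarrow> 'd \<Rightarrow> real^'d::finite \<Rightarrow> real^'d \<Rightarrow> real^'d" where
  "kernel_poly N i j x y = (\<Sum>\<alpha> | mi_abs \<alpha> \<le> N.
     ((- 1) ^ mi_abs \<alpha> / mi_fact \<alpha> * mi_power y \<alpha>) *\<^sub>R grad (mi_partial \<alpha> (K i j)) x)"

lemma kernel_poly_component:
  fixes x :: "real^'d"
  assumes d: "CARD('d) \<ge> 2" and x: "x \<noteq> 0"
  shows "kernel_poly N i j x y $ k = taylor_poly (partial k (K i j)) (- y) N x"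
  unfolding kernel_poly_def taylor_poly_def
  by (simp add: grad_def mi_partial_commute[OF homog_K[OF d] x] mi_power_minus mult_ac)

text \<open>The weight (1 + |y|)^{-2p}, which is the decay of u_i u_j, is kept on the left because
  near y = x the kernel has no decay and the weight must provide the power of |x|. The two summands
  on the right are integrable in y, the first since 2p - N > d, the second by the L^1 bound.\<close>

lemma kernel_estimate_component:
  fixes p T :: real and i j k :: "'d::finite"
  assumes d: "CARD('d) \<ge> 2" and p: "real N < 2 * p - real CARD('d) - 1"
  shows "\<exists>C\<ge>0. \<forall>t. 0 < t \<longrightarrow> t \<le> T \<longrightarrow> (\<forall>x y :: real^'d. norm x \<ge> 1 \<longrightarrow>
    (1 + norm y) powr (- 2 * p) * \<bar>oseen t i j (x - y) $ k - kernel_poly N i j x y $ k\<bar>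
      \<le> C * norm x powr (- real CARD('d) - real N - 1) * ((1 + norm y) powr (real N - 2 * p) + oseen_majorant t (x - y)))"
proof -
  define E where "E = - real CARD('d) - real N - 1"
  define r where "r = - (real CARD('d) + 1)"
  have E: "E \<le> 0" "r \<le> 0" "r - real N = E" "- 2 * p \<le> E" "- (real CARD('d) + 1 + real N) = E"
    using p by (auto simp: E_def r_def)
  note hK = homog_partial_K[OF d, of k i j, folded r_def]
  obtain C1 where C1: "C1 \<ge> 0" "\<And>t z. 0 < t \<Longrightarrow> t \<le> T \<Longrightarrow> norm z \<ge> 1 / 2 \<Longrightarrow>
     \<bar>oseen t i j z $ k - partial k (K i j) z\<bar> \<le> C1 * norm z powr E"
    using oseen_partial_K_diff[OF d of_nat_0_le_iff, of T i j k N] unfolding E(5) by blast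
  obtain C2 where C2: "C2 \<ge> 0" "\<And>x y. x \<noteq> 0 \<Longrightarrow> norm y \<le> norm x / 2 \<Longrightarrow>
     \<bar>partial k (K i j) (x + y) - taylor_poly (partial k (K i j)) y N x\<bar> \<le> C2 * norm y ^ N * norm x powr E"
    using taylor_remainder_bound[OF hK E(2), of N] unfolding E(3) by blast
  obtain C3 where C3: "C3 \<ge> 0" "\<And>x y. x \<noteq> 0 \<Longrightarrow> norm x / 2 \<le> norm y \<Longrightarrow>
     \<bar>taylor_poly (partial k (K i j)) y N x\<bar> \<le> C3 * norm y ^ N * norm x powr E"
    using taylor_poly_bound[OF hK, of N] unfolding E(3) by blast
  obtain C4 where C4: "C4 \<ge> 0" "\<And>x. x \<noteq> 0 \<Longrightarrow> \<bar>partial k (K i j) x\<bar> \<le> C4 * norm x powr r"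
    using homog_bound[OF hK] by blast
  obtain C5 where C5: "C5 \<ge> 0" "\<And>t z. t > 0 \<Longrightarrow> \<bar>oseen t i j z $ k\<bar> \<le> C5 * oseen_majorant t z"
    using oseen_component_bound[OF d, of i j k] by blast
  define A where "A = C1 * (1 / 2) powr E + C2 + C3 + C4 * (1 / 2) powr r * 2 ^ N"
  have A: "A \<ge> 0" unfolding A_def using C1(1) C2(1) C3(1) C4(1) by auto
  define B where "B = C5 * (1 / 2) powr (- 2 * p)"
  have B: "B \<ge> 0" unfolding B_def using C5(1) by auto
  have "(1 + norm y) powr (- 2 * p) * \<bar>oseen t i j (x - y) $ k - kernel_poly N i j x y $ k\<bar>
      \<le> (A + B) * norm x powr E * ((1 + norm y) powr (real N - 2 * p) + oseen_majorant t (x - y))"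
    if t: "0 < t" "t \<le> T" and x: "norm x \<ge> 1" for t and x y :: "real^'d"
  proof -
    define X where "X = norm x powr E"
    define Y where "Y = (1 + norm y) ^ N"
    define P where "P = (1 + norm y) powr (- 2 * p)"
    define Q where "Q = oseen_majorant t (x - y)"
    have nn: "X \<ge> 0" "Y \<ge> 1" "P \<ge> 0" "Q \<ge> 0" by (auto simp: X_def Y_def P_def Q_def oseen_majorant_nonneg)
    have x0: "x \<noteq> 0" using x by auto
    have yY: "norm y ^ N \<le> Y" unfolding Y_def by (intro power_mono) auto
    have PY: "P * Y = (1 + norm y) powr (real N - 2 * p)"
      unfolding P_def Y_def by (subst powr_realpow[symmetric]) (auto simp: add_pos_nonneg algebra_simps simp flip: powr_add)
    have half: "norm z powr e \<le> (1 / 2) powr e * norm x powr e" if "norm x / 2 \<le> norm z" "e \<le> 0" for z :: "real^'d" and e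
    proof -
      have "norm z powr e \<le> (norm x / 2) powr e" using that x by (intro powr_mono2') auto
      also have "\<dots> = (1 / 2 * norm x) powr e" by simp
      also have "\<dots> = (1 / 2) powr e * norm x powr e" by (rule powr_mult)
      finally show ?thesis .
    qed
    let ?o = "oseen t i j (x - y) $ k" and ?K = "partial k (K i j) (x - y)" and ?t = "taylor_poly (partial k (K i j)) (- y) N x"
    have "P * \<bar>?o - ?t\<bar> \<le> (A + B) * X * (P * Y + Q)"
    \<comment> \<open>Away from the singularity the Oseen kernel is first replaced by the derivative
      of K, which is then compared with its Taylor polynomial or, for large y, bounded separately
      from it.\<close>
    proof (cases "norm x / 2 \<le> norm (x - y)")
      case True
      then have z: "norm (x - y) \<ge> 1 / 2" "x - y \<noteq> 0" using x by auto
      have "\<bar>?o - ?K\<bar> \<le> C1 * norm (x - y) powr E" by (rule C1(2)[OF t z(1)])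
      also have "\<dots> \<le> C1 * ((1 / 2) powr E * X)" unfolding X_def using C1(1) E True by (intro mult_left_mono half) auto
      also have "\<dots> \<le> C1 * (1 / 2) powr E * (X * Y)"
      proof -
        have "C1 * (1 / 2) powr E * (X * 1) \<le> C1 * (1 / 2) powr E * (X * Y)" using nn C1(1) by (intro mult_left_mono) auto
        then show ?thesis by simp
      qed
      finally have oK: "\<bar>?o - ?K\<bar> \<le> C1 * (1 / 2) powr E * (X * Y)" .
      have "\<bar>?o - ?t\<bar> \<le> A * (X * Y)"
      proof (cases "norm y \<le> norm x / 2")
        case True
        then have "\<bar>?K - ?t\<bar> \<le> C2 * norm y ^ N * X"
          using C2(2)[OF x0, of "- y"] by (simp add: X_def)
        also have "\<dots> \<le> C2 * Y * X" using yY C2(1) nn by (intro mult_right_mono mult_left_mono) auto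
        finally have "\<bar>?o - ?t\<bar> \<le> (C1 * (1 / 2) powr E + C2) * (X * Y)" using oK by (simp add: algebra_simps)
        also have "\<dots> \<le> A * (X * Y)" using nn C3(1) C4(1) unfolding A_def by (intro mult_right_mono) auto
        finally show ?thesis .
      next
        case False
        have "\<bar>?t\<bar> \<le> C3 * norm y ^ N * X"
          using C3(2)[OF x0, of "- y"] False by (simp add: X_def)
        also have "\<dots> \<le> C3 * Y * X" using yY C3(1) nn by (intro mult_right_mono mult_left_mono) auto
        finally have tb: "\<bar>?t\<bar> \<le> C3 * (X * Y)" by (simp add: mult_ac)
        have "\<bar>?K\<bar> \<le> C4 * norm (x - y) powr r" by (rule C4(2)[OF z(2)])
        also have "\<dots> \<le> C4 * ((1 / 2) powr r * norm x powr r)"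
          using C4(1) E True by (intro mult_left_mono half) auto
        \<comment> \<open>The decay |x|^r alone falls short of the claimed rate by |x|^N, which is
          moved onto y since |x| < 2|y| here.\<close>
        also have "norm x powr r = norm x ^ N * X"
        proof -
          have "norm x ^ N = norm x powr real N" using x by (subst powr_realpow) auto
          moreover have "r = real N + E" using E(3) by simp
          ultimately show ?thesis unfolding X_def by (simp only: powr_add)
        qed
        also have "C4 * ((1 / 2) powr r * (norm x ^ N * X)) \<le> C4 * ((1 / 2) powr r * ((2 * (1 + norm y)) ^ N * X))"
          using False C4(1) nn by (intro mult_left_mono mult_right_mono power_mono) auto
        also have "\<dots> = C4 * (1 / 2) powr r * 2 ^ N * (X * Y)" by (simp only: Y_def power_mult_distrib mult_ac)
        finally have "\<bar>?K\<bar> \<le> C4 * (1 / 2) powr r * 2 ^ N * (X * Y)" .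
        with oK tb have "\<bar>?o - ?t\<bar> \<le> (C1 * (1 / 2) powr E + C3 + C4 * (1 / 2) powr r * 2 ^ N) * (X * Y)"
          unfolding distrib_right by linarith
        also have "\<dots> \<le> A * (X * Y)" using nn C2(1) unfolding A_def by (intro mult_right_mono) auto
        finally show ?thesis .
      qed
      then have "P * \<bar>?o - ?t\<bar> \<le> P * (A * (X * Y))" using nn by (intro mult_left_mono) auto
      also have "\<dots> = A * X * (P * Y)" by simp
      also have "\<dots> \<le> (A + B) * X * (P * Y + Q)"
        using nn A B by (intro mult_mono) auto
      finally show ?thesis .
    next
      case False
      have yx: "norm x / 2 \<le> norm y"
        using False norm_triangle_ineq[of "x - y" y] by simp
      have "\<bar>?t\<bar> \<le> C3 * norm y ^ N * X"
        using C3(2)[OF x0, of "- y"] yx by (simp add: X_def)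
      also have "\<dots> \<le> C3 * Y * X" using yY C3(1) nn by (intro mult_right_mono mult_left_mono) auto
      also have "\<dots> \<le> A * (X * Y)"
      proof -
        have "C3 \<le> A" using C1(1) C2(1) C4(1) by (simp add: A_def)
        then have "C3 * (X * Y) \<le> A * (X * Y)" using nn by (intro mult_right_mono) auto
        then show ?thesis by (simp add: mult_ac)
      qed
      finally have tb: "\<bar>?t\<bar> \<le> A * (X * Y)" .
      \<comment> \<open>Here |y| \<ge> |x|/2, so the weight alone decays like |x|^{-2p}. This
        contribution belongs to the second remainder and is absorbed into the first, as -2p \<le> -d
        - N - 1 and |x| \<ge> 1.\<close>
      have "P \<le> (1 / 2) powr (- 2 * p) * X"
      proof -
        have "P \<le> (norm x / 2) powr (- 2 * p)"
          unfolding P_def using yx x E by (intro powr_mono2') auto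
        also have "\<dots> = (1 / 2 * norm x) powr (- 2 * p)" by simp
        also have "\<dots> = (1 / 2) powr (- 2 * p) * norm x powr (- 2 * p)" by (rule powr_mult)
        also have "\<dots> \<le> (1 / 2) powr (- 2 * p) * X"
          unfolding X_def using x E by (intro mult_left_mono powr_mono) auto
        finally show ?thesis .
      qed
      then have "P * \<bar>?o\<bar> \<le> ((1 / 2) powr (- 2 * p) * X) * (C5 * Q)"
        unfolding Q_def using C5(2)[OF t(1), of "x - y"] nn by (intro mult_mono) auto
      then have "P * \<bar>?o\<bar> \<le> B * X * Q" by (simp add: B_def mult_ac)
      moreover have "P * \<bar>?t\<bar> \<le> A * X * (P * Y)" using mult_left_mono[OF tb nn(3)] by (simp add: mult_ac)
      moreover have "P * \<bar>?o - ?t\<bar> \<le> P * \<bar>?o\<bar> + P * \<bar>?t\<bar>"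
        using nn(3) by (simp add: mult_left_mono flip: distrib_left)
      moreover have "B * X * Q + A * X * (P * Y) \<le> (A + B) * X * (P * Y + Q)"
      proof -
        have "0 \<le> A * X * Q" "0 \<le> B * X * (P * Y)" using A B nn by auto
        then show ?thesis by (simp add: algebra_simps)
      qed
      ultimately show ?thesis by linarith
    qed
    then show ?thesis
      unfolding kernel_poly_component[OF d x0] P_def[symmetric] PY[symmetric] X_def Q_def .
  qed
  then show ?thesis unfolding E_def[symmetric] using A B by (intro exI[of _ "A + B"]) auto
qed

lemma kernel_estimate:
  fixes p T :: real
  assumes d: "CARD('d::finite) \<ge> 2" and p: "real N < 2 * p - real CARD('d) - 1"
  obtains C where "C \<ge> 0" "\<And>i j t (x :: real^'d) y. 0 < t \<Longrightarrow> t \<le> T \<Longrightarrow> norm x \<ge> 1 \<Longrightarrow>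
    (1 + norm y) powr (- 2 * p) * norm (oseen t i j (x - y) - kernel_poly N i j x y)
      \<le> C * norm x powr (- real CARD('d) - real N - 1) * ((1 + norm y) powr (real N - 2 * p) + oseen_majorant t (x - y))"
proof -
  let ?R = "\<lambda>t (x :: real^'d) y. norm x powr (- real CARD('d) - real N - 1) * ((1 + norm y) powr (real N - 2 * p) + oseen_majorant t (x - y))"
  let ?P = "\<lambda>y :: real^'d. (1 + norm y) powr (- 2 * p)"
  have "\<exists>C. \<forall>i j k. C i j k \<ge> 0 \<and> (\<forall>t. 0 < t \<longrightarrow> t \<le> T \<longrightarrow> (\<forall>x y :: real^'d. norm x \<ge> 1 \<longrightarrow>
    ?P y * \<bar>oseen t i j (x - y) $ k - kernel_poly N i j x y $ k\<bar> \<le> C i j k * ?R t x y))"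
    using kernel_estimate_component[OF d p, of T] unfolding mult.assoc by metis
  then obtain C where C: "\<And>i j k. C i j k \<ge> 0" "\<And>i j k t (x :: real^'d) y. 0 < t \<Longrightarrow> t \<le> T \<Longrightarrow> norm x \<ge> 1 \<Longrightarrow>
    ?P y * \<bar>oseen t i j (x - y) $ k - kernel_poly N i j x y $ k\<bar> \<le> C i j k * ?R t x y"
    by blast
  define D where "D = (\<Sum>i\<in>UNIV. \<Sum>j\<in>UNIV. \<Sum>k\<in>UNIV. C i j k)"
  have "?P y * norm (oseen t i j (x - y) - kernel_poly N i j x y) \<le> D * ?R t x y"
    if t: "0 < t" "t \<le> T" "norm x \<ge> 1" for i j t and x y :: "real^'d"
  proof -
    have R: "?R t x y \<ge> 0" by (intro mult_nonneg_nonneg add_nonneg_nonneg) (auto simp: oseen_majorant_nonneg)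
    have "?P y * norm (oseen t i j (x - y) - kernel_poly N i j x y) = norm (?P y *\<^sub>R (oseen t i j (x - y) - kernel_poly N i j x y))"
      by simp
    also have "\<dots> \<le> (\<Sum>k\<in>UNIV. C i j k * ?R t x y)"
      using C(2)[OF t] by (intro norm_vec_bound) (simp add: abs_mult)
    also have "\<dots> = (\<Sum>k\<in>UNIV. C i j k) * ?R t x y" by (simp only: sum_distrib_right)
    also have "(\<Sum>k\<in>UNIV. C i j k) \<le> (\<Sum>j\<in>UNIV. \<Sum>k\<in>UNIV. C i j k)"
      by (rule member_le_sum[of j UNIV "\<lambda>j. \<Sum>k\<in>UNIV. C i j k"]) (auto intro: sum_nonneg C)
    also have "\<dots> \<le> D"
      unfolding D_def by (rule member_le_sum[of i UNIV "\<lambda>i. \<Sum>j\<in>UNIV. \<Sum>k\<in>UNIV. C i j k"]) (auto intro: sum_nonneg C)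
    finally show ?thesis using R by (simp add: mult_right_mono)
  qed
  moreover have "D \<ge> 0" unfolding D_def by (intro sum_nonneg C)
  ultimately show ?thesis using that[of D] by (simp only: mult.assoc)
qed

text \<open>Convergence is demanded along each sequence separately, so the exceptional null set may
  depend on the sequence. Continuity in L^infinity provides no more than that.\<close>

lemma continuous_on_parametric_integral:
  fixes f :: "'a::metric_space \<Rightarrow> 'b \<Rightarrow> 'c::{banach, second_countable_topology}"
  assumes meas: "\<And>s. s \<in> S \<Longrightarrow> f s \<in> borel_measurable M"
    and bound: "\<And>s y. s \<in> S \<Longrightarrow> norm (f s y) \<le> B y" and B: "integrable M B"
    and conv: "\<And>X s. s \<in> S \<Longrightarrow> (\<And>n. X n \<in> S - {s}) \<Longrightarrow> X \<longlonglongrightarrow> s \<Longrightarrow> AE y in M. (\<lambda>n. f (X n) y) \<longlonglongrightarrow> f s y"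
  shows "continuous_on S (\<lambda>s. integral\<^sup>L M (f s))"
  unfolding continuous_on_def
proof (intro ballI, subst tendsto_at_iff_sequentially, intro allI impI)
  fix s X assume s: "s \<in> S" and X: "\<forall>n. X n \<in> S - {s}" "X \<longlonglongrightarrow> s"
  show "((\<lambda>s. integral\<^sup>L M (f s)) \<circ> X) \<longlonglongrightarrow> integral\<^sup>L M (f s)"
    unfolding o_def
    by (rule integral_dominated_convergence[OF _ _ B]) (use s X meas bound conv in auto)
qed

text \<open>The essential supremum bounds the difference off a null set for each n; a sequence has
  only countably many members, so one null set serves them all.\<close>

lemma AE_tendsto_of_Linf:
  fixes u :: "real \<Rightarrow> real^'d \<Rightarrow> real^'d"
  assumes c: "continuous_Linf I u" and s: "s \<in> I" and X: "\<And>n. X n \<in> I - {s}" "X \<longlonglongrightarrow> s"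
  shows "AE y in lebesgue. (\<lambda>n. u (X n) y) \<longlonglongrightarrow> u s y"
proof -
  let ?e = "\<lambda>r. Linf_norm (\<lambda>x. u r x - u s x)"
  have "(?e \<longlongrightarrow> 0) (at s within I)" using c s by (simp add: continuous_Linf_def)
  then have e: "(\<lambda>n. ?e (X n)) \<longlonglongrightarrow> 0"
    using X unfolding tendsto_at_iff_sequentially o_def by blast
  have "AE y in lebesgue. \<forall>n. ereal (norm (u (X n) y - u s y)) \<le> ?e (X n)"
    unfolding AE_all_countable Linf_norm_def by (intro allI esssup_AE)
  then show ?thesis
  proof eventually_elim
    case (elim y)
    have "(\<lambda>n. ereal (norm (u (X n) y - u s y))) \<longlonglongrightarrow> ereal 0"
      unfolding zero_ereal_def[symmetric]
      by (rule tendsto_sandwich[OF _ _ tendsto_const e]) (use elim in auto)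
    then have "(\<lambda>n. norm (u (X n) y - u s y)) \<longlonglongrightarrow> 0" by simp
    then show ?case by (simp add: tendsto_norm_zero_iff LIM_zero_iff)
  qed
qed

text \<open>Turns an almost everywhere bound between continuous functions into a pointwise one: the
  set where it fails is open.\<close>

lemma open_AE_empty:
  assumes "open (S :: 'a::euclidean_space set)" "AE x in lebesgue. x \<notin> S"
  shows "S = {}"
proof (rule ccontr)
  assume "S \<noteq> {}"
  then have "\<not> negligible S" using assms(1) open_not_negligible by blast
  moreover have "S \<in> null_sets lebesgue"
    using assms by (subst AE_iff_null_sets) auto
  ultimately show False by (simp add: negligible_iff_null_sets)
qed

lemma continuous_on_heat_flow:
  fixes f :: "real^'d \<Rightarrow> real^'d"
  assumes t: "t > 0" and f: "f \<in> borel_measurable lebesgue" and bound: "\<And>y. norm (f y) \<le> B"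
  shows "continuous_on UNIV (heat_flow t f)"
proof -
  have B: "B \<ge> 0" using bound[of 0] norm_ge_zero[of "f 0"] by linarith
  define c where "c = (4 * pi * t) powr (- real CARD('d) / 2)"
  have hk: "heat_kernel t z = c * exp (- (norm z)\<^sup>2 / (4 * t))" for z :: "real^'d"
    by (simp add: heat_kernel_def c_def)
  have c: "c \<ge> 0" by (simp add: c_def)
  have [measurable]: "(\<lambda>y. heat_kernel t (x - y)) \<in> borel_measurable lebesgue" for x :: "real^'d"
    by (rule measurable_completion) (simp add: hk)
  have ball: "continuous_on (cball x0 1) (\<lambda>x. LINT y|lebesgue. heat_kernel t (x - y) *\<^sub>R f y)" for x0
  proof (rule continuous_on_parametric_integral)
    show "(\<lambda>y. heat_kernel t (x - y) *\<^sub>R f y) \<in> borel_measurable lebesgue" for x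
      using f by (intro borel_measurable_scaleR) auto
    \<comment> \<open>One Gaussian of half the rate dominates all translates with centre in the unit
      ball, since |x0 - y|^2 \<le> 2|x - y|^2 + 2.\<close>
    let ?B = "\<lambda>y. c * exp (1 / (4 * t)) * B * exp (- (1 / (8 * t)) * (norm (x0 - y))\<^sup>2)"
    have "integrable lborel (\<lambda>y. (\<lambda>z. c * exp (1 / (4 * t)) * B * exp (- (1 / (8 * t)) * (norm z)\<^sup>2)) (x0 - y))"
      using t by (subst lborel_integral_reflect(2)) (auto intro!: integrable_mult_right gaussian_integrable[of "1 / (8 * t)", simplified])
    then show "integrable lebesgue ?B" by (subst integrable_completion) auto
    show "norm (heat_kernel t (x - y) *\<^sub>R f y) \<le> ?B y" if "x \<in> cball x0 1" for x y
    proof -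
      have "norm (x0 - y) \<le> norm (x - y) + norm (x0 - x)" using norm_triangle_ineq[of "x - y" "x0 - x"] by simp
      also have "\<dots> \<le> norm (x - y) + 1" using that by (simp add: dist_norm)
      finally have "(norm (x0 - y))\<^sup>2 \<le> (norm (x - y) + 1)\<^sup>2" by (intro power_mono) auto
      also have "\<dots> \<le> 2 * (norm (x - y))\<^sup>2 + 2"
        using zero_le_power2[of "norm (x - y) - 1"] by (simp add: power2_eq_square algebra_simps)
      finally have "(norm (x0 - y))\<^sup>2 / (8 * t) \<le> (2 * (norm (x - y))\<^sup>2 + 2) / (8 * t)"
        using t by (intro divide_right_mono) auto
      then have "- (norm (x - y))\<^sup>2 / (4 * t) \<le> 1 / (4 * t) + - (1 / (8 * t)) * (norm (x0 - y))\<^sup>2"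
        using t by (simp add: add_divide_distrib)
      then have "exp (- (norm (x - y))\<^sup>2 / (4 * t)) \<le> exp (1 / (4 * t)) * exp (- (1 / (8 * t)) * (norm (x0 - y))\<^sup>2)"
        by (simp only: mult_exp_exp exp_le_cancel_iff)
      then have "c * exp (- (norm (x - y))\<^sup>2 / (4 * t)) * norm (f y) \<le> c * (exp (1 / (4 * t)) * exp (- (1 / (8 * t)) * (norm (x0 - y))\<^sup>2)) * B"
        using c B bound by (intro mult_mono mult_left_mono) auto
      then show ?thesis using c by (simp add: hk mult_ac)
    qed
    show "AE y in lebesgue. (\<lambda>n. heat_kernel t (X n - y) *\<^sub>R f y) \<longlonglongrightarrow> heat_kernel t (x - y) *\<^sub>R f y"
      if "X \<longlonglongrightarrow> x" for X x
      unfolding hk using that t by (auto intro!: tendsto_intros)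
  qed
  have "isCont (\<lambda>x. LINT y|lebesgue. heat_kernel t (x - y) *\<^sub>R f y) x" for x
    by (rule continuous_on_interior[OF ball[of x]]) simp
  then have "continuous_on UNIV (\<lambda>x. LINT y|lebesgue. heat_kernel t (x - y) *\<^sub>R f y)"
    by (simp add: continuous_at_imp_continuous_on)
  then show ?thesis using t by (simp add: heat_flow_def[abs_def])
qed

lemma powr_minus_half_integral:
  assumes t: "t > (0::real)"
  shows "integrable lborel (\<lambda>s. indicator {0..<t} s * (t - s) powr (- 1 / 2))"
    and "(LINT s|lborel. indicator {0..<t} s * (t - s) powr (- 1 / 2)) = 2 * t powr (1 / 2)"
proof -
  have hi: "((\<lambda>s. s powr (- 1 / 2)) has_integral 2 * t powr (1 / 2)) {0..t}"
    using has_integral_powr_from_0[of "- 1 / 2" t] t by (simp add: mult.commute)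
  have "(\<integral>\<^sup>+s. ennreal (indicator {0..t} s * s powr (- 1 / 2)) \<partial>lborel) = ennreal (2 * t powr (1 / 2))"
    using nn_integral_has_integral_lebesgue[OF _ hi] by simp
  then have h: "has_bochner_integral lborel (\<lambda>s. indicator {0..t} s * s powr (- 1 / 2)) (2 * t powr (1 / 2))"
    by (intro has_bochner_integral_nn_integral) auto
  \<comment> \<open>The intervals differ at s = t, but there the right side contains
    \<open>0 powr (- 1 / 2)\<close>, which is 0.\<close>
  have "indicator {0..<t} s * (t - s) powr (- 1 / 2) = (\<lambda>s. indicator {0..t} s * s powr (- 1 / 2)) (t - s)" for s
    by (auto split: split_indicator)
  then have eq: "(\<lambda>s. indicator {0..<t} s * (t - s) powr (- 1 / 2)) = (\<lambda>s. (\<lambda>s. indicator {0..t} s * s powr (- 1 / 2)) (t - s))"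
    by (rule ext)
  show "integrable lborel (\<lambda>s. indicator {0..<t} s * (t - s) powr (- 1 / 2))"
    unfolding eq using h by (subst lborel_integral_reflect(2)) (auto simp: has_bochner_integral_iff)
  show "(LINT s|lborel. indicator {0..<t} s * (t - s) powr (- 1 / 2)) = 2 * t powr (1 / 2)"
    unfolding eq using h by (subst lborel_integral_reflect(1)) (auto simp: has_bochner_integral_iff)
qed

section \<open>The expansion of the nonlinear term\<close>

lemma integrable_bracket_powr_lebesgue:
  assumes "e < - real CARD('d::finite)"
  shows "integrable lebesgue (\<lambda>y::real^'d. (1 + norm y) powr e)"
  using integrable_bracket_powr[of "- e", where 'a="real^'d"] assms by (subst integrable_completion) auto

lemma product_decay:
  fixes v :: "real^'d"
  assumes v: "norm v \<le> H * (1 + norm y) powr (- p)"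
  shows "\<bar>v $ i * v $ j\<bar> \<le> H\<^sup>2 * (1 + norm (y :: real^'d)) powr (- 2 * p)"
proof -
  have "\<bar>v $ i * v $ j\<bar> \<le> norm v * norm v"
    unfolding abs_mult by (intro mult_mono component_le_norm_cart) auto
  also have "\<dots> \<le> (H * (1 + norm y) powr (- p)) * (H * (1 + norm y) powr (- p))"
    by (intro mult_mono v order_trans[OF norm_ge_zero v]) auto
  also have "\<dots> = H\<^sup>2 * ((1 + norm y) powr (- p) * (1 + norm y) powr (- p))"
    by (simp add: power2_eq_square)
  also have "(1 + norm y) powr (- p) * (1 + norm y) powr (- p) = (1 + norm y) powr (- 2 * p)"
    by (simp flip: powr_add)
  finally show ?thesis .
qed

definition moment_sum ::
  "nat \<Rightarrow> (real \<Rightarrow> real^'d::finite \<Rightarrow> real^'d) \<Rightarrow> real \<Rightarrow> real^'d \<Rightarrow> real^'d" where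
  "moment_sum N u t x = (\<Sum>\<alpha> | mi_abs \<alpha> \<le> N. ((- 1) ^ mi_abs \<alpha> / mi_fact \<alpha>) *\<^sub>R
     (\<Sum>i\<in>UNIV. \<Sum>j\<in>UNIV. (LINT s:{0..t}|lebesgue. moment u \<alpha> i j s) *\<^sub>R grad (mi_partial \<alpha> (K i j)) x))"

text \<open>The moment sum is the nonlinear term with the Oseen kernel replaced by its Taylor
  polynomial. The kernel error is O((t - s)^{-1/2}) in time, hence integrable up to s = t, which
  makes the constant uniform for t \<le> T.\<close>

lemma nonlinear_expansion:
  fixes u :: "real \<Rightarrow> real^'d::finite \<Rightarrow> real^'d" and \<nu> p T H :: real
  assumes d: "CARD('d) \<ge> 2" and \<nu>: "\<nu> > 0" and p: "real N < 2 * p - real CARD('d) - 1"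
    and cont: "continuous_Linf I u" and sub: "{0..T} \<subseteq> I"
    and bound: "\<And>s y. s \<in> {0..T} \<Longrightarrow> norm (u s y) \<le> H * (1 + norm y) powr (- p)"
  obtains C where "C \<ge> 0" "\<And>t x. 0 < t \<Longrightarrow> t \<le> T \<Longrightarrow> norm x \<ge> 1 \<Longrightarrow>
    norm (moment_sum N u t x - (LINT s:{0..t}|lebesgue. heat_leray_div (\<nu> * (t - s)) (\<lambda>y. outer (u s y) (u s y)) x))
    \<le> C * norm x powr (- real CARD('d) - real N - 1)"
proof -
  let ?d = "real CARD('d)"
  define W where "W i j s y = u s y $ i * u s y $ j" for i j s y
  obtain CE where CE: "CE \<ge> 0" "\<And>i j t (x :: real^'d) y. 0 < t \<Longrightarrow> t \<le> \<nu> * T \<Longrightarrow> norm x \<ge> 1 \<Longrightarrow>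
    (1 + norm y) powr (- 2 * p) * norm (oseen t i j (x - y) - kernel_poly N i j x y)
      \<le> CE * norm x powr (- ?d - real N - 1) * ((1 + norm y) powr (real N - 2 * p) + oseen_majorant t (x - y))"
    by (rule kernel_estimate[OF d p, of "\<nu> * T"]) blast
  obtain CK where CK: "CK \<ge> 0" "\<And>t. t > 0 \<Longrightarrow> integrable lborel (oseen_majorant t :: real^'d \<Rightarrow> real)"
     "\<And>t. t > 0 \<Longrightarrow> (LINT z|lborel. oseen_majorant t (z :: real^'d)) \<le> CK * t powr (- 1 / 2)"
    using oseen_majorant_integral[where 'd='d] by blast
  obtain CO where CO: "CO \<ge> 0" "\<And>i j t (z :: real^'d). t > 0 \<Longrightarrow> norm (oseen t i j z) \<le> CO * oseen_majorant t z"
    using oseen_bound[OF d] by blast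
  define Q where "Q = (LINT y|lebesgue. (1 + norm (y :: real^'d)) powr (real N - 2 * p))"
  have Q: "Q \<ge> 0" unfolding Q_def by (rule integral_nonneg_AE) simp
  have intN: "integrable lebesgue (\<lambda>y::real^'d. (1 + norm y) powr (real N - 2 * p))"
    by (rule integrable_bracket_powr_lebesgue) (use p in simp)
  have intP: "integrable lebesgue (\<lambda>y::real^'d. (1 + norm y) powr (- 2 * p))"
    by (rule integrable_bracket_powr_lebesgue) (use p in simp)
  have um: "u s \<in> borel_measurable lebesgue" if "s \<in> {0..T}" for s
    using cont sub that by (auto simp: continuous_Linf_def Linf_def)
  have Wm[measurable]: "W i j s \<in> borel_measurable lebesgue" if "s \<in> {0..T}" for i j s
  proof -
    have "(\<lambda>y. u s y $ k) \<in> borel_measurable lebesgue" for k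
      using measurable_compose[OF um[OF that], of "\<lambda>v. v $ k" borel] by simp
    then show ?thesis unfolding W_def by (intro borel_measurable_times)
  qed
  have Wb: "\<bar>W i j s y\<bar> \<le> H\<^sup>2 * (1 + norm y) powr (- 2 * p)" if "s \<in> {0..T}" for i j s y
    unfolding W_def by (rule product_decay[OF bound[OF that]])
  have Wconv: "AE y in lebesgue. (\<lambda>n. W i j (X n) y) \<longlonglongrightarrow> W i j s y"
    if "s \<in> {0..T}" "\<And>n. X n \<in> {0..T} - {s}" "X \<longlonglongrightarrow> s" for X s i j
  proof -
    have "AE y in lebesgue. (\<lambda>n. u (X n) y) \<longlonglongrightarrow> u s y"
      by (rule AE_tendsto_of_Linf[OF cont]) (use that sub in auto)
    then show ?thesis unfolding W_def by eventually_elim (intro tendsto_intros)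
  qed
  have pm: "(\<lambda>y::real^'d. mi_power y \<alpha>) \<in> borel_measurable lebesgue" for \<alpha>
    by (rule measurable_completion) (simp add: mi_power_def)
  have Wp: "norm (mi_power y \<alpha> * W i j s y) \<le> H\<^sup>2 * (1 + norm y) powr (real N - 2 * p)"
    if "s \<in> {0..T}" "mi_abs \<alpha> \<le> N" for i j s y \<alpha>
  proof -
    have "\<bar>mi_power y \<alpha>\<bar> \<le> norm y ^ mi_abs \<alpha>" by (rule mi_power_bound)
    also have "\<dots> \<le> (1 + norm y) ^ mi_abs \<alpha>" by (intro power_mono) auto
    also have "\<dots> \<le> (1 + norm y) ^ N" using that by (intro power_increasing) auto
    also have "\<dots> = (1 + norm y) powr real N" by (subst powr_realpow) (auto simp: add_pos_nonneg)
    finally have "\<bar>mi_power y \<alpha>\<bar> * \<bar>W i j s y\<bar> \<le> (1 + norm y) powr real N * (H\<^sup>2 * (1 + norm y) powr (- 2 * p))"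
      using Wb[OF that(1)] by (intro mult_mono) auto
    also have "\<dots> = H\<^sup>2 * ((1 + norm y) powr real N * (1 + norm y) powr (- 2 * p))" by simp
    also have "(1 + norm y) powr real N * (1 + norm y) powr (- 2 * p) = (1 + norm y) powr (real N - 2 * p)"
      by (simp flip: powr_add)
    finally show ?thesis by (simp add: abs_mult)
  qed
  have mom: "moment u \<alpha> i j s = (LINT y|lebesgue. mi_power y \<alpha> * W i j s y)" for \<alpha> i j s
    by (simp add: moment_def W_def mult.assoc)
  have Wpm: "(\<lambda>y. mi_power y \<alpha> * W i j s y) \<in> borel_measurable lebesgue" if "s \<in> {0..T}" for \<alpha> i j s
    by (intro borel_measurable_times pm Wm that)
  have Wpi: "integrable lebesgue (\<lambda>y. mi_power y \<alpha> * W i j s y)" if "s \<in> {0..T}" "mi_abs \<alpha> \<le> N" for \<alpha> i j s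
  proof (rule Bochner_Integration.integrable_bound[OF integrable_mult_right[OF intN, of "H\<^sup>2"] Wpm[OF that(1)]])
    show "AE y in lebesgue. norm (mi_power y \<alpha> * W i j s y) \<le> norm (H\<^sup>2 * (1 + norm y) powr (real N - 2 * p))"
      by (intro AE_I2 order_trans[OF Wp[OF that]]) simp
  qed
  have mcont: "continuous_on {0..T} (moment u \<alpha> i j)" if "mi_abs \<alpha> \<le> N" for \<alpha> i j
  proof -
    have "continuous_on {0..T} (\<lambda>s. LINT y|lebesgue. mi_power y \<alpha> * W i j s y)"
    proof (rule continuous_on_parametric_integral[where B = "\<lambda>y. H\<^sup>2 * (1 + norm y) powr (real N - 2 * p)"])
      show "AE y in lebesgue. (\<lambda>n. mi_power y \<alpha> * W i j (X n) y) \<longlonglongrightarrow> mi_power y \<alpha> * W i j s y"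
        if "s \<in> {0..T}" "\<And>n. X n \<in> {0..T} - {s}" "X \<longlonglongrightarrow> s" for X s
        using Wconv[OF that] by eventually_elim (intro tendsto_intros)
    qed (use Wpm Wp that intN in auto)
    then show ?thesis by (simp add: mom)
  qed
  have mi: "integrable lebesgue (\<lambda>s. indicator {0..t} s * moment u \<alpha> i j s)"
    if "mi_abs \<alpha> \<le> N" "t \<le> T" for \<alpha> i j t
  proof -
    have "continuous_on {0..t} (moment u \<alpha> i j)" by (rule continuous_on_subset[OF mcont[OF that(1)]]) (use that in auto)
    then have "set_integrable lborel {0..t} (moment u \<alpha> i j)" by (rule borel_integrable_atLeastAtMost')
    then show ?thesis unfolding set_integrable_def by (subst integrable_completion) auto
  qed
  \<comment> \<open>The two cardinalities count the pairs (i, j). Inside, Q T integrates the weight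
    term over time and 2 T^{1/2} integrates (t - s)^{-1/2}.\<close>
  define C where "C = real CARD('d) * (real CARD('d) * (H\<^sup>2 * CE * (Q * T + CK * \<nu> powr (- 1 / 2) * (2 * T powr (1 / 2)))))"
  have main: "norm (moment_sum N u t x - (LINT s:{0..t}|lebesgue. heat_leray_div (\<nu> * (t - s)) (\<lambda>y. outer (u s y) (u s y)) x))
    \<le> C * norm x powr (- ?d - real N - 1)" if t: "0 < t" "t \<le> T" and x: "norm x \<ge> 1" for t x
  proof -
    define V where "V \<alpha> i j = ((- 1) ^ mi_abs \<alpha> / mi_fact \<alpha>) *\<^sub>R grad (mi_partial \<alpha> (K i j)) x" for \<alpha> i j
    define X where "X = norm x powr (- ?d - real N - 1)"
    have X: "X \<ge> 0" by (simp add: X_def)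
    define a where "a i j s = (LINT y|lebesgue. W i j s y *\<^sub>R oseen (\<nu> * (t - s)) i j (x - y))" for i j s
    define m where "m i j s = (LINT y|lebesgue. W i j s y *\<^sub>R kernel_poly N i j x y)" for i j s
    have om: "(\<lambda>y. oseen \<tau> i j (x - y)) \<in> borel_measurable lebesgue" if "\<tau> > 0" for \<tau> i j
      by (rule measurable_completion, rule measurable_compose[where f = "\<lambda>y. x - y", OF _ oseen_measurable[OF d that]]) simp
    have mexp: "W i j s y *\<^sub>R kernel_poly N i j x y = (\<Sum>\<alpha> | mi_abs \<alpha> \<le> N. (mi_power y \<alpha> * W i j s y) *\<^sub>R V \<alpha> i j)" for i j s y
      by (simp add: kernel_poly_def V_def scaleR_sum_right mult_ac)
    have intm: "integrable lebesgue (\<lambda>y. W i j s y *\<^sub>R kernel_poly N i j x y)" if "s \<in> {0..T}" for i j s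
      unfolding mexp using that by (intro Bochner_Integration.integrable_sum integrable_scaleR_left Wpi) auto
    have m_eq: "m i j s = (\<Sum>\<alpha> | mi_abs \<alpha> \<le> N. moment u \<alpha> i j s *\<^sub>R V \<alpha> i j)" if "s \<in> {0..T}" for i j s
    proof -
      have "m i j s = (\<Sum>\<alpha> | mi_abs \<alpha> \<le> N. LINT y|lebesgue. (mi_power y \<alpha> * W i j s y) *\<^sub>R V \<alpha> i j)"
        unfolding m_def mexp using that by (intro Bochner_Integration.integral_sum integrable_scaleR_left Wpi) auto
      also have "\<dots> = (\<Sum>\<alpha> | mi_abs \<alpha> \<le> N. moment u \<alpha> i j s *\<^sub>R V \<alpha> i j)"
        unfolding mom using that by (intro sum.cong refl integral_scaleR_left Wpi) auto
      finally show ?thesis .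
    qed
    have ob: "norm (W i j s y *\<^sub>R oseen \<tau> i j (x - y)) \<le> H\<^sup>2 * (1 + norm y) powr (- 2 * p) * (CO * B)"
      if "s \<in> {0..T}" "\<tau> > 0" "oseen_majorant \<tau> (x - y) \<le> B" for i j s y \<tau> B
    proof -
      have "norm (oseen \<tau> i j (x - y)) \<le> CO * B"
        using CO(2)[OF that(2), of i j "x - y"] mult_left_mono[OF that(3) CO(1)] by linarith
      then show ?thesis using Wb[OF that(1)] unfolding norm_scaleR by (intro mult_mono) auto
    qed
    have into: "integrable lebesgue (\<lambda>y. W i j s y *\<^sub>R oseen \<tau> i j (x - y))" if s: "s \<in> {0..T}" and "\<tau> > 0" for i j s \<tau>
    proof -
      obtain B where B: "B \<ge> 0" "\<And>t' (z :: real^'d). t' \<ge> \<tau> \<Longrightarrow> oseen_majorant t' z \<le> B"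
        using oseen_majorant_bounded[OF \<open>\<tau> > 0\<close>, where 'd='d] by blast
      show ?thesis
      proof (rule Bochner_Integration.integrable_bound)
        show "integrable lebesgue (\<lambda>y::real^'d. H\<^sup>2 * (1 + norm y) powr (- 2 * p) * (CO * B))"
          by (intro integrable_mult_left integrable_mult_right intP)
        show "(\<lambda>y. W i j s y *\<^sub>R oseen \<tau> i j (x - y)) \<in> borel_measurable lebesgue"
          by (intro borel_measurable_scaleR Wm om that)
        show "AE y in lebesgue. norm (W i j s y *\<^sub>R oseen \<tau> i j (x - y)) \<le> norm (H\<^sup>2 * (1 + norm y) powr (- 2 * p) * (CO * B))"
          unfolding real_norm_def[of "_ * (CO * B)"]
          by (intro AE_I2 order_trans[OF ob[OF that B(2)] abs_ge_self]) simp
      qed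
    qed
    have acont: "continuous_on {0..<t} (a i j)" for i j
      unfolding continuous_on_eq_continuous_within
    proof
      fix s assume s: "s \<in> {0..<t}"
      \<comment> \<open>The kernel degenerates as s tends to t. Up to the midpoint t1 its time stays
        above \<nu>(t - t1), so the majorant is bounded there and domination is possible.\<close>
      define t1 where "t1 = (s + t) / 2"
      have t1: "s < t1" "t1 < t" using s by (auto simp: t1_def)
      have \<tau>: "\<nu> * (t - t1) > 0" using \<nu> t1 by simp
      obtain B where B: "B \<ge> 0" "\<And>t' (z :: real^'d). t' \<ge> \<nu> * (t - t1) \<Longrightarrow> oseen_majorant t' z \<le> B"
        using oseen_majorant_bounded[OF \<tau>, where 'd='d] by blast
      have pos: "\<nu> * (t - r) > 0" "\<nu> * (t - r) \<ge> \<nu> * (t - t1)" "r \<in> {0..T}" if "r \<in> {0..t1}" for r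
        using that t1 t \<nu> by auto
      have "continuous_on {0..t1} (a i j)"
        unfolding a_def
      proof (rule continuous_on_parametric_integral[where B = "\<lambda>y. H\<^sup>2 * (1 + norm y) powr (- 2 * p) * (CO * B)"])
        show "integrable lebesgue (\<lambda>y::real^'d. H\<^sup>2 * (1 + norm y) powr (- 2 * p) * (CO * B))"
          by (intro integrable_mult_left integrable_mult_right intP)
        show "(\<lambda>y. W i j r y *\<^sub>R oseen (\<nu> * (t - r)) i j (x - y)) \<in> borel_measurable lebesgue" if "r \<in> {0..t1}" for r
          by (intro borel_measurable_scaleR Wm om pos that)
        show "norm (W i j r y *\<^sub>R oseen (\<nu> * (t - r)) i j (x - y)) \<le> H\<^sup>2 * (1 + norm y) powr (- 2 * p) * (CO * B)"
          if "r \<in> {0..t1}" for r y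
          by (intro ob B(2) pos that)
        fix Y r assume r: "r \<in> {0..t1}" and Y: "\<And>n. Y n \<in> {0..t1} - {r}" "Y \<longlonglongrightarrow> r"
        have "AE y in lebesgue. (\<lambda>n. W i j (Y n) y) \<longlonglongrightarrow> W i j r y"
          by (rule Wconv) (use r Y pos(3) in auto)
        then show "AE y in lebesgue. (\<lambda>n. W i j (Y n) y *\<^sub>R oseen (\<nu> * (t - Y n)) i j (x - y))
           \<longlonglongrightarrow> W i j r y *\<^sub>R oseen (\<nu> * (t - r)) i j (x - y)"
        proof eventually_elim
          case (elim y)
          have "(\<lambda>n. oseen (\<nu> * (t - Y n)) i j (x - y)) \<longlonglongrightarrow> oseen (\<nu> * (t - r)) i j (x - y)"
          proof (rule continuous_on_tendsto_compose[OF continuous_on_oseen_time[OF d]])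
            show "(\<lambda>n. \<nu> * (t - Y n)) \<longlonglongrightarrow> \<nu> * (t - r)" using Y(2) by (intro tendsto_intros)
            show "\<nu> * (t - r) \<in> {0<..}" using pos(1)[OF r] by simp
            show "\<forall>\<^sub>F n in sequentially. \<nu> * (t - Y n) \<in> {0<..}"
              using pos(1) Y(1) by (intro always_eventually allI) auto
          qed
          with elim show ?case by (intro tendsto_intros)
        qed
      qed
      then have "continuous (at s within {0..t1}) (a i j)"
        using s t1 by (auto simp: continuous_on_eq_continuous_within)
      moreover have "at s within {0..t1} = at s within {0..<t}"
        by (rule at_within_nhd[of s "{..<t1}"]) (use s t1 in auto)
      ultimately show "continuous (at s within {0..<t}) (a i j)" by simp
    qed
    have am: "(\<lambda>s. indicator {0..t} s *\<^sub>R a i j s) \<in> borel_measurable lebesgue" for i j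
    proof -
      \<comment> \<open>Continuity is known on the half-open interval; the endpoint, where the
        kernel time is 0, is added as a single point.\<close>
      have "(\<lambda>s. indicator {0..<t} s *\<^sub>R a i j s + indicator {t} s *\<^sub>R a i j t) \<in> borel_measurable borel"
        by (intro borel_measurable_add borel_measurable_continuous_on_indicator acont borel_measurable_scaleR) auto
      also have "(\<lambda>s. indicator {0..<t} s *\<^sub>R a i j s + indicator {t} s *\<^sub>R a i j t) = (\<lambda>s. indicator {0..t} s *\<^sub>R a i j s)"
        using t by (auto split: split_indicator)
      finally show ?thesis by (intro measurable_completion) simp
    qed
    have mint: "integrable lebesgue (\<lambda>s. indicator {0..t} s *\<^sub>R m i j s)"
      and mval: "(LINT s|lebesgue. indicator {0..t} s *\<^sub>R m i j s) = (\<Sum>\<alpha> | mi_abs \<alpha> \<le> N. (LINT s:{0..t}|lebesgue. moment u \<alpha> i j s) *\<^sub>R V \<alpha> i j)" for i j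
    proof -
      have eq: "(\<lambda>s. indicator {0..t} s *\<^sub>R m i j s) = (\<lambda>s. \<Sum>\<alpha> | mi_abs \<alpha> \<le> N. (indicator {0..t} s * moment u \<alpha> i j s) *\<^sub>R V \<alpha> i j)"
      proof
        fix s show "indicator {0..t} s *\<^sub>R m i j s = (\<Sum>\<alpha> | mi_abs \<alpha> \<le> N. (indicator {0..t} s * moment u \<alpha> i j s) *\<^sub>R V \<alpha> i j)"
          using m_eq[of s i j] t by (cases "s \<in> {0..t}") auto
      qed
      show "integrable lebesgue (\<lambda>s. indicator {0..t} s *\<^sub>R m i j s)"
        unfolding eq using t by (intro Bochner_Integration.integrable_sum integrable_scaleR_left mi) auto
      show "(LINT s|lebesgue. indicator {0..t} s *\<^sub>R m i j s) = (\<Sum>\<alpha> | mi_abs \<alpha> \<le> N. (LINT s:{0..t}|lebesgue. moment u \<alpha> i j s) *\<^sub>R V \<alpha> i j)"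
      proof -
        have "(LINT s|lebesgue. indicator {0..t} s *\<^sub>R m i j s) = (\<Sum>\<alpha> | mi_abs \<alpha> \<le> N. LINT s|lebesgue. (indicator {0..t} s * moment u \<alpha> i j s) *\<^sub>R V \<alpha> i j)"
          unfolding eq using t by (intro Bochner_Integration.integral_sum integrable_scaleR_left mi) auto
        also have "\<dots> = (\<Sum>\<alpha> | mi_abs \<alpha> \<le> N. (LINT s:{0..t}|lebesgue. moment u \<alpha> i j s) *\<^sub>R V \<alpha> i j)"
          unfolding set_lebesgue_integral_def real_scaleR_def using t by (intro sum.cong refl integral_scaleR_left mi) auto
        finally show ?thesis .
      qed
    qed
    define g where "g s = H\<^sup>2 * CE * X * Q * indicator {0..<t} s
        + H\<^sup>2 * CE * X * CK * \<nu> powr (- 1 / 2) * (indicator {0..<t} s * (t - s) powr (- 1 / 2))" for s :: real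
    have err: "norm (m i j s - a i j s) \<le> H\<^sup>2 * CE * X * (Q + CK * (\<nu> * (t - s)) powr (- 1 / 2))" if s: "s \<in> {0..<t}" for i j s
    proof -
      let ?\<tau> = "\<nu> * (t - s)"
      have sT: "s \<in> {0..T}" and \<tau>: "?\<tau> > 0" "?\<tau> \<le> \<nu> * T" using s t \<nu> by auto
      have "m i j s - a i j s = (LINT y|lebesgue. W i j s y *\<^sub>R (kernel_poly N i j x y - oseen ?\<tau> i j (x - y)))"
        unfolding m_def a_def scaleR_diff_right by (rule Bochner_Integration.integral_diff[symmetric, OF intm[OF sT] into[OF sT \<tau>(1)]])
      also have "norm \<dots> \<le> (LINT y|lebesgue. norm (W i j s y *\<^sub>R (kernel_poly N i j x y - oseen ?\<tau> i j (x - y))))"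
        by (rule integral_norm_bound)
      also have "\<dots> \<le> (LINT y|lebesgue. H\<^sup>2 * CE * X * ((1 + norm y) powr (real N - 2 * p) + oseen_majorant ?\<tau> (x - y)))"
      proof (rule integral_mono)
        show "integrable lebesgue (\<lambda>y. norm (W i j s y *\<^sub>R (kernel_poly N i j x y - oseen ?\<tau> i j (x - y))))"
          unfolding scaleR_diff_right by (intro integrable_norm Bochner_Integration.integrable_diff intm into sT \<tau>)
        have "integrable lborel (\<lambda>y. oseen_majorant ?\<tau> (x - y))"
          using CK(2)[OF \<tau>(1)] by (subst lborel_integral_reflect(2)) (auto dest: borel_measurable_integrable)
        then have "integrable lebesgue (\<lambda>y. oseen_majorant ?\<tau> (x - y))"
          by (subst integrable_completion) (auto dest: borel_measurable_integrable)
        then show "integrable lebesgue (\<lambda>y. H\<^sup>2 * CE * X * ((1 + norm y) powr (real N - 2 * p) + oseen_majorant ?\<tau> (x - y)))"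
          by (intro integrable_mult_right Bochner_Integration.integrable_add intN)
        fix y
        have "norm (W i j s y *\<^sub>R (kernel_poly N i j x y - oseen ?\<tau> i j (x - y)))
           \<le> H\<^sup>2 * (1 + norm y) powr (- 2 * p) * norm (oseen ?\<tau> i j (x - y) - kernel_poly N i j x y)"
          unfolding norm_scaleR norm_minus_commute[of "kernel_poly N i j x y"] by (intro mult_right_mono Wb sT) auto
        also have "\<dots> \<le> H\<^sup>2 * (CE * X * ((1 + norm y) powr (real N - 2 * p) + oseen_majorant ?\<tau> (x - y)))"
          using CE(2)[OF \<tau> x, of y i j] unfolding X_def mult.assoc[of "H\<^sup>2"] by (intro mult_left_mono) auto
        finally show "norm (W i j s y *\<^sub>R (kernel_poly N i j x y - oseen ?\<tau> i j (x - y)))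
           \<le> H\<^sup>2 * CE * X * ((1 + norm y) powr (real N - 2 * p) + oseen_majorant ?\<tau> (x - y))"
          by (simp only: mult.assoc)
      qed
      also have "\<dots> = H\<^sup>2 * CE * X * (Q + (LINT z|lborel. oseen_majorant ?\<tau> (z :: real^'d)))"
      proof -
        have mk: "(oseen_majorant ?\<tau> :: real^'d \<Rightarrow> real) \<in> borel_measurable borel"
          using borel_measurable_integrable[OF CK(2)[OF \<tau>(1)]] by simp
        have i: "integrable lborel (\<lambda>y. oseen_majorant ?\<tau> (x - y))"
          using CK(2)[OF \<tau>(1)] mk by (subst lborel_integral_reflect(2)) auto
        then have i': "integrable lebesgue (\<lambda>y. oseen_majorant ?\<tau> (x - y))"
          by (subst integrable_completion) (auto dest: borel_measurable_integrable)
        have "(LINT y|lebesgue. oseen_majorant ?\<tau> (x - y)) = (LINT y|lborel. oseen_majorant ?\<tau> (x - y))"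
          using i by (intro integral_completion) (auto dest: borel_measurable_integrable)
        also have "\<dots> = (LINT z|lborel. oseen_majorant ?\<tau> (z :: real^'d))"
          by (rule lborel_integral_reflect(1)[OF mk])
        finally show ?thesis
          using intN i' by (simp add: Bochner_Integration.integral_add Q_def)
      qed
      also have "\<dots> \<le> H\<^sup>2 * CE * X * (Q + CK * ?\<tau> powr (- 1 / 2))"
        using CK(3)[OF \<tau>(1)] CE(1) X by (intro mult_left_mono add_left_mono) auto
      finally show ?thesis .
    qed
    \<comment> \<open>At s = t the kernel at time 0 is not controlled; that point is null and is
      discarded by \<open>AEt\<close>.\<close>
    have errg: "norm (indicator {0..t} s *\<^sub>R (m i j s - a i j s)) \<le> g s" if "s \<noteq> t" for i j s
    proof (cases "s \<in> {0..<t}")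
      case True
      have "(\<nu> * (t - s)) powr (- 1 / 2) = \<nu> powr (- 1 / 2) * (t - s) powr (- 1 / 2)" by (rule powr_mult)
      then show ?thesis using err[OF True, of i j] True by (simp add: g_def distrib_left mult.assoc)
    next
      case False
      then show ?thesis using that by (auto simp: g_def split: split_indicator)
    qed
    have AEt: "AE s in lebesgue. s \<noteq> t" using AE_lborel_singleton[of t] by (rule AE_completion)
    have gi: "integrable lborel g" and gv: "(LINT s|lborel. g s) = H\<^sup>2 * CE * X * Q * t + H\<^sup>2 * CE * X * CK * \<nu> powr (- 1 / 2) * (2 * t powr (1 / 2))"
    proof -
      have i1: "integrable lborel (\<lambda>s. H\<^sup>2 * CE * X * Q * indicator {0..<t} s)"
        by (intro integrable_mult_right integrable_real_indicator) (use t in auto)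
      have i2: "integrable lborel (\<lambda>s. H\<^sup>2 * CE * X * CK * \<nu> powr (- 1 / 2) * (indicator {0..<t} s * (t - s) powr (- 1 / 2)))"
        by (intro integrable_mult_right powr_minus_half_integral t)
      show "integrable lborel g" unfolding g_def by (rule Bochner_Integration.integrable_add[OF i1 i2])
      have "(LINT s|lborel. H\<^sup>2 * CE * X * Q * indicator {0..<t} s) = H\<^sup>2 * CE * X * Q * t"
        using t by simp
      moreover have "(LINT s|lborel. H\<^sup>2 * CE * X * CK * \<nu> powr (- 1 / 2) * (indicator {0..<t} s * (t - s) powr (- 1 / 2)))
        = H\<^sup>2 * CE * X * CK * \<nu> powr (- 1 / 2) * (2 * t powr (1 / 2))"
        unfolding integral_mult_right_zero powr_minus_half_integral(2)[OF t(1)] ..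
      ultimately show "(LINT s|lborel. g s) = H\<^sup>2 * CE * X * Q * t + H\<^sup>2 * CE * X * CK * \<nu> powr (- 1 / 2) * (2 * t powr (1 / 2))"
        unfolding g_def Bochner_Integration.integral_add[OF i1 i2] by (simp only:)
    qed
    have gi': "integrable lebesgue g" using gi by (subst integrable_completion) (auto dest: borel_measurable_integrable)
    have gv': "(LINT s|lebesgue. g s) = (LINT s|lborel. g s)" using gi by (intro integral_completion) (auto dest: borel_measurable_integrable)
    have eint: "integrable lebesgue (\<lambda>s. indicator {0..t} s *\<^sub>R (m i j s - a i j s))" for i j
    proof (rule Bochner_Integration.integrable_bound[OF gi'])
      show "(\<lambda>s. indicator {0..t} s *\<^sub>R (m i j s - a i j s)) \<in> borel_measurable lebesgue"
        unfolding scaleR_diff_right by (intro borel_measurable_diff am borel_measurable_integrable mint)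
      show "AE s in lebesgue. norm (indicator {0..t} s *\<^sub>R (m i j s - a i j s)) \<le> norm (g s)"
        using AEt by eventually_elim (use errg in \<open>auto intro: order_trans[OF _ abs_ge_self]\<close>)
    qed
    \<comment> \<open>Integrability in time of the nonlinear term is deduced indirectly: the Taylor
      part is integrable and the difference is dominated by g.\<close>
    have aint: "integrable lebesgue (\<lambda>s. indicator {0..t} s *\<^sub>R a i j s)" for i j
      using Bochner_Integration.integrable_diff[OF mint[of i j] eint[of i j]] by (simp add: scaleR_diff_right)
    have ebound: "norm ((LINT s|lebesgue. indicator {0..t} s *\<^sub>R m i j s) - (LINT s|lebesgue. indicator {0..t} s *\<^sub>R a i j s))
       \<le> H\<^sup>2 * CE * (Q * T + CK * \<nu> powr (- 1 / 2) * (2 * T powr (1 / 2))) * X" for i j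
    proof -
      have "(LINT s|lebesgue. indicator {0..t} s *\<^sub>R m i j s) - (LINT s|lebesgue. indicator {0..t} s *\<^sub>R a i j s)
        = (LINT s|lebesgue. indicator {0..t} s *\<^sub>R (m i j s - a i j s))"
        unfolding scaleR_diff_right by (rule Bochner_Integration.integral_diff[symmetric, OF mint aint])
      also have "norm \<dots> \<le> (LINT s|lebesgue. norm (indicator {0..t} s *\<^sub>R (m i j s - a i j s)))"
        by (rule integral_norm_bound)
      also have "\<dots> \<le> (LINT s|lebesgue. g s)"
        by (rule integral_mono_AE[OF integrable_norm[OF eint] gi']) (use AEt errg in \<open>auto elim!: eventually_mono\<close>)
      also have "\<dots> = H\<^sup>2 * CE * (Q * t + CK * \<nu> powr (- 1 / 2) * (2 * t powr (1 / 2))) * X"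
        unfolding gv' gv by (simp add: algebra_simps)
      also have "\<dots> \<le> H\<^sup>2 * CE * (Q * T + CK * \<nu> powr (- 1 / 2) * (2 * T powr (1 / 2))) * X"
        using t Q X CE(1) CK(1) by (intro mult_right_mono mult_left_mono add_mono powr_mono2) auto
      finally show ?thesis .
    qed
    have L: "(LINT s:{0..t}|lebesgue. heat_leray_div (\<nu> * (t - s)) (\<lambda>y. outer (u s y) (u s y)) x)
       = (\<Sum>i\<in>UNIV. \<Sum>j\<in>UNIV. LINT s|lebesgue. indicator {0..t} s *\<^sub>R a i j s)"
    proof -
      have "heat_leray_div (\<nu> * (t - s)) (\<lambda>y. outer (u s y) (u s y)) x = (\<Sum>i\<in>UNIV. \<Sum>j\<in>UNIV. a i j s)" for s
        unfolding heat_leray_div_def a_def W_def by (simp add: outer_def)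
      then have "(LINT s:{0..t}|lebesgue. heat_leray_div (\<nu> * (t - s)) (\<lambda>y. outer (u s y) (u s y)) x)
        = (LINT s|lebesgue. (\<Sum>i\<in>UNIV. \<Sum>j\<in>UNIV. indicator {0..t} s *\<^sub>R a i j s))"
        by (simp add: set_lebesgue_integral_def scaleR_sum_right)
      also have "\<dots> = (\<Sum>i\<in>UNIV. LINT s|lebesgue. (\<Sum>j\<in>UNIV. indicator {0..t} s *\<^sub>R a i j s))"
        by (intro Bochner_Integration.integral_sum Bochner_Integration.integrable_sum aint)
      also have "\<dots> = (\<Sum>i\<in>UNIV. \<Sum>j\<in>UNIV. LINT s|lebesgue. indicator {0..t} s *\<^sub>R a i j s)"
        by (intro sum.cong refl Bochner_Integration.integral_sum aint)
      finally show ?thesis .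
    qed
    have M: "moment_sum N u t x = (\<Sum>i\<in>UNIV. \<Sum>j\<in>UNIV. LINT s|lebesgue. indicator {0..t} s *\<^sub>R m i j s)"
    proof -
      have "moment_sum N u t x = (\<Sum>\<alpha> | mi_abs \<alpha> \<le> N. \<Sum>i\<in>UNIV. \<Sum>j\<in>UNIV. (LINT s:{0..t}|lebesgue. moment u \<alpha> i j s) *\<^sub>R V \<alpha> i j)"
        by (simp add: moment_sum_def V_def scaleR_sum_right mult.commute)
      also have "\<dots> = (\<Sum>i\<in>UNIV. \<Sum>\<alpha> | mi_abs \<alpha> \<le> N. \<Sum>j\<in>UNIV. (LINT s:{0..t}|lebesgue. moment u \<alpha> i j s) *\<^sub>R V \<alpha> i j)"
        by (rule sum.swap)
      also have "\<dots> = (\<Sum>i\<in>UNIV. \<Sum>j\<in>UNIV. \<Sum>\<alpha> | mi_abs \<alpha> \<le> N. (LINT s:{0..t}|lebesgue. moment u \<alpha> i j s) *\<^sub>R V \<alpha> i j)"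
        by (intro sum.cong refl sum.swap)
      finally show ?thesis unfolding mval .
    qed
    have "norm ((\<Sum>i\<in>UNIV. \<Sum>j\<in>UNIV. LINT s|lebesgue. indicator {0..t} s *\<^sub>R m i j s)
       - (\<Sum>i\<in>UNIV. \<Sum>j\<in>UNIV. LINT s|lebesgue. indicator {0..t} s *\<^sub>R a i j s))
      = norm (\<Sum>i\<in>UNIV. \<Sum>j\<in>UNIV. (LINT s|lebesgue. indicator {0..t} s *\<^sub>R m i j s) - (LINT s|lebesgue. indicator {0..t} s *\<^sub>R a i j s))"
      by (simp add: sum_subtractf)
    also have "\<dots> \<le> (\<Sum>i\<in>(UNIV::'d set). \<Sum>j\<in>(UNIV::'d set). H\<^sup>2 * CE * (Q * T + CK * \<nu> powr (- 1 / 2) * (2 * T powr (1 / 2))) * X)"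
      by (intro sum_norm_le ebound)
    also have "\<dots> = C * X" by (simp add: C_def)
    finally show ?thesis unfolding M L X_def .
  qed
  show ?thesis
  \<comment> \<open>T is an arbitrary real here and may be negative, so the sign of C is secured by
    its absolute value.\<close>
  proof (rule that[OF abs_ge_zero[of C]])
    fix t and x :: "real^'d" assume "0 < t" "t \<le> T" "norm x \<ge> 1"
    from order_trans[OF main[OF this] mult_right_mono[OF abs_ge_self powr_ge_zero]]
    show "norm (moment_sum N u t x - (LINT s:{0..t}|lebesgue. heat_leray_div (\<nu> * (t - s)) (\<lambda>y. outer (u s y) (u s y)) x))
      \<le> \<bar>C\<bar> * norm x powr (- real CARD('d) - real N - 1)" .
  qed
qed

lemma continuous_on_moment_sum:
  assumes d: "CARD('d) \<ge> 2"
  shows "continuous_on (- {0}) (moment_sum N u t :: real^'d::finite \<Rightarrow> _)"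
proof -
  have "continuous_on (- {0}) (grad (mi_partial \<alpha> (K i j)) :: real^'d \<Rightarrow> _)" for \<alpha> and i j :: 'd
    unfolding grad_def[abs_def]
    by (intro continuous_on_vec_lambda continuous_at_imp_continuous_on ballI
        homog_isCont[OF homog_partial[OF homog_mi_partial[OF homog_K[OF d]]]]) auto
  then show ?thesis unfolding moment_sum_def[abs_def] by (intro continuous_intros)
qed

theorem proposition3p7:
  fixes \<nu> p :: real
    and u0 :: "real ^ 'd \<Rightarrow> real ^ 'd"
    and u :: "real \<Rightarrow> real ^ 'd \<Rightarrow> real ^ 'd"
    and h :: "real \<Rightarrow> real"
    and Tmax :: ereal
    and I :: "real set"
    and N :: nat
  assumes "CARD('d) \<ge> 2"
    and "\<nu> > 0"
    and "real CARD('d) / 2 + 1 < p"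
    and "u0 \<in> Linf"
    and "Tmax = lifespan \<nu> u0"
    and "I = {t. 0 \<le> t \<and> ereal t < Tmax}"
    and "mild_solution \<nu> u0 I u"
    and "u 0 = u0"
    and "mono_on I h"
    and "\<And>t. t \<in> I \<Longrightarrow> 0 \<le> h t"
    and "\<And>t x. t \<in> I \<Longrightarrow> t > 0 \<Longrightarrow> u t differentiable (at x)"
    and "\<And>t x. t \<in> I \<Longrightarrow>
           norm (u t x) + sqrt (\<nu> * t) * norm (jacobian (u t) (at x))
             \<le> h t * (1 + norm x) powr (- p)"
    and "1 \<le> N"
    and "real N < 2 * p - real CARD('d) - 1"
  shows "\<exists>R1 R2 :: real ^ 'd \<Rightarrow> real \<Rightarrow> real ^ 'd.
    (\<forall>x. \<forall>t\<in>I. norm x \<ge> 1 \<longrightarrow>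
       u t x = heat_flow (\<nu> * t) u0 x
         - (\<Sum>\<alpha> | mi_abs \<alpha> \<le> N. ((- 1) ^ mi_abs \<alpha> / mi_fact \<alpha>) *\<^sub>R
              (\<Sum>i\<in>UNIV. \<Sum>j\<in>UNIV.
                 (LINT s:{0..t}|lebesgue. moment u \<alpha> i j s) *\<^sub>R grad (mi_partial \<alpha> (K i j)) x))
         + R1 x t + R2 x t) \<and>
    (\<forall>T'\<in>I.
       (\<exists>C::real. \<forall>\<^sub>F x in at_infinity.
          (SUP t\<in>{0..T'}. ereal (norm (R1 x t)))
            \<le> ereal (C * norm x powr (- real CARD('d) - real N - 1))) \<and>
       (\<exists>C::real. \<forall>\<^sub>F x in at_infinity.
          (SUP t\<in>{0..T'}. ereal (norm (R2 x t))) \<le> ereal (C * norm x powr (- 2 * p))))"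
proof -
  note d = assms(1) and \<nu> = assms(2) and hmono = assms(9) and diff = assms(11) and decay = assms(12) and p = assms(14)
  have cont: "continuous_Linf I u" and mild: "\<And>t. t \<in> I \<Longrightarrow> AE x in lebesgue. u t x = mild_rhs \<nu> u0 u t x"
    using assms(7) by (auto simp: mild_solution_def)
  let ?S = "moment_sum N u"
  \<comment> \<open>The whole defect of the expansion, so the identity holds for all x and t by
    definition and only the bound remains.\<close>
  define R where "R x t = u t x - heat_flow (\<nu> * t) u0 x + ?S t x" for x t
  let ?E = "- real CARD('d) - real N - 1"
  have u_bound: "norm (u t x) \<le> h t * (1 + norm x) powr (- p)" if "t \<in> I" for t x
  proof -
    have "0 \<le> sqrt (\<nu> * t) * norm (jacobian (u t) (at x))"
      using \<nu> that assms(6) by (intro mult_nonneg_nonneg) auto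
    then show ?thesis using decay[OF that, of x] by linarith
  qed
  have S0: "?S 0 x = 0" for x
  proof -
    have "(LINT s:{0..0}|lebesgue. moment u \<alpha> i j s) = 0" for \<alpha> i j
      unfolding set_lebesgue_integral_def
      by (rule integral_eq_zero_AE, rule eventually_mono[OF AE_completion[OF AE_lborel_singleton[of 0]]]) simp
    then show ?thesis by (simp add: moment_sum_def)
  qed
  have bound: "\<exists>C::real. \<forall>\<^sub>F x in at_infinity. (SUP t\<in>{0..T}. ereal (norm (R x t))) \<le> ereal (C * norm x powr ?E)"
    if T: "T \<in> I" for T
  proof -
    have sub: "{0..T} \<subseteq> I" using T assms(6) by (auto intro: le_less_trans[of "ereal _" "ereal T"])
    have T0: "0 \<in> I" "0 \<le> T" using T assms(6) sub by auto
    have ub: "norm (u s y) \<le> h T * (1 + norm y) powr (- p)" if "s \<in> {0..T}" for s y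
    proof -
      have "s \<in> I" "h s \<le> h T" using that sub T hmono by (auto simp: mono_on_def)
      then show ?thesis using u_bound[of s y] by (meson mult_right_mono order_trans powr_ge_zero)
    qed
    obtain C where C: "C \<ge> 0" "\<And>t x. 0 < t \<Longrightarrow> t \<le> T \<Longrightarrow> norm x \<ge> 1 \<Longrightarrow>
      norm (?S t x - (LINT s:{0..t}|lebesgue. heat_leray_div (\<nu> * (t - s)) (\<lambda>y. outer (u s y) (u s y)) x)) \<le> C * norm x powr ?E"
      by (rule nonlinear_expansion[OF d \<nu> p cont sub ub], assumption) (rule that)
    \<comment> \<open>The strict inequality keeps the region open, which the passage from almost
      everywhere to everywhere requires. At t = 0 the remainder vanishes, since
      \<open>u 0 = u0\<close> holds pointwise.\<close>
    have Rb: "norm (R x t) \<le> C * norm x powr ?E" if t: "t \<in> {0..T}" and x: "norm x > 1" for t x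
    proof (cases "t = 0")
      case True
      then show ?thesis using C(1) assms(8) by (simp add: R_def S0 heat_flow_def)
    next
      case False
      then have t0: "0 < t" "t \<le> T" "t \<in> I" using t sub by auto
      let ?B = "{x. norm x > 1 \<and> norm (R x t) - C * norm x powr ?E > 0}"
      have ae: "AE x in lebesgue. x \<notin> ?B"
        using mild[OF t0(3)]
      proof eventually_elim
        case (elim x)
        have "R x t = ?S t x - (LINT s:{0..t}|lebesgue. heat_leray_div (\<nu> * (t - s)) (\<lambda>y. outer (u s y) (u s y)) x)"
          unfolding R_def elim mild_rhs_def by simp
        then show ?case using C(2)[OF t0(1,2), of x] by auto
      qed
      have "u0 \<in> borel_measurable lebesgue" using assms(4) by (simp add: Linf_def)
      \<comment> \<open>Membership in \<open>Linf\<close> bounds u0 only essentially; the pointwise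
        bound comes from the decay hypothesis at t = 0.\<close>
      moreover have "norm (u0 y) \<le> h 0" for y
      proof -
        have "norm (u0 y) \<le> h 0 * (1 + norm y) powr (- p)" using u_bound[OF T0(1), of y] assms(8) by simp
        also have "\<dots> \<le> h 0 * (1 + norm y) powr 0"
          using assms(3) assms(10)[OF T0(1)] by (intro mult_left_mono powr_mono) (auto intro: less_imp_le less_trans[of 0 "real CARD('d) / 2 + 1"])
        also have "(1 + norm y) powr 0 = 1" using norm_ge_zero[of y] by (simp add: add_nonneg_eq_0_iff)
        finally show ?thesis by simp
      qed
      ultimately have "continuous_on UNIV (heat_flow (\<nu> * t) u0)"
        using \<nu> t0 by (intro continuous_on_heat_flow) auto
      moreover have "continuous_on UNIV (u t)"
        using diff[OF t0(3,1)] by (intro continuous_at_imp_continuous_on ballI differentiable_imp_continuous_within)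
      moreover have "continuous_on (- {0}) (?S t)"
        by (rule continuous_on_moment_sum[OF d])
      ultimately have "continuous_on {x. norm x > 1} (\<lambda>x. R x t)"
        unfolding R_def by (intro continuous_intros) (auto elim: continuous_on_subset)
      then have "continuous_on {x. norm x > 1} (\<lambda>x. norm (R x t) - C * norm x powr ?E)"
        by (intro continuous_intros) auto
      moreover have "open {x::real^'d. norm x > 1}" by (intro open_Collect_less continuous_intros)
      ultimately have "open ({x. norm x > 1} \<inter> (\<lambda>x. norm (R x t) - C * norm x powr ?E) -` {0<..})"
        by (rule continuous_open_preimage) auto
      also have "{x. norm x > 1} \<inter> (\<lambda>x. norm (R x t) - C * norm x powr ?E) -` {0<..} = ?B" by auto
      finally have "?B = {}" by (rule open_AE_empty[OF _ ae])
      then have "x \<notin> ?B" by (metis empty_iff)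
      then show ?thesis using x by simp
    qed
    have "\<forall>\<^sub>F x::real^'d in at_infinity. norm x > 1"
      unfolding eventually_at_infinity by (rule exI[of _ 2]) auto
    then have "\<forall>\<^sub>F x in at_infinity. (SUP t\<in>{0..T}. ereal (norm (R x t))) \<le> ereal (C * norm x powr ?E)"
      by (rule eventually_mono) (intro SUP_least, simp add: Rb)
    then show ?thesis by blast
  qed
  show ?thesis
  proof (rule exI[of _ R], rule exI[of _ "\<lambda>_ _. 0"], intro conjI ballI allI impI)
    fix x t
    show "u t x = heat_flow (\<nu> * t) u0 x
         - (\<Sum>\<alpha> | mi_abs \<alpha> \<le> N. ((- 1) ^ mi_abs \<alpha> / mi_fact \<alpha>) *\<^sub>R
              (\<Sum>i\<in>UNIV. \<Sum>j\<in>UNIV.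
                 (LINT s:{0..t}|lebesgue. moment u \<alpha> i j s) *\<^sub>R grad (mi_partial \<alpha> (K i j)) x))
         + R x t + 0"
      unfolding R_def moment_sum_def by simp
  next
    fix T assume "T \<in> I"
    then show "\<exists>C::real. \<forall>\<^sub>F x in at_infinity. (SUP t\<in>{0..T}. ereal (norm (R x t))) \<le> ereal (C * norm x powr ?E)"
      by (rule bound)
  next
    fix T
    show "\<exists>C::real. \<forall>\<^sub>F x::real^'d in at_infinity. (SUP t\<in>{0..T}. ereal (norm (0 :: real^'d))) \<le> ereal (C * norm x powr (- 2 * p))"
      by (intro exI[of _ 0] always_eventually allI SUP_least) simp
  qed
qed

end
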